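(* Let $g$ and $N$ be positive integers and let $\mathbf{r},\mathbf{s}\in\frac1N\mathbb{Z}^g$. The function $\Theta(\left[\begin{smallmatrix}\mathbf{r}\\ \mathbf{s}\end{smallmatrix}\right],Z)$ of $Z\in\mathbb{H}_g$ (defined in the context) belongs to $\mathcal{F}_N=\mathcal{A}_0(\Gamma(N),\mathbb{Q}(\zeta_N))$, where $\zeta_N=e^{2\pi\mathrm{i}/N}$.
   Context: **The function $\Theta$.** $\mathbb{H}_g=\{Z\in M_g(\mathbb{C}) : Z^T=Z,\ \mathrm{Im}(Z)\text{ positive definite}\}$, $e(x)=e^{2\pi \mathrm{i}x}$. For $\mathbf{r},\mathbf{s}\in\mathbb{Q}^g$, $Z\in\mathbb{H}_g$, $$\theta(\left[\begin{smallmatrix}\mathbf{r}\\ \mathbf{s}\end{smallmatrix}\right],Z)=\sum_{\mathbf{n}\in\mathbb{Z}^g}e\left(\tfrac12(\mathbf{n}+\mathbf{r})^TZ(\mathbf{n}+\mathbf{r})+(\mathbf{n}+\mathbf{r})^T\mathbf{s}\right).$$ Let $S_-$ (resp. $S_+$) be the set of $\left[\begin{smallmatrix}\mathbf{a}\\ \mathbf{b}\end{smallmatrix}\right]$ with $\mathbf{a},\mathbf{b}\in\{0,1/2\}^g$ and $e(2\mathbf{a}^T\mathbf{b})=-1$ (resp. $=1$). For $\mathbf{r},\mathbf{s}\in\frac1N\mathbb{Z}^g$ put $$\Theta(\left[\begin{smallmatrix}\mathbf{r}\\ \mathbf{s}\end{smallmatrix}\right],Z)=2^{4N}e\left(-2^gN(2^g-1)(2^g+1)\mathbf{r}^T\mathbf{s}\right)\frac{\prod_{\left[\begin{smallmatrix}\mathbf{a}\\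 \mathbf{b}\end{smallmatrix}\right]\in S_-}\theta(\left[\begin{smallmatrix}\mathbf{a}\\ \mathbf{b}\end{smallmatrix}\right]-\left[\begin{smallmatrix}\mathbf{r}\\ \mathbf{s}\end{smallmatrix}\right],Z)^{4N(2^g+1)}}{\prod_{\left[\begin{smallmatrix}\mathbf{c}\\ \mathbf{d}\end{smallmatrix}\right]\in S_+}\theta(\left[\begin{smallmatrix}\mathbf{c}\\ \mathbf{d}\end{smallmatrix}\right],Z)^{4N(2^g-1)}}.$$ **Siegel modular functions.** $\mathrm{Sp}_{2g}(\mathbb{Z})$ is defined by $\alpha^TJ\alpha=J$ with $J=\left[\begin{smallmatrix} O & -I_g \\ I_g & O \end{smallmatrix}\right]$ and acts on $\mathbb{H}_g$ by $\gamma(Z)=(AZ+B)(CZ+D)^{-1}$ for $\gamma=\left[\begin{smallmatrix} A & B \\ C & D \end{smallmatrix}\right]$ in $g\times g$ blocks. $\Gamma(M)=\{\gamma\in\mathrm{Sp}_{2g}(\mathbb{Z}) : \gamma\equiv I_{2g}\pmod M\}$. A Siegel modular form of weight $k$ and level $M$ is a holomorphic $f:\mathbb{H}_g\to\mathbb{C}$ with $f(\gamma(Z))=\det(CZ+D)^kf(Z)$ for all $\gamma\in\Gamma(M)$ (and holomorphic at every cusp when $g=1$). It has a Fourier expansion $f(Z)=\sum_\beta c(\beta)e(\mathrm{tr}(\beta Z)/M)$, $\beta$ running over $g\times g$ positive semi-definite symmetric matrices over half integers with integer diagonal entries; the $c(\beta)$ are its Fourier coefficients. For a subfield $F\subseteq\mathbb{C}$,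 $\mathcal{M}_k(F)$ is the set of Siegel modular forms of weight $k$ and some level $M\geq1$ with all Fourier coefficients in $F$. $\mathcal{A}_0(\Gamma(N),F)$ is the field of all meromorphic functions on $\mathbb{H}_g$ of the form $f_1/f_2$ with $f_1\in\mathcal{M}_k(F)$, $f_2\in\mathcal{M}_k(F)\setminus\{0\}$ for some $k$, which are invariant under $\Gamma(N)$. *)

theory Defs
  imports "HOL-Analysis.Analysis"
begin

text \<open>
  The genus is \<open>g = CARD('g)\<close>.  Vectors of length \<open>g\<close> are indexed by \<open>'g\<close>, and
  \<open>2g \<times> 2g\<close> matrices by the sum type \<open>'g + 'g\<close>, so that the four \<open>g \<times> g\<close> blocks are
  selected by \<open>Inl\<close> and \<open>Inr\<close>.
\<close>

definition e2pi :: "complex \<Rightarrow> complex" where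
  "e2pi x = exp (2 * of_real pi * \<i> * x)"

text \<open>The bilinear form \<open>v\<^sup>T w\<close>; on complex vectors the library's \<open>\<bullet>\<close> is the real inner
  product instead.\<close>

definition dotp :: "'a::comm_semiring_0 ^ 'n \<Rightarrow> 'a ^ 'n \<Rightarrow> 'a" where
  "dotp v w = (\<Sum>i\<in>UNIV. v $ i * w $ i)"

definition cvec :: "real ^ 'n \<Rightarrow> complex ^ 'n" where
  "cvec v = (\<chi> i. complex_of_real (v $ i))"

definition map_mat :: "('a \<Rightarrow> 'b) \<Rightarrow> 'a ^ 'n ^ 'm \<Rightarrow> 'b ^ 'n ^ 'm" where
  "map_mat h A = (\<chi> i j. h (A $ i $ j))"


section \<open>The Siegel upper half-space and the symplectic group\<close>

definition siegel_space :: "(complex ^ 'g ^ 'g) set" where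
  "siegel_space = {Z. transpose Z = Z \<and> (\<forall>x. x \<noteq> 0 \<longrightarrow> x \<bullet> (map_mat Im Z *v x) > 0)}"

definition symplectic_J :: "int ^ ('g::finite + 'g) ^ ('g + 'g)" where
  "symplectic_J = (\<chi> p q. case (p, q) of
      (Inl i, Inr j) \<Rightarrow> (if i = j then -1 else 0)
    | (Inr i, Inl j) \<Rightarrow> (if i = j then 1 else 0)
    | _ \<Rightarrow> 0)"

definition Sp_int :: "(int ^ ('g::finite + 'g) ^ ('g + 'g)) set" where
  "Sp_int = {\<alpha>. transpose \<alpha> ** symplectic_J ** \<alpha> = symplectic_J}"

definition principal_congruence :: "nat \<Rightarrow> (int ^ ('g::finite + 'g) ^ ('g + 'g)) set" where
  "principal_congruence M =
     {\<gamma> \<in> Sp_int. \<forall>p q. \<gamma> $ p $ q mod int M = (mat 1 :: int ^ ('g + 'g) ^ ('g + 'g)) $ p $ q mod int M}"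

definition blockA :: "int ^ ('g::finite + 'g) ^ ('g + 'g) \<Rightarrow> complex ^ 'g ^ 'g" where
  "blockA \<gamma> = (\<chi> i j. of_int (\<gamma> $ Inl i $ Inl j))"

definition blockB :: "int ^ ('g::finite + 'g) ^ ('g + 'g) \<Rightarrow> complex ^ 'g ^ 'g" where
  "blockB \<gamma> = (\<chi> i j. of_int (\<gamma> $ Inl i $ Inr j))"

definition blockC :: "int ^ ('g::finite + 'g) ^ ('g + 'g) \<Rightarrow> complex ^ 'g ^ 'g" where
  "blockC \<gamma> = (\<chi> i j. of_int (\<gamma> $ Inr i $ Inl j))"

definition blockD :: "int ^ ('g::finite + 'g) ^ ('g + 'g) \<Rightarrow> complex ^ 'g ^ 'g" where
  "blockD \<gamma> = (\<chi> i j. of_int (\<gamma> $ Inr i $ Inr j))"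

definition sp_act :: "int ^ ('g::finite + 'g) ^ ('g + 'g) \<Rightarrow> complex ^ 'g ^ 'g \<Rightarrow> complex ^ 'g ^ 'g" where
  "sp_act \<gamma> Z = (blockA \<gamma> ** Z + blockB \<gamma>) ** matrix_inv (blockC \<gamma> ** Z + blockD \<gamma>)"

definition aut_factor :: "int ^ ('g::finite + 'g) ^ ('g + 'g) \<Rightarrow> complex ^ 'g ^ 'g \<Rightarrow> complex" where
  "aut_factor \<gamma> Z = det (blockC \<gamma> ** Z + blockD \<gamma>)"


section \<open>Siegel modular forms\<close>

text \<open>Holomorphy in several variables: complex (Frechet) differentiability at every point.
  \<^const>\<open>siegel_space\<close> is open in the space of symmetric matrices, not in the space of all
  matrices, so the derivative is taken within it; only the restriction of \<open>D\<close> to symmetric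
  matrices is determined.  Here and below, the values of functions outside
  \<^const>\<open>siegel_space\<close> are irrelevant.\<close>

definition siegel_holomorphic :: "(complex ^ 'g ^ 'g \<Rightarrow> complex) \<Rightarrow> bool" where
  "siegel_holomorphic f \<longleftrightarrow> (\<forall>Z\<in>siegel_space. \<exists>D.
     (f has_derivative D) (at Z within siegel_space) \<and>
     (\<forall>c X. D (map_mat (\<lambda>x. c * x) X) = c * D X))"

definition fourier_index :: "(real ^ 'g ^ 'g) set" where
  "fourier_index = {\<beta>. transpose \<beta> = \<beta> \<and> (\<forall>i j. 2 * \<beta> $ i $ j \<in> \<int>) \<and> (\<forall>i. \<beta> $ i $ i \<in> \<int>) \<and>
     (\<forall>x. x \<bullet> (\<beta> *v x) \<ge> 0)}"

definition has_fourier_expansion ::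
  "nat \<Rightarrow> (complex ^ 'g ^ 'g \<Rightarrow> complex) \<Rightarrow> (real ^ 'g ^ 'g \<Rightarrow> complex) \<Rightarrow> bool" where
  "has_fourier_expansion M f c \<longleftrightarrow> (\<forall>Z\<in>siegel_space.
     ((\<lambda>\<beta>. c \<beta> * e2pi (trace (map_mat complex_of_real \<beta> ** Z) / of_nat M)) has_sum f Z) fourier_index)"

text \<open>For \<open>g = 1\<close>, holomorphy at every cusp is imposed by requiring that each transform of
  \<open>f\<close> under the full modular group has an expansion without negative exponents.  The width of
  every cusp divides \<open>M\<close>, since the principal congruence subgroup is normal.\<close>

definition siegel_modular_form :: "int \<Rightarrow> nat \<Rightarrow> (complex ^ 'g ^ 'g \<Rightarrow> complex) \<Rightarrow> bool" where
  "siegel_modular_form k M f \<longleftrightarrow>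
     siegel_holomorphic f \<and>
     (\<forall>\<gamma>\<in>principal_congruence M. \<forall>Z\<in>siegel_space. f (sp_act \<gamma> Z) = aut_factor \<gamma> Z powi k * f Z) \<and>
     (CARD('g) = 1 \<longrightarrow>
       (\<forall>\<gamma>\<in>Sp_int. \<exists>c. has_fourier_expansion M (\<lambda>Z. aut_factor \<gamma> Z powi (- k) * f (sp_act \<gamma> Z)) c))"

text \<open>The Fourier coefficients of a form are uniquely determined, so the existential
  quantifier over \<open>c\<close> only names them.\<close>

definition modular_forms_over :: "int \<Rightarrow> complex set \<Rightarrow> (complex ^ 'g ^ 'g \<Rightarrow> complex) set" where
  "modular_forms_over k F = {f. \<exists>M\<ge>1. siegel_modular_form k M f \<and>
     (\<exists>c. has_fourier_expansion M f c \<and> (\<forall>\<beta>\<in>fourier_index. c \<beta> \<in> F))}"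


section \<open>Siegel modular functions\<close>

text \<open>A meromorphic function on \<^const>\<open>siegel_space\<close> is represented by a fraction \<open>(p, q)\<close> of
  holomorphic functions with \<open>q\<close> not identically zero, standing for \<open>p / q\<close>.  Since
  \<^const>\<open>siegel_space\<close> is connected, two fractions are the same meromorphic function if and
  only if they are equal by cross-multiplication.  Pairs are used rather than a total function
  \<open>\<lambda>Z. p Z / q Z\<close> so that no arbitrary value at zeros of the denominator enters, and so that a
  fraction with identically vanishing denominator is not a meromorphic function.\<close>

type_synonym 'g siegel_fraction =
  "(complex ^ 'g ^ 'g \<Rightarrow> complex) \<times> (complex ^ 'g ^ 'g \<Rightarrow> complex)"

definition siegel_meromorphic :: "'g::finite siegel_fraction \<Rightarrow> bool" where
  "siegel_meromorphic h \<longleftrightarrow> siegel_holomorphic (fst h) \<and> siegel_holomorphic (snd h) \<and>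
     (\<exists>Z\<in>siegel_space. snd h Z \<noteq> 0)"

definition fraction_eq :: "'g::finite siegel_fraction \<Rightarrow> 'g siegel_fraction \<Rightarrow> bool" where
  "fraction_eq h h' \<longleftrightarrow> (\<forall>Z\<in>siegel_space. fst h Z * snd h' Z = fst h' Z * snd h Z)"

definition fraction_act :: "int ^ ('g::finite + 'g) ^ ('g + 'g) \<Rightarrow> 'g::finite siegel_fraction \<Rightarrow> 'g siegel_fraction"
  where "fraction_act \<gamma> h = (fst h \<circ> sp_act \<gamma>, snd h \<circ> sp_act \<gamma>)"

definition siegel_functions :: "nat \<Rightarrow> complex set \<Rightarrow> 'g::finite siegel_fraction set" where
  "siegel_functions N F = {h. siegel_meromorphic h \<and>
     (\<exists>k f1 f2. f1 \<in> modular_forms_over k F \<and> f2 \<in> modular_forms_over k F \<and>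
        (\<exists>Z\<in>siegel_space. f2 Z \<noteq> 0) \<and> fraction_eq h (f1, f2)) \<and>
     (\<forall>\<gamma>\<in>principal_congruence N. fraction_eq (fraction_act \<gamma> h) h)}"

definition complex_subfield :: "complex set \<Rightarrow> bool" where
  "complex_subfield K \<longleftrightarrow> 0 \<in> K \<and> 1 \<in> K \<and>
     (\<forall>x\<in>K. \<forall>y\<in>K. x - y \<in> K \<and> x * y \<in> K) \<and> (\<forall>x\<in>K. x \<noteq> 0 \<longrightarrow> inverse x \<in> K)"

text \<open>\<open>\<rat>(\<zeta>\<^sub>N)\<close>: the least subfield containing \<open>\<zeta>\<^sub>N = e\<^bsup>2\<pi>i/N\<^esup>\<close>
  (every subfield contains \<open>\<rat>\<close>).\<close>

definition cyclotomic_field :: "nat \<Rightarrow> complex set" where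
  "cyclotomic_field N = \<Inter> {K. complex_subfield K \<and> e2pi (1 / of_nat N) \<in> K}"


section \<open>Theta constants and the function \<open>\<Theta>\<close>\<close>

definition theta :: "real ^ 'g \<Rightarrow> real ^ 'g \<Rightarrow> complex ^ 'g ^ 'g \<Rightarrow> complex" where
  "theta r s Z = (\<Sum>\<^sub>\<infinity>n\<in>(UNIV :: (int ^ 'g) set).
     let v = cvec ((\<chi> i. of_int (n $ i)) + r) in e2pi (dotp v (Z *v v) / 2 + dotp v (cvec s)))"

definition half_characteristics :: "((real ^ 'g) \<times> (real ^ 'g)) set" where
  "half_characteristics = {(a, b). (\<forall>i. a $ i \<in> {0, 1/2}) \<and> (\<forall>i. b $ i \<in> {0, 1/2})}"

definition S_minus :: "((real ^ 'g) \<times> (real ^ 'g)) set" where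
  "S_minus = {(a, b) \<in> half_characteristics. e2pi (of_real (2 * dotp a b)) = -1}"

definition S_plus :: "((real ^ 'g) \<times> (real ^ 'g)) set" where
  "S_plus = {(a, b) \<in> half_characteristics. e2pi (of_real (2 * dotp a b)) = 1}"

definition Theta_num :: "nat \<Rightarrow> real ^ 'g \<Rightarrow> real ^ 'g \<Rightarrow> complex ^ 'g ^ 'g \<Rightarrow> complex" where
  "Theta_num N r s Z =
     2 ^ (4 * N) *
     e2pi (of_real (- (2 ^ CARD('g)) * real N * (2 ^ CARD('g) - 1) * (2 ^ CARD('g) + 1) * dotp r s)) *
     (\<Prod>(a, b)\<in>S_minus. theta (a - r) (b - s) Z ^ (4 * N * (2 ^ CARD('g) + 1)))"

definition Theta_den :: "nat \<Rightarrow> complex ^ 'g ^ 'g \<Rightarrow> complex" where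
  "Theta_den N Z = (\<Prod>(c, d)\<in>S_plus. theta c d Z ^ (4 * N * (2 ^ CARD('g) - 1)))"

definition Theta :: "nat \<Rightarrow> real ^ 'g \<Rightarrow> real ^ 'g \<Rightarrow> 'g::finite siegel_fraction" where
  "Theta N r s = (Theta_num N r s, Theta_den N)"

end

theory Submission
  imports Defs "HOL-Complex_Analysis.Complex_Analysis" "HOL-Probability.Characteristic_Functions"
begin

text \<open>
  Put \<open>\<phi>(v, Z) = e(- v'\<^sup>T v'' / 2) \<theta>(v, Z)\<close> for a characteristic \<open>v = (v', v'')\<close>.  Under the action
  of a symplectic matrix \<open>\<gamma>\<close> on \<open>Z\<close>, \<open>\<phi>(v, \<cdot>)\<close> turns into \<open>\<phi>(\<gamma>\<^sup>T v + c, \<cdot>)\<close> up to a half-integral shift \<open>c\<close>, an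
  eighth root of unity and a square root of \<open>det (C Z + D)\<close>.  It suffices to see this for generators, and
  row reduction shows that the symplectic group is generated by translations of one diagonal
  entry, elementary unimodular substitutions and inversions in a single coordinate; the latter only
  involve one summation variable, so that the one-dimensional Jacobi inversion formula is enough and the
  automorphy factor is just the diagonal entry \<open>Z\<^sub>i\<^sub>i\<close>.

  The power \<open>\<phi>(v, Z) ^ (4 N)\<close> depends only on the class of \<open>v \<in> (1/(2N)) \<int>\<^sup>2\<^sup>g\<close> modulo integral vectors, and the
  affine maps \<open>v \<mapsto> \<gamma>\<^sup>T v + c\<close> permute the half-integral classes and preserve their parity.  Hence numerator
  and denominator of \<open>\<Theta>(v, \<cdot>)\<close> acquire the same sign and the same power of \<open>det (C Z + D)\<close> while \<open>v\<close> is
  replaced by \<open>\<gamma>\<^sup>T v\<close>, which is congruent to \<open>v\<close> when \<open>\<gamma> \<in> \<Gamma>(N)\<close>.  Expanding the theta series gives the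
  Fourier coefficients.
\<close>

no_notation fps_nth (infixl \<open>$\<close> 75)


section \<open>The theta series\<close>

text \<open>The exponents in \<open>Theta\<close> balance the two products. There are
  \<open>2^(g-1) (2^g - 1)\<close> odd and \<open>2^(g-1) (2^g + 1)\<close> even half-integral
  characteristics, so the extra powers \<open>2^g + 1\<close> and \<open>2^g - 1\<close> give
  numerator and denominator equally many theta factors and hence equal weight; being odd, these
  powers preserve signs. A transformation law alone does not give membership in the function field.
  The normalisation \<open>phi\<close>, which transforms cleanly, carries phases that need not be
  \<open>N\<close>th roots of unity, so the coefficients are read off from a third normalisation
  \<open>theta0\<close>. In genus one, holomorphy at the cusps involves transforms under the full
  symplectic group, so the law is established for every \<gamma> and not only on \<Gamma>(N). The
  denominator must not vanish identically: each even theta constant is evaluated at a point where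
  all terms of its series have the same phase, and the identity theorem on complex lines passes from
  factors to the product.\<close>

lemma e2pi_add: "e2pi (x + y) = e2pi x * e2pi y"
  by (simp add: e2pi_def distrib_left exp_add)

lemma e2pi_0 [simp]: "e2pi 0 = 1"
  by (simp add: e2pi_def)

lemma e2pi_nonzero [simp]: "e2pi x \<noteq> 0"
  by (simp add: e2pi_def)

lemma e2pi_minus: "e2pi (- x) = inverse (e2pi x)"
  by (simp add: e2pi_def exp_minus)

lemma e2pi_diff: "e2pi (x - y) = e2pi x / e2pi y"
  by (simp add: e2pi_def right_diff_distrib exp_diff)

lemma e2pi_power: "e2pi x ^ n = e2pi (of_nat n * x)"
  by (simp add: e2pi_def exp_of_nat_mult[symmetric] mult.left_commute)

lemma e2pi_sum: "finite A \<Longrightarrow> e2pi (sum f A) = (\<Prod>x\<in>A. e2pi (f x))"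
  by (induction A rule: finite_induct) (auto simp: e2pi_add)

lemma e2pi_Ints: "x \<in> \<int> \<Longrightarrow> e2pi x = 1"
  by (auto elim!: Ints_cases simp: e2pi_def exp_eq_1)

lemma e2pi_of_real_Ints: "(x::real) \<in> \<int> \<Longrightarrow> e2pi (of_real x) = 1"
  by (rule e2pi_Ints) (auto elim!: Ints_cases)

lemma e2pi_cong_Ints: "(x::real) - y \<in> \<int> \<Longrightarrow> e2pi (of_real x) = e2pi (of_real y)"
  using e2pi_of_real_Ints[of "x - y"] by (simp add: e2pi_diff)

lemma norm_e2pi: "norm (e2pi x) = exp (- 2 * pi * Im x)"
  by (simp add: e2pi_def)

definition ivec :: "int ^ 'g \<Rightarrow> real ^ 'g" where
  "ivec n = (\<chi> i. of_int (n $ i))"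

definition qf :: "real ^ 'g \<Rightarrow> complex ^ 'g ^ 'g \<Rightarrow> complex" where
  "qf x Z = (\<Sum>i\<in>UNIV. \<Sum>j\<in>UNIV. of_real (x $ i) * of_real (x $ j) * Z $ i $ j)"

definition theta_term :: "real ^ 'g \<Rightarrow> real ^ 'g \<Rightarrow> complex ^ 'g ^ 'g \<Rightarrow> int ^ 'g \<Rightarrow> complex" where
  "theta_term r s Z n = e2pi (qf (ivec n + r) Z / 2 + of_real ((ivec n + r) \<bullet> s))"

lemma dotp_eq_inner: "dotp x y = x \<bullet> y" for x y :: "real ^ 'n"
  by (simp add: dotp_def inner_vec_def)

lemma dotp_cvec: "dotp (cvec x) (cvec y) = of_real (x \<bullet> y)"
  by (simp add: dotp_def cvec_def inner_vec_def)

lemma dotp_mult_cvec: "dotp (cvec x) (Z *v cvec x) = qf x Z"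
  by (simp add: dotp_def cvec_def qf_def matrix_vector_mult_def sum_distrib_left mult_ac)

lemma theta_altdef: "theta r s Z = (\<Sum>\<^sub>\<infinity>n. theta_term r s Z n)"
  by (simp add: theta_def theta_term_def Let_def dotp_mult_cvec dotp_cvec flip: ivec_def)

lemma qf_scale: "qf (c *\<^sub>R x) Z = of_real (c^2) * qf x Z"
  by (simp add: qf_def sum_distrib_left power2_eq_square mult_ac)

lemma qf_add: "qf x (Z + W) = qf x Z + qf x W"
  by (simp add: qf_def sum.distrib distrib_left)

lemma qf_diff: "qf x (Z - W) = qf x Z - qf x W"
  by (simp add: qf_def sum_subtractf right_diff_distrib)

lemma qf_map_mat: "qf x (map_mat (\<lambda>z. c * z) Z) = c * qf x Z"
  by (simp add: qf_def map_mat_def sum_distrib_left mult_ac)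

lemma qf_scaleR: "qf x (c *\<^sub>R Z) = of_real c * qf x Z"
  by (simp add: qf_def sum_distrib_left mult_ac) (simp add: scaleR_conv_of_real mult_ac)

lemma Im_qf: "Im (qf x Z) = x \<bullet> (map_mat Im Z *v x)"
proof -
  have "Im (qf x Z) = (\<Sum>i\<in>UNIV. \<Sum>j\<in>UNIV. x $ i * x $ j * Im (Z $ i $ j))"
    unfolding qf_def Im_sum by (intro sum.cong refl) (simp flip: of_real_mult)
  then show ?thesis
    by (simp add: inner_vec_def matrix_vector_mult_def map_mat_def sum_distrib_left mult_ac)
qed

lemma siegel_space_iff:
  "Z \<in> siegel_space \<longleftrightarrow> (\<forall>i j. Z $ i $ j = Z $ j $ i) \<and> (\<forall>x. x \<noteq> 0 \<longrightarrow> Im (qf x Z) > 0)"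
  unfolding siegel_space_def Im_qf by (auto simp: vec_eq_iff transpose_def)

lemma siegel_space_sym: "Z \<in> siegel_space \<Longrightarrow> Z $ i $ j = Z $ j $ i"
  by (simp add: siegel_space_iff)

lemma continuous_on_qf: "continuous_on A (\<lambda>x. qf x Z)"
  unfolding qf_def by (intro continuous_intros)

text \<open>Compactness of the unit sphere and homogeneity of degree two turn positivity into a
  uniform bound. It makes every theta series comparable with a Gaussian sum.\<close>

lemma siegel_space_coercive:
  fixes Z :: "complex ^ 'g ^ 'g"
  assumes "Z \<in> siegel_space"
  obtains c where "c > 0" "\<And>x. Im (qf x Z) \<ge> c * (norm x)\<^sup>2"
proof -
  have "compact (sphere (0::real^'g) 1)" "sphere (0::real^'g) 1 \<noteq> {}"
    by auto
  moreover have "continuous_on (sphere 0 1) (\<lambda>x. Im (qf x Z))"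
    by (intro continuous_intros continuous_on_qf)
  ultimately obtain x0 where x0: "x0 \<in> sphere 0 1" "\<And>y. y \<in> sphere 0 1 \<Longrightarrow> Im (qf x0 Z) \<le> Im (qf y Z)"
    using continuous_attains_inf by metis
  have "x0 \<noteq> 0" using x0(1) by auto
  then have "Im (qf x0 Z) > 0" using assms by (auto simp: siegel_space_iff)
  moreover have "Im (qf x Z) \<ge> Im (qf x0 Z) * (norm x)\<^sup>2" for x
  proof (cases "x = 0")
    case True
    then show ?thesis by (simp add: qf_def)
  next
    case False
    define y where "y = (1 / norm x) *\<^sub>R x"
    have xy: "norm x *\<^sub>R y = x" using False by (simp add: y_def)
    have "qf x Z = of_real ((norm x)\<^sup>2) * qf y Z" using qf_scale[of "norm x" y Z] unfolding xy .
    moreover have "y \<in> sphere 0 1" using False by (simp add: y_def)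
    ultimately show ?thesis using x0(2)[of y]
      by (simp add: mult.commute[of "Im _"] mult_left_mono)
  qed
  ultimately show ?thesis using that by blast
qed

lemma norm_qf_le:
  fixes X :: "complex ^ 'g ^ 'g"
  shows "norm (qf x X) \<le> real CARD('g) ^ 2 * norm X * (norm x)\<^sup>2"
proof -
  have *: "norm (of_real (x $ i) * of_real (x $ j) * X $ i $ j) \<le> norm X * (norm x)\<^sup>2" for i j
  proof -
    have "norm (X $ i $ j) \<le> norm X"
      by (rule order_trans[OF Finite_Cartesian_Product.norm_nth_le Finite_Cartesian_Product.norm_nth_le])
    moreover have "\<bar>x $ i\<bar> \<le> norm x" "\<bar>x $ j\<bar> \<le> norm x"
      using Finite_Cartesian_Product.norm_nth_le[of x i] Finite_Cartesian_Product.norm_nth_le[of x j] by simp_all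
    ultimately have "\<bar>x $ i\<bar> * \<bar>x $ j\<bar> * norm (X $ i $ j) \<le> norm x * norm x * norm X"
      by (intro mult_mono) auto
    then show ?thesis by (simp add: norm_mult power2_eq_square mult_ac)
  qed
  have "norm (qf x X) \<le> (\<Sum>i\<in>(UNIV::'g set). \<Sum>j\<in>(UNIV::'g set). norm X * (norm x)\<^sup>2)"
    unfolding qf_def by (intro order_trans[OF norm_sum] sum_mono *)
  then show ?thesis by (simp add: power2_eq_square mult_ac)
qed

section \<open>Gaussian majorants and absolute convergence of theta series\<close>

lemma summable_on_exp_abs_int: "(\<lambda>n::int. exp (- \<bar>real_of_int n\<bar>)) summable_on UNIV"
proof -
  have *: "(\<lambda>n::nat. exp (- real n)) summable_on UNIV"
  proof -
    have "summable (\<lambda>n::nat. exp (-1::real) ^ n)" by (rule summable_geometric) auto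
    then have "summable (\<lambda>n::nat. exp (- real n))" by (simp add: exp_of_nat_mult[symmetric])
    then show ?thesis by (subst summable_on_UNIV_nonneg_real_iff) auto
  qed
  have "(\<lambda>n::int. exp (- \<bar>real_of_int n\<bar>)) summable_on range (\<lambda>n. int n)"
    using * by (subst summable_on_reindex) (auto simp: inj_def o_def)
  moreover have "(\<lambda>n::int. exp (- \<bar>real_of_int n\<bar>)) summable_on range (\<lambda>n. - int n)"
    using * by (subst summable_on_reindex) (auto simp: inj_def o_def)
  ultimately have "(\<lambda>n::int. exp (- \<bar>real_of_int n\<bar>)) summable_on range (\<lambda>n. int n) \<union> range (\<lambda>n. - int n)"
    by (rule summable_on_union)
  moreover have "range (\<lambda>n. int n) \<union> range (\<lambda>n. - int n) = UNIV"
  proof -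
    have "x \<in> range (\<lambda>n. int n) \<union> range (\<lambda>n. - int n)" for x
    proof (cases "x \<ge> 0")
      case True then show ?thesis by (intro UnI1) (metis nonneg_int_cases rangeI)
    next
      case False then show ?thesis by (intro UnI2 image_eqI[where x="nat (-x)"]) auto
    qed
    then show ?thesis by blast
  qed
  ultimately show ?thesis by simp
qed

text \<open>The summand is a product over the coordinates, so the sum is a power of the
  one-dimensional geometric one.\<close>

lemma summable_on_exp_sum_abs:
  "(\<lambda>n::int^'g. exp (- (\<Sum>i\<in>UNIV. \<bar>real_of_int (n $ i)\<bar>))) summable_on UNIV"
proof -
  have "Infinite_Set_Sum.abs_summable_on (\<lambda>n::int. exp (- \<bar>real_of_int n\<bar>)) UNIV"
    using summable_on_exp_abs_int by (simp add: abs_summable_equivalent[symmetric])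
  then have "Infinite_Set_Sum.abs_summable_on (\<lambda>h. \<Prod>i\<in>(UNIV::'g set). exp (- \<bar>real_of_int (h i)\<bar>)) (PiE UNIV (\<lambda>_. UNIV))"
    by (intro abs_summable_on_prod_PiE) auto
  then have "(\<lambda>h::'g\<Rightarrow>int. exp (- (\<Sum>i\<in>UNIV. \<bar>real_of_int (h i)\<bar>))) summable_on UNIV"
    by (simp add: abs_summable_equivalent[symmetric] exp_sum[symmetric] sum_negf PiE_UNIV_domain)
  moreover have "bij_betw (vec_nth :: int^'g \<Rightarrow> _) UNIV UNIV"
    by (rule bij_betwI[where g=vec_lambda]) auto
  ultimately show ?thesis
    using summable_on_reindex_bij_betw[of "vec_nth :: int^'g \<Rightarrow> _" UNIV UNIV "\<lambda>h. exp (- (\<Sum>i\<in>UNIV. \<bar>real_of_int (h i)\<bar>))"]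
    by simp
qed

lemma summable_on_gauss:
  fixes r :: "real ^ 'g"
  assumes "c > 0"
  shows "(\<lambda>n. exp (- c * (norm (ivec n + r))\<^sup>2)) summable_on UNIV"
proof -
  define K where "K = real CARD('g) / (4 * c) + (\<Sum>i\<in>UNIV. \<bar>r $ i\<bar>)"
  have bound: "exp (- c * (norm (ivec n + r))\<^sup>2) \<le> exp K * exp (- (\<Sum>i\<in>UNIV. \<bar>real_of_int (n $ i)\<bar>))" for n :: "int^'g"
  proof -
    have "\<bar>real_of_int (n $ i)\<bar> \<le> c * ((ivec n + r) $ i)\<^sup>2 + (1 / (4 * c) + \<bar>r $ i\<bar>)" for i
    proof -
      let ?x = "(ivec n + r) $ i"
      \<comment> \<open>Completing the square bounds each \<open>\<bar>x\<bar>\<close> by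
        \<open>c * x^2 + 1 / (4 * c)\<close>; summed over the coordinates this trades the Gaussian
        for an exponential.\<close>
      have "0 \<le> c * (\<bar>?x\<bar> - 1 / (2 * c))\<^sup>2" using assms by simp
      also have "\<dots> = c * ?x\<^sup>2 - \<bar>?x\<bar> + 1 / (4 * c)"
        using assms by (simp add: power2_diff field_simps power2_eq_square)
      finally have "\<bar>?x\<bar> \<le> c * ?x\<^sup>2 + 1 / (4 * c)" by simp
      moreover have "real_of_int (n $ i) = ?x - r $ i" by (simp add: ivec_def)
      ultimately show ?thesis by linarith
    qed
    then have "(\<Sum>i\<in>UNIV. \<bar>real_of_int (n $ i)\<bar>) \<le> (\<Sum>i\<in>UNIV. c * ((ivec n + r) $ i)\<^sup>2 + (1 / (4 * c) + \<bar>r $ i\<bar>))"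
      by (intro sum_mono)
    also have "\<dots> = c * (norm (ivec n + r))\<^sup>2 + K"
      by (simp add: sum.distrib K_def norm_vec_def L2_set_def sum_nonneg sum_distrib_left)
    finally show ?thesis by (simp flip: exp_add)
  qed
  show ?thesis
    by (rule summable_on_comparison_test[OF summable_on_cmult_right[OF summable_on_exp_sum_abs] bound]) auto
qed

text \<open>Half of the Gaussian decay pays for the polynomial factor. The case \<open>k = 1\<close>
  majorises the termwise derivative of a theta series and \<open>k = 2\<close> its second-order
  remainder.\<close>

lemma summable_on_power_gauss:
  fixes r :: "real ^ 'g"
  assumes "c > 0"
  shows "(\<lambda>n. (norm (ivec n + r)) ^ (2 * k) * exp (- c * (norm (ivec n + r))\<^sup>2)) summable_on UNIV"
proof -
  have bound: "(norm x) ^ (2 * k) * exp (- c * (norm x)\<^sup>2) \<le> (real k ^ k * (2 / c) ^ k) * exp (- (c / 2) * (norm x)\<^sup>2)"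
    for x :: "real ^ 'g"
  proof -
    define y where "y = c / 2 * (norm x)\<^sup>2"
    have "y \<ge> 0" using assms by (simp add: y_def)
    \<comment> \<open>From \<open>(1 + y / k)^k \<le> exp y\<close>.\<close>
    then have yk: "y ^ k \<le> real k ^ k * exp y"
      using exp_ge_one_plus_x_over_n_power_n[of k y] power_mono[of y "y + k" k]
      by (cases "k = 0") (auto simp: field_simps power_divide intro: order_trans[rotated])
    have "(norm x) ^ (2 * k) = (2 / c) ^ k * y ^ k"
      using assms by (simp add: y_def power_mult power_mult_distrib[symmetric])
    also have "\<dots> \<le> (2 / c) ^ k * (real k ^ k * exp y)"
      using yk assms by (intro mult_left_mono) (auto simp: field_simps)
    finally have "(norm x) ^ (2 * k) * exp (- c * (norm x)\<^sup>2)
      \<le> (2 / c) ^ k * (real k ^ k * exp y) * exp (- c * (norm x)\<^sup>2)" by (intro mult_right_mono) auto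
    also have "\<dots> = (real k ^ k * (2 / c) ^ k) * (exp y * exp (- c * (norm x)\<^sup>2))" by simp
    also have "exp y * exp (- c * (norm x)\<^sup>2) = exp (- (c / 2) * (norm x)\<^sup>2)"
      by (simp add: y_def flip: exp_add)
    finally show ?thesis .
  qed
  show ?thesis
    by (rule summable_on_comparison_test[OF summable_on_cmult_right[OF summable_on_gauss[of "c/2"]] bound])
       (use assms in auto)
qed

lemma norm_theta_term: "norm (theta_term r s Z n) = exp (- pi * Im (qf (ivec n + r) Z))"
  by (simp add: theta_term_def norm_e2pi)

lemma theta_term_abs_summable:
  assumes "Z \<in> siegel_space"
  shows "(\<lambda>n. norm (theta_term r s Z n)) summable_on UNIV"
proof -
  obtain c where c: "c > 0" "\<And>x. Im (qf x Z) \<ge> c * (norm x)\<^sup>2"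
    using siegel_space_coercive[OF assms] by blast
  have "(\<lambda>n. exp (- (pi * c) * (norm (ivec n + r))\<^sup>2)) summable_on UNIV"
    using c(1) by (intro summable_on_gauss) simp
  then show ?thesis
    by (rule summable_on_comparison_test) (use c in \<open>auto simp: norm_theta_term mult.assoc\<close>)
qed

lemma theta_term_summable: "Z \<in> siegel_space \<Longrightarrow> theta_term r s Z summable_on UNIV"
  using theta_term_abs_summable abs_summable_summable by blast

lemma theta_has_sum: "Z \<in> siegel_space \<Longrightarrow> (theta_term r s Z has_sum theta r s Z) UNIV"
  by (simp add: theta_altdef theta_term_summable)

lemma has_sum_diff_complex:
  fixes f g :: "'a \<Rightarrow> complex"
  assumes "(f has_sum a) A" "(g has_sum b) A"
  shows "((\<lambda>x. f x - g x) has_sum (a - b)) A"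
  using has_sum_add[OF assms(1) has_sum_uminusI[OF assms(2)]] by simp

text \<open>Termwise differentiation: \<open>D\<close> is the sum of the derivatives of the terms,
  complex linear because \<open>qf\<close> is linear in the matrix. Moving from \<open>Z\<close> to
  \<open>W\<close> multiplies a term by \<open>exp w\<close> with \<open>w\<close> linear in
  \<open>W - Z\<close>, so the remainder is governed by \<open>exp w - 1 - w\<close>.\<close>

lemma siegel_holomorphic_theta: "siegel_holomorphic (theta r s :: complex ^ 'g ^ 'g \<Rightarrow> complex)"
  unfolding siegel_holomorphic_def
proof
  fix Z :: "complex ^ 'g ^ 'g" assume Z: "Z \<in> siegel_space"
  obtain c where c: "c > 0" "\<And>x. Im (qf x Z) \<ge> c * (norm x)\<^sup>2"
    using siegel_space_coercive[OF Z] by blast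
  define K where "K = real CARD('g) ^ 2"
  have K: "K > 0" by (simp add: K_def)
  define D where "D X = (\<Sum>\<^sub>\<infinity>n. theta_term r s Z n * (\<i> * pi * qf (ivec n + r) X))" for X
  let ?G = "\<lambda>k a n. (norm (ivec n + r)) ^ (2 * k) * exp (- a * (norm (ivec n + r))\<^sup>2)"
  have le: "norm (theta_term r s Z n) \<le> exp (- (pi * c) * (norm (ivec n + r))\<^sup>2)" for n
    using c by (simp add: norm_theta_term mult.assoc)
  have qle: "norm (\<i> * pi * qf (ivec n + r) X) \<le> pi * K * norm X * (norm (ivec n + r))\<^sup>2" for n X
    using norm_qf_le[of "ivec n + r" X] by (simp add: norm_mult K_def mult.assoc)
  have G1: "?G 1 (pi * c) summable_on UNIV" "?G 2 (pi * c / 2) summable_on UNIV"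
    using c(1) by (intro summable_on_power_gauss; simp)+
  have tb: "norm (theta_term r s Z n * (\<i> * pi * qf (ivec n + r) X)) \<le> (pi * K * norm X) * ?G 1 (pi * c) n" for n X
  proof -
    have "norm (theta_term r s Z n * (\<i> * pi * qf (ivec n + r) X))
      \<le> exp (- (pi * c) * (norm (ivec n + r))\<^sup>2) * (pi * K * norm X * (norm (ivec n + r))\<^sup>2)"
      unfolding norm_mult[of "theta_term r s Z n"] by (intro mult_mono le qle) auto
    then show ?thesis by (simp add: mult_ac)
  qed
  have Dsum: "(\<lambda>n. theta_term r s Z n * (\<i> * pi * qf (ivec n + r) X)) summable_on UNIV" for X
    by (rule abs_summable_summable, rule Infinite_Sum.abs_summable_on_comparison_test'[OF summable_on_cmult_right[OF G1(1)] tb])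
  have Dhs: "((\<lambda>n. theta_term r s Z n * (\<i> * pi * qf (ivec n + r) X)) has_sum D X) UNIV" for X
    unfolding D_def using Dsum by simp
  have Dn: "norm (D X) \<le> norm X * (pi * K * infsum (?G 1 (pi * c)) UNIV)" for X
    using norm_infsum_le[OF Dhs has_sum_cmult_right[OF has_sum_infsum[OF G1(1)]] tb] by (simp add: mult_ac)
  have bl: "bounded_linear D"
  proof
    show "D (X + Y) = D X + D Y" for X Y
      using infsumI[OF has_sum_add[OF Dhs[of X] Dhs[of Y]]]
      by (simp add: D_def qf_add distrib_left)
    show "D (a *\<^sub>R X) = a *\<^sub>R D X" for a X
      using infsumI[OF has_sum_cmult_right[OF Dhs[of X], of "of_real a"]]
      by (simp add: D_def qf_scaleR scaleR_conv_of_real[where 'a=complex] mult_ac)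
    show "\<exists>K. \<forall>x. norm (D x) \<le> norm x * K" using Dn by blast
  qed
  have Dc: "D (map_mat (\<lambda>x. a * x) X) = a * D X" for a X
    using infsumI[OF has_sum_cmult_right[OF Dhs[of X], of a]]
    unfolding D_def qf_map_mat by (simp add: mult_ac)
  define C where "C = (pi * K)\<^sup>2 * infsum (?G 2 (pi * c / 2)) UNIV"
  \<comment> \<open>The radius \<open>c / (2 * K)\<close> keeps \<open>norm w\<close> below half of
    the decay exponent of the term, so one Gaussian of half the rate majorises all
    remainders.\<close>
  have "(theta r s has_derivative D) (at Z within siegel_space)"
  proof (rule has_derivativeI_sandwich[where e = "c / (2 * K)" and H = "\<lambda>W. C * norm (W - Z)"])
    show "0 < c / (2 * K)" using c K by simp
    show "bounded_linear D" by (rule bl)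
    show "((\<lambda>W. C * norm (W - Z)) \<longlongrightarrow> 0) (at Z within siegel_space)"
      by (rule tendsto_eq_intros refl | simp)+
    fix W :: "complex ^ 'g ^ 'g"
    assume W: "W \<in> siegel_space" "W \<noteq> Z" "dist W Z < c / (2 * K)"
    have hs: "((\<lambda>n. theta_term r s W n - theta_term r s Z n - theta_term r s Z n * (\<i> * pi * qf (ivec n + r) (W - Z)))
       has_sum theta r s W - theta r s Z - D (W - Z)) UNIV"
      by (intro has_sum_diff_complex theta_has_sum Dhs W Z)
    have tb2: "norm (theta_term r s W n - theta_term r s Z n - theta_term r s Z n * (\<i> * pi * qf (ivec n + r) (W - Z)))
      \<le> ((pi * K)\<^sup>2 * (norm (W - Z))\<^sup>2) * ?G 2 (pi * c / 2) n" (is "?L \<le> _") for n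
    proof -
      define x where "x = ivec n + r"
      define w where "w = \<i> * pi * qf x (W - Z)"
      have eq: "theta_term r s W n = theta_term r s Z n * exp w"
        by (simp add: theta_term_def w_def e2pi_def flip: exp_add x_def) (simp add: qf_diff field_simps)
      have "norm w \<le> pi * K * norm (W - Z) * (norm x)\<^sup>2" unfolding w_def x_def by (rule qle)
      moreover have "K * norm (W - Z) \<le> c / 2"
        using W(3) K by (simp add: dist_norm field_simps)
      then have "pi * K * norm (W - Z) * (norm x)\<^sup>2 \<le> (pi * c / 2) * (norm x)\<^sup>2"
        using mult_left_mono[of "K * norm (W - Z)" "c / 2" "pi * (norm x)\<^sup>2"] by (simp add: mult_ac)
      ultimately have w1: "norm w \<le> (pi * c / 2) * (norm x)\<^sup>2" and w2: "norm w \<le> pi * K * norm (W - Z) * (norm x)\<^sup>2"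
        by linarith+
      have "norm (exp w - 1 - w) \<le> exp (norm w) * (norm w)\<^sup>2"
        using Taylor_exp_field[of w 1] by (simp add: power2_eq_square algebra_simps)
      also have "\<dots> \<le> exp ((pi * c / 2) * (norm x)\<^sup>2) * (pi * K * norm (W - Z) * (norm x)\<^sup>2)\<^sup>2"
        using w1 w2 by (intro mult_mono power_mono) auto
      finally have r: "norm (exp w - 1 - w) \<le> exp ((pi * c / 2) * (norm x)\<^sup>2) * (pi * K * norm (W - Z) * (norm x)\<^sup>2)\<^sup>2" .
      have "?L = norm (theta_term r s Z n) * norm (exp w - 1 - w)"
        by (simp add: eq flip: w_def x_def norm_mult) (simp add: algebra_simps)
      also have "\<dots> \<le> exp (- (pi * c) * (norm x)\<^sup>2) * (exp ((pi * c / 2) * (norm x)\<^sup>2) * (pi * K * norm (W - Z) * (norm x)\<^sup>2)\<^sup>2)"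
        using le[of n] r by (intro mult_mono) (auto simp: x_def)
      also have "\<dots> = (exp (- (pi * c) * (norm x)\<^sup>2) * exp ((pi * c / 2) * (norm x)\<^sup>2)) * ((pi * K)\<^sup>2 * (norm (W - Z))\<^sup>2 * norm x ^ (2 * 2))"
        by (simp add: power_mult_distrib power_mult mult_ac)
      also have "exp (- (pi * c) * (norm x)\<^sup>2) * exp ((pi * c / 2) * (norm x)\<^sup>2) = exp (- (pi * c / 2) * (norm x)\<^sup>2)"
        by (simp flip: exp_add)
      finally show ?thesis by (simp add: x_def mult_ac)
    qed
    have "norm (theta r s W - theta r s Z - D (W - Z)) \<le> (norm (W - Z))\<^sup>2 * C"
      using norm_infsum_le[OF hs has_sum_cmult_right[OF has_sum_infsum[OF G1(2)]] tb2]
      by (simp add: C_def mult_ac)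
    then show "norm (theta r s W - theta r s Z - D (W - Z)) / norm (W - Z) \<le> C * norm (W - Z)"
      using W(2) by (simp add: divide_le_eq power2_eq_square mult_ac)
  qed
  with Dc show "\<exists>D. (theta r s has_derivative D) (at Z within siegel_space) \<and> (\<forall>c X. D (map_mat (\<lambda>x. c * x) X) = c * D X)"
    by blast
qed

definition zline :: "complex ^ 'g ^ 'g \<Rightarrow> complex ^ 'g ^ 'g \<Rightarrow> complex \<Rightarrow> complex ^ 'g ^ 'g" where
  "zline Z X t = Z + map_mat (\<lambda>x. t * x) X"

text \<open>Restriction to a complex line gives access to one-variable theorems. Complex linearity
  of the derivative along \<open>X\<close> makes it multiplication by the number
  \<open>D X\<close>.\<close>

lemma siegel_holomorphic_line:
  assumes f: "siegel_holomorphic f" and T: "\<And>t. t \<in> T \<Longrightarrow> zline Z X t \<in> siegel_space" and "open T"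
  shows "(\<lambda>t. f (zline Z X t)) holomorphic_on T"
proof (rule holomorphic_onI)
  fix t assume t: "t \<in> T"
  define L where "L = (\<lambda>t. map_mat (\<lambda>x. t * x) X)"
  have "linear L"
    by (rule linearI) (simp_all add: L_def map_mat_def vec_eq_iff distrib_right)
  then have bl: "bounded_linear L" by (simp add: linear_conv_bounded_linear)
  have "(zline Z X has_derivative L) (at t within T)"
  proof -
    have "(zline Z X) = (\<lambda>t. Z + L t)" by (simp add: zline_def L_def fun_eq_iff)
    moreover have "((\<lambda>t. Z + L t) has_derivative (\<lambda>h. 0 + L h)) (at t within T)"
      by (intro has_derivative_add has_derivative_const bounded_linear_imp_has_derivative bl)
    ultimately show ?thesis by simp
  qed
  moreover obtain D where D: "(f has_derivative D) (at (zline Z X t) within siegel_space)"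
    "\<And>c X. D (map_mat (\<lambda>x. c * x) X) = c * D X"
    using f T[OF t] unfolding siegel_holomorphic_def by blast
  moreover have "(f has_derivative D) (at (zline Z X t) within zline Z X ` T)"
    by (rule has_derivative_subset[OF D(1)]) (use T in auto)
  ultimately have "((\<lambda>t. f (zline Z X t)) has_derivative (\<lambda>h. D (L h))) (at t within T)"
    using has_derivative_in_compose by blast
  moreover have "(\<lambda>h. D (L h)) = (*) (D X)" by (simp add: L_def D(2) fun_eq_iff)
  ultimately show "(\<lambda>t. f (zline Z X t)) field_differentiable at t within T"
    unfolding field_differentiable_def has_field_derivative_def by auto
qed


section \<open>Poisson summation and the one-dimensional inversion formula\<close>

lemma periodic_int:
  assumes "\<And>x. f (x + 1) = f (x :: real)"
  shows "f (x + of_int n) = f x"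
proof (induction n rule: int_induct[where k = 0])
  case (step1 i)
  then show ?case using assms[of "x + of_int i"] by (simp add: add.assoc)
next
  case (step2 i)
  then show ?case using assms[of "x + of_int (i - 1)"] by (simp add: add.assoc)
qed simp

text \<open>Trigonometric polynomials. Only monomials and sums generate the set, so that a vanishing
  integral passes to all of it by induction; closure under products, needed for polynomials in a
  point of the circle, is derived.\<close>

inductive_set trig :: "(real \<Rightarrow> complex) set" where
  mono: "(\<lambda>x. c * e2pi (of_int m * of_real x)) \<in> trig"
| add: "f \<in> trig \<Longrightarrow> h \<in> trig \<Longrightarrow> (\<lambda>x. f x + h x) \<in> trig"

lemma trig_const: "(\<lambda>x. c) \<in> trig"
  using trig.mono[of c 0] by simp

lemma trig_mult:
  assumes "f \<in> trig" "h \<in> trig"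
  shows "(\<lambda>x. f x * h x) \<in> trig"
  using assms
proof (induction f arbitrary: h)
  case (mono c m)
  from mono show ?case
  proof (induction h)
    case (mono c' m')
    then show ?case using trig.mono[of "c * c'" "m + m'"]
      by (simp add: algebra_simps e2pi_add)
  next
    case (add f h)
    then show ?case using trig.add[OF add.IH] by (simp add: distrib_left)
  qed
next
  case (add f f')
  then show ?case using trig.add[OF add.IH(1) add.IH(2)] by (simp add: distrib_right)
qed

lemma e2pi_of_real: "e2pi (of_real x) = cis (2 * pi * x)"
  by (simp add: e2pi_def cis_conv_exp mult_ac)

lemma trig_Re: "(\<lambda>x. of_real (Re (e2pi (of_real x)))) \<in> trig"
  and trig_Im: "(\<lambda>x. of_real (Im (e2pi (of_real x)))) \<in> trig"
proof -
  have "(\<lambda>x. 1/2 * e2pi (of_int 1 * of_real x) + 1/2 * e2pi (of_int (-1) * of_real x)) \<in> trig"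
    by (intro trig.intros)
  moreover have "1/2 * e2pi (of_int 1 * of_real x) + 1/2 * e2pi (of_int (-1) * of_real x) = of_real (Re (e2pi (of_real x)))" for x :: real
    using e2pi_of_real[of x] e2pi_of_real[of "-x"] by (simp add: complex_eq_iff)
  ultimately show "(\<lambda>x. of_real (Re (e2pi (of_real x)))) \<in> trig" by simp
  have "(\<lambda>x. (-\<i>/2) * e2pi (of_int 1 * of_real x) + (\<i>/2) * e2pi (of_int (-1) * of_real x)) \<in> trig"
    by (intro trig.intros)
  moreover have "(-\<i>/2) * e2pi (of_int 1 * of_real x) + (\<i>/2) * e2pi (of_int (-1) * of_real x) = of_real (Im (e2pi (of_real x)))" for x :: real
    using e2pi_of_real[of x] e2pi_of_real[of "-x"] by (simp add: complex_eq_iff)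
  ultimately show "(\<lambda>x. of_real (Im (e2pi (of_real x)))) \<in> trig" by simp
qed

lemma trig_real_polynomial:
  fixes q :: "complex \<Rightarrow> real"
  assumes "real_polynomial_function q"
  shows "(\<lambda>x. complex_of_real (q (e2pi (of_real x)))) \<in> trig"
  using assms
proof (induction q)
  case (linear q)
  then interpret bounded_linear q .
  have "q w = Re w * q 1 + Im w * q \<i>" for w
  proof -
    have "q w = q (Re w *\<^sub>R 1 + Im w *\<^sub>R \<i>)" by (rule arg_cong[where f=q]) (simp add: complex_eq_iff)
    also have "\<dots> = Re w * q 1 + Im w * q \<i>" unfolding add scaleR by simp
    finally show ?thesis .
  qed
  then have "(\<lambda>x. complex_of_real (q (e2pi (of_real x)))) =
      (\<lambda>x. of_real (Re (e2pi (of_real x))) * of_real (q 1) + of_real (Im (e2pi (of_real x))) * of_real (q \<i>))"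
    by (metis of_real_add of_real_mult)
  then show ?case by (simp add: trig.add trig_mult trig_const trig_Re trig_Im)
next
  case (const c) then show ?case by (simp add: trig_const)
next
  case (add f g) then show ?case by (simp add: trig.add)
next
  case (mult f g) then show ?case by (simp add: trig_mult)
qed

lemma trig_polynomial:
  fixes p :: "complex \<Rightarrow> complex"
  assumes "polynomial_function p"
  shows "(\<lambda>x. p (e2pi (of_real x))) \<in> trig"
proof -
  have "real_polynomial_function (Re \<circ> p)" "real_polynomial_function (Im \<circ> p)"
    using assms bounded_linear_Re bounded_linear_Im unfolding polynomial_function_def by blast+
  then have "(\<lambda>x. of_real (Re (p (e2pi (of_real x)))) + \<i> * of_real (Im (p (e2pi (of_real x))))) \<in> trig"
    by (intro trig.add trig_mult trig_const) (auto dest: trig_real_polynomial simp: o_def)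
  moreover have "of_real (Re w) + \<i> * of_real (Im w) = w" for w by (simp add: complex_eq_iff)
  ultimately show ?thesis by simp
qed

lemma continuous_on_e2pi [continuous_intros]: "continuous_on A f \<Longrightarrow> continuous_on A (\<lambda>x. e2pi (f x))"
  unfolding e2pi_def by (intro continuous_intros)

lemma trig_continuous: "h \<in> trig \<Longrightarrow> continuous_on A h"
  by (induction rule: trig.induct) (intro continuous_intros; simp)+

text \<open>The argument of \<open>w\<close> divided by \<open>2 * pi\<close> recovers
  \<open>x\<close> up to an integer, so a function of period one descends to the circle through the
  logarithm.\<close>

lemma Ln_angle_periodic:
  fixes f :: "real \<Rightarrow> complex" and w :: complex and x :: real
  assumes per: "\<And>x. f (x + 1) = f x" and w: "w \<noteq> 0" and e: "exp (\<i> * (2 * pi * x)) = w / norm w"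
  shows "f (Im (Ln w) / (2 * pi)) = f x"
proof -
  have "exp (\<i> * of_real (Im (Ln w))) = w / norm w"
  proof -
    have "Ln w = of_real (ln (norm w)) + \<i> * of_real (Im (Ln w))" using w by (simp add: complex_eq_iff)
    then have "w = exp (of_real (ln (norm w))) * exp (\<i> * of_real (Im (Ln w)))"
      using exp_Ln[OF w] by (metis exp_add)
    then show ?thesis using w by (simp add: exp_of_real field_simps)
  qed
  with e have "exp (\<i> * of_real (Im (Ln w))) = exp (\<i> * (2 * pi * x))" by simp
  then obtain n :: int where "\<i> * of_real (Im (Ln w)) = \<i> * (2 * pi * x) + (of_int (2 * n) * pi) * \<i>"
    unfolding exp_eq by auto
  then have "Im (Ln w) = 2 * pi * x + of_int (2 * n) * pi"
    by (simp add: complex_eq_iff)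
  then have "Im (Ln w) / (2 * pi) = x + of_int n" by (simp add: field_simps)
  then show ?thesis using periodic_int[of f x n, OF per] by simp
qed

text \<open>The function descends to a continuous \<open>F\<close> on the unit circle. By
  Stone-Weierstrass its conjugate is uniformly approximated by trigonometric polynomials, all
  orthogonal to \<open>f\<close>, so the integral of \<open>f * cnj f\<close> is arbitrarily
  small.\<close>

lemma fourier_unique:
  fixes f :: "real \<Rightarrow> complex"
  assumes cont: "continuous_on UNIV f" and per: "\<And>x. f (x + 1) = f x"
    and zero: "\<And>m::int. integral {0..1} (\<lambda>x. f x * e2pi (of_int m * of_real x)) = 0"
  shows "f x = 0"
proof -
  define F where "F w = f (Im (Ln w) / (2 * pi))" for w
  have F1: "F (e2pi (of_real x)) = f x" for x :: real
    unfolding F_def by (rule Ln_angle_periodic[of f, OF per]) (auto simp: norm_e2pi e2pi_def mult_ac)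
  \<comment> \<open>A second expression for \<open>F\<close>, continuous across the cut of
    \<open>Ln\<close>. The two slit planes cover everything except the origin.\<close>
  have F2: "F w = f (Im (Ln (- w)) / (2 * pi) + 1 / 2)" if "w \<noteq> 0" for w
    unfolding F_def
  proof (rule Ln_angle_periodic[of f, OF per that])
    have *: "exp (\<i> * (2 * pi * of_real (Im (Ln (- w)) / (2 * pi) + 1 / 2))) = exp (\<i> * of_real (Im (Ln (- w)))) * exp (\<i> * pi)"
    proof -
      have "\<i> * (2 * pi * of_real (Im (Ln (- w)) / (2 * pi) + 1 / 2)) = \<i> * of_real (Im (Ln (- w))) + \<i> * pi"
        by (simp add: field_simps)
      then show ?thesis by (simp only: exp_add)
    qed
    have "Ln (-w) = of_real (ln (norm w)) + \<i> * of_real (Im (Ln (-w)))" using that by (simp add: complex_eq_iff)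
    then have "- w = exp (of_real (ln (norm w))) * exp (\<i> * of_real (Im (Ln (- w))))"
      using exp_Ln[of "-w"] that by (metis exp_add neg_equal_0_iff_equal)
    then have "exp (\<i> * of_real (Im (Ln (- w)))) = - w / norm w" using that by (simp add: exp_of_real field_simps)
    then show "iexp (2 * pi * (Im (Ln (- w)) / (2 * pi) + 1 / 2)) = w / norm w"
      using * by (simp add: exp_pi_i')
  qed
  have cf: "continuous_on A f" for A using cont continuous_on_subset by blast
  have "continuous_on ((- \<real>\<^sub>\<le>\<^sub>0) \<union> uminus -` (- \<real>\<^sub>\<le>\<^sub>0)) F"
  proof (rule continuous_on_open_Un)
    show "open (- (\<real>\<^sub>\<le>\<^sub>0 :: complex set))" by auto
    show "open (uminus -` (- (\<real>\<^sub>\<le>\<^sub>0 :: complex set)))"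
      by (intro open_vimage) (auto intro: continuous_intros)
    show "continuous_on (- \<real>\<^sub>\<le>\<^sub>0) F"
      unfolding F_def by (intro continuous_on_compose2[OF cont] continuous_intros) auto
    have "continuous_on (uminus -` (- \<real>\<^sub>\<le>\<^sub>0)) (\<lambda>w. f (Im (Ln (- w)) / (2 * pi) + 1 / 2))"
      by (intro continuous_on_compose2[OF cont] continuous_intros) auto
    then show "continuous_on (uminus -` (- \<real>\<^sub>\<le>\<^sub>0)) F"
      by (rule continuous_on_eq) (rule F2[symmetric], auto)
  qed
  then have Fc: "continuous_on (sphere 0 1) F"
    by (rule continuous_on_subset) (auto simp: complex_nonpos_Reals_iff complex_eq_iff norm_complex_def)
  have trig0: "h \<in> trig \<Longrightarrow> integral {0..1} (\<lambda>x. f x * h x) = 0" for h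
  proof (induction rule: trig.induct)
    case (mono c m)
    have "integral {0..1} (\<lambda>x. f x * (c * e2pi (of_int m * of_real x))) = c * integral {0..1} (\<lambda>x. f x * e2pi (of_int m * of_real x))"
      by (simp add: mult_ac flip: integral_mult_right)
    then show ?case using zero by simp
  next
    case (add h h')
    have "integral {0..1} (\<lambda>x. f x * h x + f x * h' x) = integral {0..1} (\<lambda>x. f x * h x) + integral {0..1} (\<lambda>x. f x * h' x)"
      using add by (intro Henstock_Kurzweil_Integration.integral_add integrable_continuous_interval continuous_intros cf trig_continuous)
    then show ?case using add by (simp add: distrib_left)
  qed
  obtain B where B: "\<And>x. x \<in> {0..1} \<Longrightarrow> norm (f x) \<le> B"
    using compact_imp_bounded[OF compact_continuous_image[OF cf[of "{0..1}"]]] unfolding bounded_iff by fastforce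
  have B0: "B \<ge> 0" using order_trans[OF norm_ge_zero B[of 0]] by simp
  define I where "I = integral {0..1} (\<lambda>x. f x * cnj (f x))"
  have "norm I \<le> e * B" if "e > 0" for e
  proof -
    have "continuous_on (sphere 0 1) (\<lambda>w. cnj (F w))" by (intro continuous_intros Fc)
    then obtain p where p: "polynomial_function p" "\<And>w. w \<in> sphere 0 1 \<Longrightarrow> norm (cnj (F w) - p w) < e"
      using Stone_Weierstrass_polynomial_function[of "sphere 0 1" "\<lambda>w. cnj (F w)" e] \<open>e > 0\<close> by auto
    define h where "h x = p (e2pi (of_real x))" for x :: real
    have h: "h \<in> trig" unfolding h_def using trig_polynomial[OF p(1)] by simp
    have hc: "norm (cnj (f x) - h x) \<le> e" for x
      using p(2)[of "e2pi (of_real x)"] F1[of x] by (simp add: h_def norm_e2pi less_imp_le)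
    have "I = integral {0..1} (\<lambda>x. f x * cnj (f x)) - integral {0..1} (\<lambda>x. f x * h x)"
      using trig0[OF h] by (simp add: I_def)
    also have "\<dots> = integral {0..1} (\<lambda>x. f x * cnj (f x) - f x * h x)"
      by (intro Henstock_Kurzweil_Integration.integral_diff[symmetric] integrable_continuous_interval continuous_intros cf trig_continuous h)
    finally have "I = integral {0..1} (\<lambda>x. f x * (cnj (f x) - h x))" by (simp add: right_diff_distrib)
    moreover have "norm (integral {0..1} (\<lambda>x. f x * (cnj (f x) - h x))) \<le> (e * B) * (1 - 0)"
    proof (rule integral_bound)
      show "continuous_on {0..1} (\<lambda>x. f x * (cnj (f x) - h x))"
        by (intro continuous_intros cf trig_continuous h)
      show "norm (f x * (cnj (f x) - h x)) \<le> e * B" if "x \<in> {0..1}" for x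
        using mult_mono[OF B[OF that] hc[of x] B0] by (simp add: norm_mult mult.commute)
    qed simp
    ultimately show ?thesis by simp
  qed
  then have "norm I \<le> 0"
  proof -
    assume *: "\<And>e. e > 0 \<Longrightarrow> norm I \<le> e * B"
    show ?thesis
    proof (rule field_le_epsilon)
      fix e :: real assume "e > 0"
      then have "norm I \<le> e / (B + 1) * B" using B0 by (intro *) simp
      also have "\<dots> \<le> e" using B0 \<open>e > 0\<close> by (simp add: field_simps)
      finally show "norm I \<le> 0 + e" by simp
    qed
  qed
  then have "integral {0..1} (\<lambda>x. complex_of_real ((norm (f x))\<^sup>2)) = 0"
    by (simp add: I_def complex_norm_square[symmetric])
  then have "integral {0..1} (\<lambda>x. (norm (f x))\<^sup>2) = 0"
  proof -
    have "integral {0..1} (\<lambda>x. complex_of_real ((norm (f x))\<^sup>2)) = of_real (integral {0..1} (\<lambda>x. (norm (f x))\<^sup>2))"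
      by (intro integral_unique has_integral_of_real integrable_integral integrable_continuous_interval continuous_intros cf)
    then show "integral {0..1} (\<lambda>x. complex_of_real ((norm (f x))\<^sup>2)) = 0 \<Longrightarrow> ?thesis" by simp
  qed
  then have 0: "f x = 0" if "x \<in> {0..1}" for x
  proof -
    have "continuous_on {0..1} (\<lambda>x. (norm (f x))\<^sup>2)" by (intro continuous_intros cf)
    from integral_eq_0_iff[OF this] that \<open>integral {0..1} (\<lambda>x. (norm (f x))\<^sup>2) = 0\<close> show ?thesis by simp
  qed
  have "f x = f (frac x + of_int \<lfloor>x\<rfloor>)" by (simp add: frac_def)
  also have "\<dots> = f (frac x)" by (rule periodic_int[of f, OF per])
  also have "\<dots> = 0" using frac_lt_1[of x] by (intro 0) (auto simp: less_imp_le)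
  finally show ?thesis .
qed

text \<open>The M-test gives uniform convergence along the net of finite subsets, which suffices for
  continuity and termwise integration of an unordered sum.\<close>

lemma series_integral:
  fixes f :: "'i \<Rightarrow> real \<Rightarrow> complex"
  assumes c: "\<And>n. continuous_on {a..b} (f n)" and le: "\<And>n x. x \<in> {a..b} \<Longrightarrow> norm (f n x) \<le> M n"
    and M: "M summable_on UNIV"
  shows "continuous_on {a..b} (\<lambda>x. \<Sum>\<^sub>\<infinity>n. f n x)"
    and "((\<lambda>n. integral {a..b} (f n)) has_sum integral {a..b} (\<lambda>x. \<Sum>\<^sub>\<infinity>n. f n x)) UNIV"
proof -
  have u: "uniform_limit {a..b} (\<lambda>X y. \<Sum>n\<in>X. f n y) (\<lambda>y. \<Sum>\<^sub>\<infinity>n\<in>UNIV. f n y) (finite_subsets_at_top UNIV)"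
    using le M by (intro Weierstrass_m_test_general) auto
  have cs: "continuous_on {a..b} (\<lambda>y. \<Sum>n\<in>X. f n y)" for X by (intro continuous_intros c)
  show "continuous_on {a..b} (\<lambda>x. \<Sum>\<^sub>\<infinity>n. f n x)"
    by (rule uniform_limit_theorem[OF _ u]) (auto intro!: always_eventually cs)
  obtain I J where IJ: "\<And>X. ((\<lambda>y. \<Sum>n\<in>X. f n y) has_integral I X) {a..b}"
    "((\<lambda>y. \<Sum>\<^sub>\<infinity>n\<in>UNIV. f n y) has_integral J) {a..b}" "(I \<longlongrightarrow> J) (finite_subsets_at_top UNIV)"
    using uniform_limit_integral[OF u cs] by auto
  have "I X = (\<Sum>n\<in>X. integral {a..b} (f n))" if "finite X" for X
    using integral_unique[OF IJ(1)[of X]] Henstock_Kurzweil_Integration.integral_sum[OF that, of f "{a..b}"]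
    by (simp add: integrable_continuous_interval[OF c])
  then have "((\<lambda>X. \<Sum>n\<in>X. integral {a..b} (f n)) \<longlongrightarrow> J) (finite_subsets_at_top UNIV)"
    by (intro Lim_transform_eventually[OF IJ(3)] eventually_finite_subsets_at_top_weakI) auto
  then show "((\<lambda>n. integral {a..b} (f n)) has_sum integral {a..b} (\<lambda>x. \<Sum>\<^sub>\<infinity>n. f n x)) UNIV"
    using integral_unique[OF IJ(2)] by (simp add: has_sum_def)
qed

lemma summable_on_gauss_int:
  fixes c r :: real
  assumes "c > 0"
  shows "(\<lambda>n::int. exp (- c * (of_int n + r)\<^sup>2)) summable_on UNIV"
proof -
  have bound: "exp (- c * (of_int n + r)\<^sup>2) \<le> exp (1 / (4 * c) + \<bar>r\<bar>) * exp (- \<bar>real_of_int n\<bar>)" for n :: int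
  proof -
    let ?x = "of_int n + r"
    have "0 \<le> c * (\<bar>?x\<bar> - 1 / (2 * c))\<^sup>2" using assms by simp
    also have "\<dots> = c * ?x\<^sup>2 - \<bar>?x\<bar> + 1 / (4 * c)"
      using assms by (simp add: power2_diff field_simps power2_eq_square)
    finally have "\<bar>real_of_int n\<bar> \<le> c * ?x\<^sup>2 + (1 / (4 * c) + \<bar>r\<bar>)" by linarith
    then show ?thesis by (simp flip: exp_add)
  qed
  show ?thesis
    by (rule summable_on_comparison_test[OF summable_on_cmult_right[OF summable_on_exp_abs_int] bound]) auto
qed

lemma integral_e2pi: "integral {0..1} (\<lambda>x. e2pi (of_int m * of_real x)) = (if m = 0 then 1 else 0)"
proof (cases "m = 0")
  case False
  define c where "c = 2 * of_real pi * \<i> * of_int m"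
  have c: "c \<noteq> 0" using False by (simp add: c_def)
  have "((\<lambda>x. exp (c * of_real x)) has_integral exp (c * of_real 1) / c - exp (c * of_real 0) / c) {0..1}"
  proof (rule fundamental_theorem_of_calculus)
    fix x :: real
    have "((\<lambda>z. exp (c * z) / c) has_field_derivative exp (c * of_real x)) (at (of_real x))"
      using c by (auto intro!: derivative_eq_intros)
    then show "((\<lambda>x. exp (c * of_real x) / c) has_vector_derivative exp (c * of_real x)) (at x within {0..1})"
      using has_vector_derivative_real_field has_vector_derivative_at_within by blast
  qed simp
  moreover have "exp c = 1" using e2pi_Ints[of "of_int m"] by (simp add: c_def e2pi_def)
  ultimately show ?thesis using False
    by (simp add: c_def e2pi_def mult_ac integral_unique)
qed simp

text \<open>The unfolding step of Poisson summation: integrals over unit intervals add up to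
  integrals over symmetric intervals, which tend to the integral over the line by dominated
  convergence.\<close>

lemma integral_over_unit_intervals:
  fixes h :: "real \<Rightarrow> complex"
  assumes c: "continuous_on UNIV h" and i: "integrable lborel h"
    and S: "((\<lambda>n::int. integral {0..1} (\<lambda>x. h (of_int n + x))) has_sum S) UNIV"
  shows "S = integral\<^sup>L lborel h"
proof -
  have cc: "continuous_on A h" for A using c continuous_on_subset by blast
  have io: "h integrable_on {a..b}" for a b by (intro integrable_continuous_interval cc)
  have sh: "integral {0..1} (\<lambda>x. h (of_int n + x)) = integral {of_int n..of_int n + 1} h" for n :: int
    using integral_shift[of 0 "of_int n" 1 h] cc by (simp add: o_def add.commute)
  have sum: "(\<Sum>n\<in>{- int k..<int k}. integral {0..1} (\<lambda>x. h (of_int n + x))) = integral {- real k..real k} h" for k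
  proof (induction k)
    case (Suc k)
    have *: "{- int (Suc k)..<int (Suc k)} = insert (- int (Suc k)) (insert (int k) {- int k..<int k})" by auto
    have "integral {- real (Suc k)..real (Suc k)} h =
      integral {- real (Suc k)..- real k} h + integral {- real k..real k} h + integral {real k..real (Suc k)} h"
      using Henstock_Kurzweil_Integration.integral_combine[of "- real (Suc k)" "- real k" "real (Suc k)" h]
        Henstock_Kurzweil_Integration.integral_combine[of "- real k" "real k" "real (Suc k)" h] io by (simp add: add.assoc)
    then show ?case unfolding * using Suc sh[of "- int (Suc k)"] sh[of "int k"] by (simp add: algebra_simps)
  qed simp
  \<comment> \<open>The symmetric integer intervals eventually contain any given finite set, so the
    unordered sum is also the limit along them.\<close>
  have "filterlim (\<lambda>k::nat. {- int k..<int k}) (finite_subsets_at_top UNIV) sequentially"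
    unfolding filterlim_finite_subsets_at_top
  proof safe
    fix X :: "int set" assume "finite X"
    then obtain B where B: "\<And>x. x \<in> X \<Longrightarrow> \<bar>x\<bar> \<le> B"
      by (metis Max_ge finite_imageI imageI)
    show "\<forall>\<^sub>F k::nat in sequentially. finite {- int k..<int k} \<and> X \<subseteq> {- int k..<int k} \<and> {- int k..<int k} \<subseteq> UNIV"
      using eventually_ge_at_top[of "nat B + 1"]
    proof eventually_elim
      case (elim k)
      have "x \<in> {- int k..<int k}" if "x \<in> X" for x using B[OF that] elim by auto
      then show ?case by auto
    qed
  qed
  with S have "(\<lambda>k. \<Sum>n\<in>{- int k..<int k}. integral {0..1} (\<lambda>x. h (of_int n + x))) \<longlonglongrightarrow> S"
    unfolding has_sum_def by (rule filterlim_compose)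
  then have l1: "(\<lambda>k. integral {- real k..real k} h) \<longlonglongrightarrow> S" by (simp only: sum)
  have "(\<lambda>k::nat. integral\<^sup>L lborel (\<lambda>x. indicator {- real k..real k} x *\<^sub>R h x)) \<longlonglongrightarrow> integral\<^sup>L lborel h"
  proof (rule integral_dominated_convergence)
    show "h \<in> borel_measurable lborel" using i by auto
    then show "(\<lambda>x. indicator {- real k..real k} x *\<^sub>R h x) \<in> borel_measurable lborel" for k :: nat
      by auto
    show "integrable lborel (\<lambda>x. norm (h x))" using i by simp
    show "AE x in lborel. norm (indicator {- real k..real k} x *\<^sub>R h x) \<le> norm (h x)" for k :: nat
      by (auto simp: indicator_def)
    show "AE x in lborel. (\<lambda>k::nat. indicator {- real k..real k} x *\<^sub>R h x) \<longlonglongrightarrow> h x"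
    proof (rule AE_I2)
      fix x :: real
      have "\<forall>\<^sub>F k in sequentially. indicator {- real k..real k} x *\<^sub>R h x = h x"
        using eventually_ge_at_top[of "nat \<lceil>\<bar>x\<bar>\<rceil>"]
      proof eventually_elim
        case (elim k)
        then have "\<bar>x\<bar> \<le> real k" by linarith
        then show ?case by (auto simp: indicator_def)
      qed
      then show "(\<lambda>k::nat. indicator {- real k..real k} x *\<^sub>R h x) \<longlonglongrightarrow> h x"
        by (rule tendsto_eventually)
    qed
  qed
  moreover have "integral\<^sup>L lborel (\<lambda>x. indicator {- real k..real k} x *\<^sub>R h x) = integral {- real k..real k} h" for k :: nat
  proof -
    have "set_integrable lborel {- real k..real k} h"
      by (rule borel_integrable_atLeastAtMost'[OF cc])
    from set_borel_integral_eq_integral(2)[OF this] show ?thesis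
      by (simp add: set_lebesgue_integral_def)
  qed
  ultimately show ?thesis using l1 LIMSEQ_unique by simp
qed

text \<open>A rescaling turns the integral into the characteristic function of the standard normal
  distribution.\<close>

lemma gaussian_fourier:
  fixes t u :: real
  assumes "t > 0"
  defines "h \<equiv> (\<lambda>y. complex_of_real (exp (- pi * t * y\<^sup>2)) * e2pi (of_real (u * y)))"
  shows "integrable lborel h" "integral\<^sup>L lborel h = of_real (exp (- pi * u\<^sup>2 / t) / sqrt t)"
proof -
  \<comment> \<open>The scale for which \<open>pi * t * (c * x)^2\<close> equals
    \<open>x^2 / 2\<close>.\<close>
  define c where "c = 1 / sqrt (2 * pi * t)"
  have c: "c > 0" "c\<^sup>2 = 1 / (2 * pi * t)" using assms by (simp_all add: c_def power_divide)
  have h: "h (0 + c * x) = of_real (sqrt (2 * pi)) * (std_normal_density x *\<^sub>R iexp (2 * pi * u * c * x))" for x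
  proof -
    have "- pi * t * (c * x)\<^sup>2 = - x\<^sup>2 / 2" using c(2) assms by (simp add: power_mult_distrib)
    then show ?thesis
      by (simp add: h_def std_normal_density_def scaleR_conv_of_real e2pi_def mult_ac)
  qed
  have int: "integrable lborel (\<lambda>x. std_normal_density x *\<^sub>R iexp (2 * pi * u * c * x))"
    by (rule Bochner_Integration.integrable_bound[OF integrable_normal_density[where \<mu> = 0 and \<sigma> = 1]]) (auto simp: norm_mult)
  then have "integrable lborel (\<lambda>x. h (0 + c * x))" unfolding h by (rule integrable_mult_right)
  then show "integrable lborel h"
    using c(1) lborel_integrable_real_affine_iff[of c h 0] by simp
  have ch: "integral\<^sup>L lborel (\<lambda>x. std_normal_density x *\<^sub>R iexp (2 * pi * u * c * x)) = of_real (exp (- (2 * pi * u * c)\<^sup>2 / 2))"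
  proof -
    have "char std_normal_distribution (2 * pi * u * c) = integral\<^sup>L lborel (\<lambda>x. std_normal_density x *\<^sub>R iexp (2 * pi * u * c * x))"
      unfolding char_def by (subst integral_density) (auto simp: mult_ac)
    then show ?thesis by (simp add: char_std_normal_distribution)
  qed
  have e: "(2 * pi * u * c)\<^sup>2 / 2 = pi * u\<^sup>2 / t" using c(2) assms
    by (simp add: power_mult_distrib field_simps power2_eq_square)
  have s: "c * sqrt (2 * pi) = 1 / sqrt t" by (simp add: c_def real_sqrt_mult)
  have "integral\<^sup>L lborel h = \<bar>c\<bar> *\<^sub>R integral\<^sup>L lborel (\<lambda>x. h (0 + c * x))"
    using c(1) by (intro lborel_integral_real_affine) simp
  also have "\<dots> = of_real (c * sqrt (2 * pi)) * of_real (exp (- (pi * u\<^sup>2 / t)))"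
    unfolding h integral_mult_right_zero ch using c(1) e by (simp add: scaleR_conv_of_real)
  finally show "integral\<^sup>L lborel h = of_real (exp (- pi * u\<^sup>2 / t) / sqrt t)" unfolding s by simp
qed

lemma continuous_on_UNIV_realI:
  fixes f :: "real \<Rightarrow> complex"
  assumes "\<And>B. B > 0 \<Longrightarrow> continuous_on {-B..B} f"
  shows "continuous_on UNIV f"
proof -
  have "continuous_on {- real (Suc k)<..<real (Suc k)} f" for k
    by (rule continuous_on_subset[OF assms[of "real (Suc k)"]]) auto
  then have "continuous_on (\<Union>k. {- real (Suc k)<..<real (Suc k)}) f"
    by (intro continuous_on_open_UN) auto
  moreover have "(\<Union>k. {- real (Suc k)<..<real (Suc k)}) = UNIV"
  proof -
    have "\<exists>k. x \<in> {- real (Suc k)<..<real (Suc k)}" for x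
      by (rule exI[of _ "nat \<lceil>\<bar>x\<bar>\<rceil>"]) (simp, linarith)
    then show ?thesis by blast
  qed
  ultimately show ?thesis by simp
qed

text \<open>Both sides are continuous functions of \<open>x\<close> with period one, and their
  Fourier coefficients agree: those of the left side by unfolding to a Gaussian integral, those of
  the right side by orthogonality of the exponentials.\<close>

lemma poisson_gauss:
  fixes t s x :: real
  assumes t: "t > 0"
  shows "(\<Sum>\<^sub>\<infinity>n::int. of_real (exp (- pi * t * (of_int n + x)\<^sup>2)) * e2pi (of_real ((of_int n + x) * s)))
    = (\<Sum>\<^sub>\<infinity>m::int. of_real (exp (- pi * (of_int m - s)\<^sup>2 / t) / sqrt t) * e2pi (of_int m * of_real x))" (is "?F x = ?G x")
proof -
  let ?f = "\<lambda>n x. complex_of_real (exp (- pi * t * (of_int n + x)\<^sup>2)) * e2pi (of_real ((of_int n + x) * s))"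
  let ?a = "\<lambda>m. complex_of_real (exp (- pi * (of_int m - s)\<^sup>2 / t) / sqrt t)"
  let ?g = "\<lambda>m x. ?a m * e2pi (of_int m * of_real x)"
  have fb: "norm (?f n x) \<le> exp (pi * t * B\<^sup>2) * exp (- (pi * t / 2) * (of_int n + 0)\<^sup>2)" if "x \<in> {-B..B}" for x B and n :: int
  proof -
    \<comment> \<open>Equivalent to \<open>n^2 / 2 - x^2 \<le> (n + x)^2\<close>, which yields a
      majorant uniform for \<open>x\<close> in a bounded interval.\<close>
    have "0 \<le> (of_int n + 2 * x)\<^sup>2" by simp
    then have "(of_int n)\<^sup>2 / 2 - x\<^sup>2 \<le> (of_int n + x)\<^sup>2" by (simp add: power2_eq_square algebra_simps)
    moreover have "x\<^sup>2 \<le> B\<^sup>2" using that by (intro abs_le_square_iff[THEN iffD1]) auto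
    ultimately have "(of_int n)\<^sup>2 / 2 - B\<^sup>2 \<le> (of_int n + x)\<^sup>2" by simp
    then have "(pi * t) * ((of_int n)\<^sup>2 / 2 - B\<^sup>2) \<le> (pi * t) * (of_int n + x)\<^sup>2" using t by (intro mult_left_mono) auto
    then have "- pi * t * (of_int n + x)\<^sup>2 \<le> pi * t * B\<^sup>2 + - (pi * t / 2) * (of_int n + 0)\<^sup>2"
      by (simp add: algebra_simps)
    then show ?thesis by (simp add: norm_mult norm_e2pi flip: exp_add)
  qed
  have fM: "(\<lambda>n::int. exp (pi * t * B\<^sup>2) * exp (- (pi * t / 2) * (of_int n + 0)\<^sup>2)) summable_on UNIV" for B
    using t by (intro summable_on_cmult_right summable_on_gauss_int) simp
  have gb: "norm (?g m x) \<le> 1 / sqrt t * exp (- (pi / t) * (of_int m + (- s))\<^sup>2)" for m x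
    using t by (simp add: norm_mult norm_divide norm_e2pi)
  have gM: "(\<lambda>m::int. 1 / sqrt t * exp (- (pi / t) * (of_int m + (- s))\<^sup>2)) summable_on UNIV"
    using t by (intro summable_on_cmult_right summable_on_gauss_int) simp
  have fc: "continuous_on A (?f n)" and gc: "continuous_on A (?g n)" for A n
    by (intro continuous_intros)+
  have Fc: "continuous_on UNIV ?F"
    by (intro continuous_on_UNIV_realI series_integral(1)[OF fc fb fM])
  have Gc: "continuous_on UNIV ?G"
    by (intro continuous_on_UNIV_realI series_integral(1)[OF gc gb gM])
  have Fp: "?F (x + 1) = ?F x" for x
  proof -
    have "bij_betw (\<lambda>n::int. n + 1) UNIV UNIV" by (rule bij_betwI[where g="\<lambda>n. n - 1"]) auto
    from infsum_reindex_bij_betw[OF this, of "\<lambda>n. ?f n x"] show ?thesis by (simp add: add_ac)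
  qed
  have Gp: "?G (x + 1) = ?G x" for x
    by (simp add: distrib_left e2pi_add e2pi_Ints)
  have FI: "integral {0..1} (\<lambda>x. ?F x * e2pi (of_int k * of_real x)) = ?a (- k)" for k :: int
  proof -
    define h where "h = (\<lambda>y. complex_of_real (exp (- pi * t * y\<^sup>2)) * e2pi (of_real ((s + of_int k) * y)))"
    \<comment> \<open>Since \<open>k * n\<close> is an integer, the character at \<open>x\<close>
      may be evaluated at \<open>n + x\<close>; every summand thereby becomes a translate of the
      same function \<open>h\<close>.\<close>
    have eq: "?f n x * e2pi (of_int k * of_real x) = h (of_int n + x)" for n x
    proof -
      have "e2pi (of_real ((s + of_int k) * (of_int n + x))) = e2pi (of_real ((of_int n + x) * s)) * e2pi (of_int k * of_real x) * e2pi (of_int (k * n))"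
        by (simp add: algebra_simps flip: e2pi_add)
      then show ?thesis by (simp add: h_def e2pi_Ints)
    qed
    have hs: "((\<lambda>n. integral {0..1} (\<lambda>x. ?f n x * e2pi (of_int k * of_real x))) has_sum
       integral {0..1} (\<lambda>x. \<Sum>\<^sub>\<infinity>n. ?f n x * e2pi (of_int k * of_real x))) UNIV"
    proof (rule series_integral(2)[OF _ _ fM[of 1]])
      show "continuous_on {0..1} (\<lambda>x. ?f n x * e2pi (of_int k * of_real x))" for n
        by (intro continuous_intros)
      show "norm (?f n x * e2pi (of_int k * of_real x)) \<le> exp (pi * t * 1\<^sup>2) * exp (- (pi * t / 2) * (of_int n + 0)\<^sup>2)" if "x \<in> {0..1}" for n x
        using fb[of x 1 n] that by (simp add: norm_mult[of _ "e2pi (of_int k * of_real x)"] norm_e2pi)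
    qed
    have inf: "(\<Sum>\<^sub>\<infinity>n. ?f n x * e2pi (of_int k * of_real x)) = ?F x * e2pi (of_int k * of_real x)" for x
      by (rule infsum_cmult_left')
    have "integral {0..1} (\<lambda>x. ?F x * e2pi (of_int k * of_real x)) = integral\<^sup>L lborel h"
    proof (rule integral_over_unit_intervals)
      show "continuous_on UNIV h" unfolding h_def by (intro continuous_intros)
      show "integrable lborel h" unfolding h_def by (rule gaussian_fourier(1)[OF t])
      show "((\<lambda>n. integral {0..1} (\<lambda>x. h (of_int n + x))) has_sum integral {0..1} (\<lambda>x. ?F x * e2pi (of_int k * of_real x))) UNIV"
        using hs unfolding inf unfolding eq .
    qed
    also have "\<dots> = ?a (- k)" unfolding h_def gaussian_fourier(2)[OF t]
      by (simp add: power2_eq_square algebra_simps)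
    finally show ?thesis .
  qed
  have GI: "integral {0..1} (\<lambda>x. ?G x * e2pi (of_int k * of_real x)) = ?a (- k)" for k :: int
  proof -
    have hs: "((\<lambda>m. integral {0..1} (\<lambda>x. ?g m x * e2pi (of_int k * of_real x))) has_sum
       integral {0..1} (\<lambda>x. \<Sum>\<^sub>\<infinity>m. ?g m x * e2pi (of_int k * of_real x))) UNIV"
    proof (rule series_integral(2)[OF _ _ gM])
      show "continuous_on {0..1} (\<lambda>x. ?g m x * e2pi (of_int k * of_real x))" for m
        by (intro continuous_intros)
      show "norm (?g m x * e2pi (of_int k * of_real x)) \<le> 1 / sqrt t * exp (- (pi / t) * (of_int m + (- s))\<^sup>2)" for m x
        using gb[of m x] unfolding norm_mult[of _ "e2pi (of_int k * of_real x)"] by (simp add: norm_e2pi)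
    qed
    have inf: "(\<Sum>\<^sub>\<infinity>m. ?g m x * e2pi (of_int k * of_real x)) = ?G x * e2pi (of_int k * of_real x)" for x
      by (rule infsum_cmult_left')
    have "integral {0..1} (\<lambda>x. ?g m x * e2pi (of_int k * of_real x)) = (if m = - k then ?a m else 0)" for m
    proof -
      have "integral {0..1} (\<lambda>x. ?g m x * e2pi (of_int k * of_real x)) = integral {0..1} (\<lambda>x. ?a m * e2pi (of_int (m + k) * of_real x))"
        by (simp only: of_int_add distrib_right e2pi_add mult.assoc)
      also have "\<dots> = ?a m * integral {0..1} (\<lambda>x. e2pi (of_int (m + k) * of_real x))"
        by (rule integral_mult_right)
      finally have fin: "integral {0..1} (\<lambda>x. ?g m x * e2pi (of_int k * of_real x)) = ?a m * (if m + k = 0 then 1 else 0)"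
        unfolding integral_e2pi .
      show ?thesis unfolding fin by (simp add: add_eq_0_iff2)
    qed
    with hs inf have "((\<lambda>m. if m = - k then ?a m else 0) has_sum integral {0..1} (\<lambda>x. ?G x * e2pi (of_int k * of_real x))) UNIV"
      by simp
    moreover have "((\<lambda>m. if m = - k then ?a m else 0) has_sum ?a (- k)) UNIV"
      by (rule has_sum_finite_neutralI[of "{- k}"]) auto
    ultimately show ?thesis by (rule has_sum_unique)
  qed
  have "?F x - ?G x = 0"
  proof (rule fourier_unique[of "\<lambda>x. ?F x - ?G x"])
    show "continuous_on UNIV (\<lambda>x. ?F x - ?G x)" by (intro continuous_on_diff Fc Gc)
    show "?F (x + 1) - ?G (x + 1) = ?F x - ?G x" for x unfolding Fp Gp ..
    fix m :: int
    have "integral {0..1} (\<lambda>x. (?F x - ?G x) * e2pi (of_int m * of_real x)) =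
      integral {0..1} (\<lambda>x. ?F x * e2pi (of_int m * of_real x)) - integral {0..1} (\<lambda>x. ?G x * e2pi (of_int m * of_real x))"
      unfolding left_diff_distrib
      by (intro Henstock_Kurzweil_Integration.integral_diff integrable_continuous_interval continuous_on_mult
            continuous_on_subset[OF Fc] continuous_on_subset[OF Gc] continuous_intros) auto
    then show "integral {0..1} (\<lambda>x. (?F x - ?G x) * e2pi (of_int m * of_real x)) = 0"
      unfolding FI GI by simp
  qed
  then show ?thesis by simp
qed

section \<open>The Jacobi inversion formula\<close>

definition jacobi_theta :: "real \<Rightarrow> real \<Rightarrow> complex \<Rightarrow> complex" where
  "jacobi_theta r s \<tau> = (\<Sum>\<^sub>\<infinity>n::int. e2pi (\<tau> * (of_int n + of_real r)\<^sup>2 / 2 + (of_int n + of_real r) * of_real s))"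

text \<open>Genus one is the instance with the one-element index type, from which holomorphy in
  \<tau> is inherited.\<close>

lemma jacobi_theta_eq_theta: "jacobi_theta r s \<tau> = theta (\<chi> i::1. r) (\<chi> i. s) (\<chi> i j. \<tau>)"
proof -
  have b: "bij_betw (\<lambda>n::int. (\<chi> i::1. n)) UNIV UNIV"
    by (rule bij_betwI[where g="\<lambda>v. v $ 1"]) (auto simp: vec_eq_iff)
  have "theta (\<chi> i::1. r) (\<chi> i. s) (\<chi> i j. \<tau>) = (\<Sum>\<^sub>\<infinity>n::int. theta_term (\<chi> i::1. r) (\<chi> i. s) (\<chi> i j. \<tau>) (\<chi> i. n))"
    unfolding theta_altdef by (rule infsum_reindex_bij_betw[OF b, symmetric])
  then show ?thesis
    by (simp add: jacobi_theta_def theta_term_def qf_def ivec_def inner_vec_def power2_eq_square mult_ac)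
qed

lemma siegel_space_1: "(\<chi> i j. \<tau>) \<in> (siegel_space :: (complex ^ 1 ^ 1) set) \<longleftrightarrow> Im \<tau> > 0"
proof -
  have "qf x (\<chi> i j. \<tau>) = of_real ((x $ 1)\<^sup>2) * \<tau>" for x :: "real ^ 1"
    by (simp add: qf_def power2_eq_square)
  then have *: "Im (qf x (\<chi> i j. \<tau>)) = (x $ 1)\<^sup>2 * Im \<tau>" for x :: "real ^ 1"
    by simp
  have "(\<chi> i. 1) \<noteq> (0 :: real ^ 1)" by (simp add: vec_eq_iff)
  then show ?thesis unfolding siegel_space_iff *
    by (auto simp: vec_eq_iff dest!: spec[of _ "\<chi> i. 1"])
qed

lemma jacobi_theta_holomorphic: "jacobi_theta r s holomorphic_on {\<tau>. Im \<tau> > 0}"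
proof -
  have z: "zline 0 (\<chi> i j. 1) \<tau> = (\<chi> i j. \<tau>)" for \<tau> :: complex
    by (simp add: zline_def map_mat_def vec_eq_iff)
  have "(\<lambda>\<tau>. theta (\<chi> i::1. r) (\<chi> i. s) (zline 0 (\<chi> i j. 1) \<tau>)) holomorphic_on {\<tau>. Im \<tau> > 0}"
    by (rule siegel_holomorphic_line[OF siegel_holomorphic_theta])
       (auto simp: z siegel_space_1 open_halfspace_Im_gt)
  then show ?thesis unfolding z by (simp add: jacobi_theta_eq_theta[abs_def])
qed

lemma jacobi_theta_inversion_imag:
  assumes t: "t > 0"
  shows "jacobi_theta r s (\<i> * of_real t) = of_real (1 / sqrt t) * (e2pi (of_real (r * s)) * jacobi_theta (- s) r (\<i> / of_real t))"
proof -
  have "jacobi_theta r s (\<i> * of_real t) = (\<Sum>\<^sub>\<infinity>n::int. of_real (exp (- pi * t * (of_int n + r)\<^sup>2)) * e2pi (of_real ((of_int n + r) * s)))"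
    unfolding jacobi_theta_def e2pi_add
    by (intro infsum_cong arg_cong2[where f="(*)"])
       (simp_all add: e2pi_def exp_of_real[symmetric] field_simps del: exp_of_real)
  also have "\<dots> = (\<Sum>\<^sub>\<infinity>m::int. of_real (exp (- pi * (of_int m - s)\<^sup>2 / t) / sqrt t) * e2pi (of_int m * of_real r))"
    by (rule poisson_gauss[OF t])
  also have "\<dots> = (\<Sum>\<^sub>\<infinity>m::int. (of_real (1 / sqrt t) * e2pi (of_real (r * s))) *
     e2pi ((\<i> / of_real t) * (of_int m + of_real (- s))\<^sup>2 / 2 + (of_int m + of_real (- s)) * of_real r))"
  proof (rule infsum_cong)
    fix m :: int
    have "of_real (exp (- pi * (of_int m - s)\<^sup>2 / t)) = e2pi ((\<i> / of_real t) * (of_int m + of_real (- s))\<^sup>2 / 2)"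
      by (simp add: e2pi_def exp_of_real[symmetric] field_simps del: exp_of_real)
    moreover have "e2pi (of_int m * of_real r) = e2pi (of_real (r * s)) * e2pi ((of_int m + of_real (- s)) * of_real r)"
      by (simp add: algebra_simps flip: e2pi_add)
    ultimately show "of_real (exp (- pi * (of_int m - s)\<^sup>2 / t) / sqrt t) * e2pi (of_int m * of_real r) =
      (of_real (1 / sqrt t) * e2pi (of_real (r * s))) *
     e2pi ((\<i> / of_real t) * (of_int m + of_real (- s))\<^sup>2 / 2 + (of_int m + of_real (- s)) * of_real r)"
      by (simp add: e2pi_add)
  qed
  also have "\<dots> = of_real (1 / sqrt t) * (e2pi (of_real (r * s)) * jacobi_theta (- s) r (\<i> / of_real t))"
    unfolding jacobi_theta_def by (subst infsum_cmult_right') (simp add: mult.assoc)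
  finally show ?thesis .
qed

text \<open>The square root of \<open>- \<i> * \<tau>\<close> that is positive on the imaginary
  half-axis. It is holomorphic on the upper half-plane because \<open>- \<i> * \<tau>\<close> has
  positive real part there.\<close>

definition rtfac :: "complex \<Rightarrow> complex" where
  "rtfac \<tau> = exp (Ln (- \<i> * \<tau>) / 2)"

lemma rtfac_power2: "\<tau> \<noteq> 0 \<Longrightarrow> rtfac \<tau> ^ 2 = - \<i> * \<tau>"
  by (simp add: rtfac_def flip: exp_double)

lemma rtfac_nonzero [simp]: "rtfac \<tau> \<noteq> 0"
  by (simp add: rtfac_def)

text \<open>Both sides are holomorphic in the upper half-plane and agree on a segment of the
  imaginary axis by Poisson summation, so the identity theorem applies.\<close>

lemma jacobi_theta_inversion:
  assumes \<tau>: "Im \<tau> > 0"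
  shows "rtfac \<tau> * jacobi_theta r s \<tau> = e2pi (of_real (r * s)) * jacobi_theta (- s) r (- 1 / \<tau>)"
proof -
  let ?H = "{\<tau>. Im \<tau> > 0}"
  let ?d = "\<lambda>\<tau>. rtfac \<tau> * jacobi_theta r s \<tau> - e2pi (of_real (r * s)) * jacobi_theta (- s) r (- 1 / \<tau>)"
  have H: "open ?H" "connected ?H"
    by (auto simp: open_halfspace_Im_gt intro: convex_connected convex_halfspace_Im_gt)
  have "(\<lambda>\<tau>. jacobi_theta (- s) r (- 1 / \<tau>)) holomorphic_on ?H"
  proof -
    have "(jacobi_theta (- s) r \<circ> (\<lambda>\<tau>. - 1 / \<tau>)) holomorphic_on ?H"
    proof (rule holomorphic_on_compose_gen[OF _ jacobi_theta_holomorphic])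
      show "(\<lambda>\<tau>. - 1 / \<tau>) holomorphic_on ?H" by (intro holomorphic_intros) auto
      show "(\<lambda>\<tau>. - 1 / \<tau>) ` ?H \<subseteq> ?H" by (auto simp: Im_divide_Reals complex_div_gt_0 Im_divide sum_power2_gt_zero_iff)
    qed
    then show ?thesis by (simp add: o_def)
  qed
  moreover have "rtfac holomorphic_on ?H"
    unfolding rtfac_def by (intro holomorphic_intros) (auto simp: complex_nonpos_Reals_iff)
  ultimately have "?d holomorphic_on ?H"
    by (intro holomorphic_intros jacobi_theta_holomorphic)
  moreover have "?d z = 0" if z: "z \<in> (\<lambda>t. \<i> * of_real t) ` {1..2}" for z
  proof -
    obtain t :: real where t: "z = \<i> * of_real t" "t > 0" using z by auto
    have "- \<i> * z = of_real t" by (simp add: t)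
    then have "rtfac z = of_real (sqrt t)"
      using t(2) exp_of_real[of "ln t / 2", where 'a=complex]
      by (simp add: rtfac_def Ln_of_real powr_half_sqrt[symmetric] powr_def)
    moreover have "- 1 / z = \<i> / of_real t" using t(2) by (subst frac_eq_eq) (auto simp: t(1))
    ultimately show ?thesis using t(2) by (simp add: t(1) jacobi_theta_inversion_imag)
  qed
  moreover have "\<i> islimpt (\<lambda>t. \<i> * of_real t) ` {1..2}"
  proof -
    have "\<i> * of_real 1 islimpt (\<lambda>t. \<i> * of_real t) ` {1..2}"
    proof (rule islimpt_isCont_image)
      show "(1::real) islimpt {1..2}" by (simp add: islimpt_Icc)
    qed (auto intro!: continuous_intros eventually_neq_at_within simp: eventually_at_filter)
    then show ?thesis by simp
  qed
  ultimately have "?d \<tau> = 0"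
    by (intro analytic_continuation[of ?d ?H "(\<lambda>t. \<i> * of_real t) ` {1..2}" \<i> \<tau>]) (use H \<tau> in auto)
  then show ?thesis by simp
qed

text \<open>Every complex \<open>z\<close> is \<open>a + \<tau> b\<close> with real \<open>a\<close>, \<open>b\<close>, so the inversion formula for real
  characteristics covers complex arguments.\<close>

lemma jacobi_inversion:
  assumes \<tau>: "Im \<tau> > 0"
  shows "rtfac \<tau> * (\<Sum>\<^sub>\<infinity>n::int. e2pi (\<tau> * (of_int n + of_real r)\<^sup>2 / 2 + (of_int n + of_real r) * z))
    = (\<Sum>\<^sub>\<infinity>m::int. e2pi (- (of_int m - z)\<^sup>2 / (2 * \<tau>) + of_int m * of_real r))"
proof -
  have \<tau>0: "\<tau> \<noteq> 0" using \<tau> by auto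
  define b where "b = Im z / Im \<tau>"
  define a where "a = Re (z - \<tau> * of_real b)"
  have z: "z = of_real a + \<tau> * of_real b"
    using \<tau> by (simp add: complex_eq_iff a_def b_def)
  \<comment> \<open>Completing the square: the part \<open>\<tau> * b\<close> of the argument moves
    into the characteristic \<open>r + b\<close>, at the price of a factor that does not depend on
    \<open>n\<close>.\<close>
  have l: "e2pi (\<tau> * (of_int n + of_real r)\<^sup>2 / 2 + (of_int n + of_real r) * z) = e2pi (- \<tau> * of_real b ^ 2 / 2 - of_real (b * a)) *
     e2pi (\<tau> * (of_int n + of_real (r + b))\<^sup>2 / 2 + (of_int n + of_real (r + b)) * of_real a)" for n :: int
    unfolding e2pi_add[symmetric] z by (rule arg_cong[where f=e2pi]) (simp add: field_simps power2_eq_square)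
  have r: "e2pi (- (of_int m - z)\<^sup>2 / (2 * \<tau>) + of_int m * of_real r) = (e2pi (- \<tau> * of_real b ^ 2 / 2 - of_real (b * a)) * e2pi (of_real ((r + b) * a))) *
     e2pi ((- 1 / \<tau>) * (of_int m + of_real (- a))\<^sup>2 / 2 + (of_int m + of_real (- a)) * of_real (r + b))" for m :: int
    unfolding e2pi_add[symmetric] z using \<tau>0 by (intro arg_cong[where f=e2pi]) (simp add: field_simps power2_eq_square)
  show ?thesis
    unfolding l r infsum_cmult_right' jacobi_theta_def[symmetric] using jacobi_theta_inversion[OF \<tau>, of "r + b" a] by simp
qed


section \<open>Generators of the integral symplectic group\<close>

text \<open>Left multiplication by the generators, written as row operations.\<close>

definition opT :: "'g::finite \<Rightarrow> int \<Rightarrow> int ^ ('g + 'g) ^ ('g + 'g) \<Rightarrow> int ^ ('g + 'g) ^ ('g + 'g)" where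
  "opT i k \<gamma> = (\<chi> p q. \<gamma> $ p $ q + (if p = Inl i then k * \<gamma> $ Inr i $ q else 0))"

definition opJ :: "'g::finite \<Rightarrow> int ^ ('g + 'g) ^ ('g + 'g) \<Rightarrow> int ^ ('g + 'g) ^ ('g + 'g)" where
  "opJ i \<gamma> = (\<chi> p q. if p = Inl i then - \<gamma> $ Inr i $ q else if p = Inr i then \<gamma> $ Inl i $ q else \<gamma> $ p $ q)"

definition opU :: "'g::finite \<Rightarrow> 'g \<Rightarrow> int \<Rightarrow> int ^ ('g + 'g) ^ ('g + 'g) \<Rightarrow> int ^ ('g + 'g) ^ ('g + 'g)" where
  "opU i j k \<gamma> = (\<chi> p q. \<gamma> $ p $ q + (if p = Inl i then k * \<gamma> $ Inl j $ q else 0)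
      - (if p = Inr j then k * \<gamma> $ Inr i $ q else 0))"

lemma opT_nth [simp]: "opT i k \<gamma> $ Inl l $ q = \<gamma> $ Inl l $ q + (if l = i then k * \<gamma> $ Inr i $ q else 0)"
  "opT i k \<gamma> $ Inr l $ q = \<gamma> $ Inr l $ q"
  by (simp_all add: opT_def)

lemma opJ_nth [simp]: "opJ i \<gamma> $ Inl l $ q = (if l = i then - \<gamma> $ Inr i $ q else \<gamma> $ Inl l $ q)"
  "opJ i \<gamma> $ Inr l $ q = (if l = i then \<gamma> $ Inl i $ q else \<gamma> $ Inr l $ q)"
  by (simp_all add: opJ_def)

lemma opU_nth [simp]: "opU i j k \<gamma> $ Inl l $ q = \<gamma> $ Inl l $ q + (if l = i then k * \<gamma> $ Inl j $ q else 0)"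
  "opU i j k \<gamma> $ Inr l $ q = \<gamma> $ Inr l $ q - (if l = j then k * \<gamma> $ Inr i $ q else 0)"
  by (simp_all add: opU_def)

lemma plus_vec_eq_iff: "(x :: 'a ^ ('g::finite + 'g)) = y \<longleftrightarrow> (\<forall>i. x $ Inl i = y $ Inl i) \<and> (\<forall>i. x $ Inr i = y $ Inr i)"
  unfolding vec_eq_iff by (metis sum.exhaust)

lemma sum_UNIV_plus: "(\<Sum>p\<in>UNIV. f p) = (\<Sum>i\<in>UNIV. f (Inl i)) + (\<Sum>i\<in>UNIV. f (Inr i))"
  for f :: "'a::finite + 'b::finite \<Rightarrow> 'c::comm_monoid_add"
  unfolding UNIV_Plus_UNIV[symmetric] by (subst sum.Plus) auto

text \<open>The symplectic pairing of columns \<open>p\<close> and \<open>q\<close>, that is, the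
  entry of \<open>transpose \<gamma> ** symplectic_J ** \<gamma>\<close> at that position.\<close>

definition omega :: "int ^ ('g::finite + 'g) ^ ('g + 'g) \<Rightarrow> 'g + 'g \<Rightarrow> 'g + 'g \<Rightarrow> int" where
  "omega \<gamma> p q = (\<Sum>i\<in>UNIV. \<gamma> $ Inr i $ p * \<gamma> $ Inl i $ q - \<gamma> $ Inl i $ p * \<gamma> $ Inr i $ q)"

lemma Sp_int_iff: "\<gamma> \<in> Sp_int \<longleftrightarrow> (\<forall>p q. omega \<gamma> p q = symplectic_J $ p $ q)"
proof -
  have "(transpose \<gamma> ** symplectic_J ** \<gamma>) $ p $ q = omega \<gamma> p q" for p q
    by (simp add: matrix_matrix_mult_def transpose_def symplectic_J_def omega_def sum_UNIV_plus
        if_distrib[of "\<lambda>x. _ * x"] sum.delta' sum_subtractf sum_negf cong: if_cong)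
  then show ?thesis by (auto simp: Sp_int_def vec_eq_iff)
qed

text \<open>Words in the generators, extended on the left only, so that induction strips off one row
  operation at a time.\<close>

inductive_set spgen :: "(int ^ ('g::finite + 'g) ^ ('g + 'g)) set" where
  one: "mat 1 \<in> spgen"
| T: "\<gamma> \<in> spgen \<Longrightarrow> opT i k \<gamma> \<in> spgen"
| J: "\<gamma> \<in> spgen \<Longrightarrow> opJ i \<gamma> \<in> spgen"
| U: "\<gamma> \<in> spgen \<Longrightarrow> i \<noteq> j \<Longrightarrow> opU i j k \<gamma> \<in> spgen"

lemma opT_inv: "opT i (- k) (opT i k \<gamma>) = \<gamma>"
  by (simp add: plus_vec_eq_iff vec_eq_iff)

lemma opJ_inv: "opJ i (opJ i (opJ i (opJ i \<gamma>))) = \<gamma>"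
  by (simp add: plus_vec_eq_iff vec_eq_iff)

lemma opU_inv: "i \<noteq> j \<Longrightarrow> opU i j (- k) (opU i j k \<gamma>) = \<gamma>"
  by (simp add: plus_vec_eq_iff vec_eq_iff)

text \<open>Each row operation can be undone by operations of the same kind (\<open>opJ\<close> has
  order four), so it suffices to reduce a matrix to one already known to be generated.\<close>

lemma spgen_TD: "opT i k \<gamma> \<in> spgen \<Longrightarrow> \<gamma> \<in> spgen"
  by (metis opT_inv spgen.T)

lemma spgen_JD: "opJ i \<gamma> \<in> spgen \<Longrightarrow> \<gamma> \<in> spgen"
  by (metis opJ_inv spgen.J)

lemma spgen_UD: "opU i j k \<gamma> \<in> spgen \<Longrightarrow> i \<noteq> j \<Longrightarrow> \<gamma> \<in> spgen"
  by (metis opU_inv spgen.U)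

lemma omega_opT [simp]: "omega (opT i k \<gamma>) p q = omega \<gamma> p q"
  unfolding omega_def by (intro sum.cong) (auto simp: algebra_simps)

lemma omega_opJ [simp]: "omega (opJ i \<gamma>) p q = omega \<gamma> p q"
  unfolding omega_def by (intro sum.cong) (auto simp: algebra_simps)

text \<open>Records the progress of the row reduction. The expression
  \<open>case_sum id id p\<close> is the index of the hyperbolic plane containing the coordinate
  \<open>p\<close>; on the planes in \<open>P\<close> both rows and columns are already those of the
  identity.\<close>

definition fixes_planes :: "'g set \<Rightarrow> int ^ ('g::finite + 'g) ^ ('g + 'g) \<Rightarrow> bool" where
  "fixes_planes P \<gamma> \<longleftrightarrow> (\<forall>p q. case_sum id id p \<in> P \<or> case_sum id id q \<in> P \<longrightarrow> \<gamma> $ p $ q = (if p = q then 1 else 0))"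

definition sp_fixing :: "'g set \<Rightarrow> int ^ ('g::finite + 'g) ^ ('g + 'g) \<Rightarrow> bool" where
  "sp_fixing P \<gamma> \<longleftrightarrow> \<gamma> \<in> Sp_int \<and> fixes_planes P \<gamma>"

lemma omega_opU: 
  assumes "i \<noteq> j"
  shows "omega (opU i j k \<gamma>) p q = omega \<gamma> p q"
proof -
  let ?e = "k * (\<gamma> $ Inr i $ p * \<gamma> $ Inl j $ q - \<gamma> $ Inl j $ p * \<gamma> $ Inr i $ q)"
  have "omega (opU i j k \<gamma>) p q = (\<Sum>l\<in>UNIV. \<gamma> $ Inr l $ p * \<gamma> $ Inl l $ q - \<gamma> $ Inl l $ p * \<gamma> $ Inr l $ q
     + ((if l = i then ?e else 0) - (if l = j then ?e else 0)))"
    unfolding omega_def using assms by (intro sum.cong) (auto simp: algebra_simps)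
  then show ?thesis
    by (simp add: sum.distrib sum_subtractf omega_def)
qed

lemma sp_fixing_opT: "sp_fixing P \<gamma> \<Longrightarrow> i \<notin> P \<Longrightarrow> sp_fixing P (opT i k \<gamma>)"
  unfolding sp_fixing_def Sp_int_iff fixes_planes_def omega_opT by (auto simp: opT_def)

lemma sp_fixing_opJ: "sp_fixing P \<gamma> \<Longrightarrow> i \<notin> P \<Longrightarrow> sp_fixing P (opJ i \<gamma>)"
  unfolding sp_fixing_def Sp_int_iff fixes_planes_def omega_opJ by (auto simp: opJ_def)

lemma sp_fixing_opU: "sp_fixing P \<gamma> \<Longrightarrow> i \<notin> P \<Longrightarrow> j \<notin> P \<Longrightarrow> i \<noteq> j \<Longrightarrow> sp_fixing P (opU i j k \<gamma>)"
  unfolding sp_fixing_def Sp_int_iff fixes_planes_def by (intro conjI, simp add: omega_opU) (auto simp: opU_def)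

lemma sp_fixing_omega: "sp_fixing P \<gamma> \<Longrightarrow> omega \<gamma> p q = symplectic_J $ p $ q"
  by (simp add: sp_fixing_def Sp_int_iff)

text \<open>The symplectic relations force the rows of the plane \<open>i\<close> to be unit vectors, too.\<close>

lemma sp_fixing_insert:
  assumes g: "sp_fixing P \<gamma>"
    and c: "\<And>p. \<gamma> $ p $ Inl i = (if p = Inl i then 1 else 0)"
    and d: "\<And>p. \<gamma> $ p $ Inr i = (if p = Inr i then 1 else 0)"
  shows "sp_fixing (insert i P) \<gamma>"
proof -
  have 1: "\<gamma> $ Inr i $ q = (if q = Inr i then 1 else 0)" for q
    using sp_fixing_omega[OF g, of "Inl i" q]
    by (cases q) (auto simp: omega_def c symplectic_J_def sum_negf mult_delta_left split: if_splits)
  have 2: "\<gamma> $ Inl i $ q = (if q = Inl i then 1 else 0)" for q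
    using sp_fixing_omega[OF g, of "Inr i" q]
    by (cases q) (auto simp: omega_def d symplectic_J_def mult_delta_left split: if_splits)
  show ?thesis
    using g unfolding sp_fixing_def fixes_planes_def
    by (auto simp: 1 2 c d split: sum.splits)
qed

text \<open>Once column \<open>Inl i\<close> is a unit vector, its pairing with column
  \<open>Inr i\<close> forces the entry at \<open>(Inr i, Inr i)\<close> to be 1. This pivot clears
  one further plane per round; the induction counts the planes still to be cleared.\<close>

lemma clear_second_column:
  assumes step: "\<And>\<gamma>. sp_fixing (insert i P) \<gamma> \<Longrightarrow> \<gamma> \<in> spgen"
    and iP: "i \<notin> P"
    and g: "sp_fixing P \<gamma>" and c: "\<And>p. \<gamma> $ p $ Inl i = (if p = Inl i then 1 else 0)"
  shows "\<gamma> \<in> spgen"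
  using g c
proof (induction "card {j. j \<noteq> i \<and> (\<gamma> $ Inl j $ Inr i \<noteq> 0 \<or> \<gamma> $ Inr j $ Inr i \<noteq> 0)}" arbitrary: \<gamma> rule: less_induct)
  case less
  note g = less.prems(1) and c = less.prems(2)
  let ?S = "\<lambda>\<gamma>. {j. j \<noteq> i \<and> (\<gamma> $ Inl j $ Inr i \<noteq> 0 \<or> \<gamma> $ Inr j $ Inr i \<noteq> 0)}"
  have one: "\<gamma> $ Inr i $ Inr i = 1"
    using sp_fixing_omega[OF g, of "Inl i" "Inr i"] by (auto simp: omega_def c symplectic_J_def sum_negf mult_delta_left)
  show ?case
  proof (cases "?S \<gamma> = {}")
    case True
    define \<gamma>' where "\<gamma>' = opT i (- (\<gamma> $ Inl i $ Inr i)) \<gamma>"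
    have "sp_fixing P \<gamma>'" unfolding \<gamma>'_def by (rule sp_fixing_opT[OF g iP])
    moreover have "\<gamma>' $ p $ Inl i = (if p = Inl i then 1 else 0)" for p
      by (cases p) (auto simp: \<gamma>'_def c)
    moreover have "\<gamma>' $ p $ Inr i = (if p = Inr i then 1 else 0)" for p
      using True by (cases p) (auto simp: \<gamma>'_def one)
    ultimately have "\<gamma>' \<in> spgen" by (intro step sp_fixing_insert)
    then show ?thesis unfolding \<gamma>'_def by (rule spgen_TD)
  next
    case False
    then obtain j where j: "j \<in> ?S \<gamma>" by blast
    then have ji: "j \<noteq> i" by simp
    have jP: "j \<notin> P"
    proof
      assume "j \<in> P"
      then have "\<gamma> $ Inl j $ Inr i = 0" "\<gamma> $ Inr j $ Inr i = 0"
        using g by (auto simp: sp_fixing_def fixes_planes_def ji)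
      then show False using j by simp
    qed
    \<comment> \<open>\<open>opU\<close> clears the \<open>Inr j\<close> entry with the pivot,
      \<open>opJ\<close> exchanges the two entries of plane \<open>j\<close> up to sign, and a
      second \<open>opU\<close> clears what was the \<open>Inl j\<close> entry. Column
      \<open>Inl i\<close> stays a unit vector throughout.\<close>
    define \<gamma>1 where "\<gamma>1 = opU i j (\<gamma> $ Inr j $ Inr i) \<gamma>"
    define \<gamma>2 where "\<gamma>2 = opJ j \<gamma>1"
    define \<gamma>3 where "\<gamma>3 = opU i j (\<gamma>2 $ Inr j $ Inr i) \<gamma>2"
    have "sp_fixing P \<gamma>3" unfolding \<gamma>1_def \<gamma>2_def \<gamma>3_def
      using g iP jP ji by (intro sp_fixing_opU sp_fixing_opJ) auto
    moreover have c3: "\<gamma>3 $ p $ Inl i = (if p = Inl i then 1 else 0)" for p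
      using ji by (cases p) (auto simp: \<gamma>1_def \<gamma>2_def \<gamma>3_def c)
    moreover have "?S \<gamma>3 \<subseteq> ?S \<gamma> - {j}"
      using ji by (auto simp: \<gamma>1_def \<gamma>2_def \<gamma>3_def one split: if_splits)
    then have "card (?S \<gamma>3) < card (?S \<gamma>)"
      using j by (intro psubset_card_mono) auto
    ultimately have "\<gamma>3 \<in> spgen" using less.hyps by blast
    then show ?thesis
      unfolding \<gamma>1_def \<gamma>2_def \<gamma>3_def using ji by (metis spgen_UD spgen_JD)
  qed
qed

text \<open>A Euclidean algorithm on column \<open>Inl i\<close>. The unequal weights 2 and 3 in the
  measure make \<open>opJ\<close> a strict decrease whenever it moves the larger entry of a plane
  from the lower half to the upper half, just as division with remainder is one.\<close>

lemma clear_first_column: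
  assumes step: "\<And>\<gamma>. sp_fixing (insert i P) \<gamma> \<Longrightarrow> \<gamma> \<in> spgen"
    and iP: "i \<notin> P" and g: "sp_fixing P \<gamma>"
  shows "\<gamma> \<in> spgen"
  using g
proof (induction "\<Sum>j\<in>UNIV. 2 * nat \<bar>\<gamma> $ Inl j $ Inl i\<bar> + 3 * nat \<bar>\<gamma> $ Inr j $ Inl i\<bar>" arbitrary: \<gamma> rule: less_induct)
  case less
  note g = less.prems
  let ?m = "\<lambda>\<gamma> j. 2 * nat \<bar>\<gamma> $ Inl j $ Inl i\<bar> + 3 * nat \<bar>\<gamma> $ Inr j $ Inl i\<bar>"
  have IH: "\<gamma>' \<in> spgen" if "sp_fixing P \<gamma>'" "\<And>l. l \<noteq> j \<Longrightarrow> ?m \<gamma>' l = ?m \<gamma> l" "?m \<gamma>' j < ?m \<gamma> j" for \<gamma>' j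
  proof (rule less.hyps[OF _ that(1)])
    have "?m \<gamma>' l \<le> ?m \<gamma> l" for l
    proof (cases "l = j")
      case True then show ?thesis using less_imp_le[OF that(3)] by blast
    next
      case False then show ?thesis using that(2) by simp
    qed
    then show "sum (?m \<gamma>') UNIV < sum (?m \<gamma>) UNIV"
      using that(3) by (intro sum_strict_mono_ex1 ballI bexI[of _ j]) simp_all
  qed
  have z: "\<gamma> $ Inl j $ Inl i = 0" "\<gamma> $ Inr j $ Inl i = 0" if "j \<in> P" for j
    using g that iP by (auto simp: sp_fixing_def fixes_planes_def)
  have md: "\<bar>a mod b\<bar> < \<bar>b\<bar>" if "b \<noteq> 0" for a b :: int
    using that abs_mod_less by blast
  have emod: "a + - (a div b) * b = a mod b" for a b :: int
    by (simp add: minus_div_mult_eq_mod [symmetric])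
  \<comment> \<open>The cases are: a nonzero lower entry, reduced within its own plane; two nonzero
    upper entries with zero lower half, reduced against each other; at most one nonzero upper entry,
    where the algorithm stops.\<close>
  consider (b) j where "\<gamma> $ Inr j $ Inl i \<noteq> 0"
    | (a) j l where "\<And>j. \<gamma> $ Inr j $ Inl i = 0" "j \<noteq> l" "\<gamma> $ Inl l $ Inl i \<noteq> 0" "\<bar>\<gamma> $ Inl l $ Inl i\<bar> \<le> \<bar>\<gamma> $ Inl j $ Inl i\<bar>"
    | (c) j where "\<And>j. \<gamma> $ Inr j $ Inl i = 0" "\<And>l. l \<noteq> j \<Longrightarrow> \<gamma> $ Inl l $ Inl i = 0"
  proof (cases "\<exists>j. \<gamma> $ Inr j $ Inl i \<noteq> 0")
    case True then show ?thesis using b by blast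
  next
    case F: False
    show ?thesis
    proof (cases "\<exists>j. \<forall>l. l \<noteq> j \<longrightarrow> \<gamma> $ Inl l $ Inl i = 0")
      case True then show ?thesis using F c by blast
    next
      case False
      then obtain l where l: "\<gamma> $ Inl l $ Inl i \<noteq> 0" by blast
      from False obtain j where j: "j \<noteq> l" "\<gamma> $ Inl j $ Inl i \<noteq> 0" by blast
      then show ?thesis using a[of j l] a[of l j] F l by (cases "\<bar>\<gamma> $ Inl l $ Inl i\<bar> \<le> \<bar>\<gamma> $ Inl j $ Inl i\<bar>") auto
    qed
  qed
  then show ?case
  proof cases
    case (b j)
    have jP: "j \<notin> P" using b z by blast
    show ?thesis
    proof (cases "\<bar>\<gamma> $ Inl j $ Inl i\<bar> < \<bar>\<gamma> $ Inr j $ Inl i\<bar>")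
      case True
      have "opJ j \<gamma> \<in> spgen"
        by (rule IH[of _ j]) (use True in \<open>auto intro: sp_fixing_opJ[OF g jP]\<close>)
      then show ?thesis by (rule spgen_JD)
    next
      case False
      define k where "k = - (\<gamma> $ Inl j $ Inl i div \<gamma> $ Inr j $ Inl i)"
      have "\<bar>\<gamma> $ Inl j $ Inl i + k * \<gamma> $ Inr j $ Inl i\<bar> < \<bar>\<gamma> $ Inr j $ Inl i\<bar>"
        unfolding k_def emod using b by (rule md)
      then have "opT j k \<gamma> \<in> spgen"
        by (intro IH[of _ j]) (use False in \<open>auto intro: sp_fixing_opT[OF g jP]\<close>)
      then show ?thesis by (rule spgen_TD)
    qed
  next
    case (a j l)
    have P: "j \<notin> P" "l \<notin> P" using a z by force+
    define k where "k = - (\<gamma> $ Inl j $ Inl i div \<gamma> $ Inl l $ Inl i)"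
    have "\<bar>\<gamma> $ Inl j $ Inl i + k * \<gamma> $ Inl l $ Inl i\<bar> < \<bar>\<gamma> $ Inl l $ Inl i\<bar>"
      unfolding k_def emod using a(3) by (rule md)
    then have "opU j l k \<gamma> \<in> spgen"
      by (intro IH[of _ j]) (use a in \<open>auto intro: sp_fixing_opU[OF g P a(2)]\<close>)
    then show ?thesis using a(2) by (rule spgen_UD)
  next
    case (c j)
    \<comment> \<open>The surviving entry divides the pairing of columns \<open>Inl i\<close> and
      \<open>Inr i\<close>, hence is a unit. If it is -1, two applications of \<open>opJ i\<close>,
      which negate the plane, correct the sign.\<close>
    have fin: "\<gamma>' \<in> spgen"
      if "sp_fixing P \<gamma>'" "\<And>j. \<gamma>' $ Inr j $ Inl i = 0" "\<And>l. l \<noteq> i \<Longrightarrow> \<gamma>' $ Inl l $ Inl i = 0" for \<gamma>'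
    proof -
      have om: "omega \<gamma>' (Inl i) (Inr i) = - (\<gamma>' $ Inl i $ Inl i * \<gamma>' $ Inr i $ Inr i)"
      proof -
        have "omega \<gamma>' (Inl i) (Inr i) = (\<Sum>l\<in>UNIV. if l = i then - (\<gamma>' $ Inl i $ Inl i * \<gamma>' $ Inr i $ Inr i) else 0)"
          unfolding omega_def by (intro sum.cong) (auto simp: that)
        then show ?thesis by simp
      qed
      then have "\<gamma>' $ Inl i $ Inl i * \<gamma>' $ Inr i $ Inr i = 1"
        using sp_fixing_omega[OF that(1), of "Inl i" "Inr i"] by (simp add: symplectic_J_def)
      then consider "\<gamma>' $ Inl i $ Inl i = 1" | "\<gamma>' $ Inl i $ Inl i = -1"
        by (auto simp: zmult_eq_1_iff)
      then show ?thesis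
      proof cases
        case 1
        have "\<gamma>' $ p $ Inl i = (if p = Inl i then 1 else 0)" for p
          using that 1 by (cases p) auto
        then show ?thesis by (intro clear_second_column[OF step iP that(1)])
      next
        case 2
        have "opJ i (opJ i \<gamma>') $ p $ Inl i = (if p = Inl i then 1 else 0)" for p
          using that 2 by (cases p) auto
        then have "opJ i (opJ i \<gamma>') \<in> spgen"
          by (intro clear_second_column[OF step iP] sp_fixing_opJ that(1) iP)
        then show ?thesis by (metis spgen_JD)
      qed
    qed
    show ?thesis
    proof (cases "j = i")
      case True
      then show ?thesis using c g fin by blast
    next
      case False
      have "\<gamma> $ Inl j $ Inl i \<noteq> 0"
      proof
        assume "\<gamma> $ Inl j $ Inl i = 0"
        then have "\<gamma> $ Inl l $ Inl i = 0" for l using c(2) by (cases "l = j") auto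
        then have "omega \<gamma> (Inl i) (Inr i) = 0" by (simp add: omega_def c(1))
        then show False using sp_fixing_omega[OF g, of "Inl i" "Inr i"] by (simp add: symplectic_J_def)
      qed
      then have jP: "j \<notin> P" using z by blast
      \<comment> \<open>The first substitution copies the surviving entry from row
        \<open>Inl j\<close> to row \<open>Inl i\<close>, the second cancels the original.\<close>
      have "opU j i (-1) (opU i j 1 \<gamma>) \<in> spgen"
        using False c by (intro fin sp_fixing_opU g iP jP) auto
      then show ?thesis using False spgen_UD by metis
    qed
  qed
qed

theorem Sp_int_subset_spgen: "Sp_int \<subseteq> (spgen :: (int ^ ('g::finite + 'g) ^ ('g + 'g)) set)"
proof -
  have "\<gamma> \<in> spgen" if "sp_fixing P \<gamma>" for P and \<gamma> :: "int ^ ('g::finite + 'g) ^ ('g + 'g)"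
    using that
  proof (induction "card (- P)" arbitrary: P \<gamma> rule: less_induct)
    case less
    show ?case
    proof (cases "P = UNIV")
      case True
      then have "\<gamma> = mat 1" using less.prems by (simp add: sp_fixing_def fixes_planes_def vec_eq_iff mat_def)
      then show ?thesis by (simp add: spgen.one)
    next
      case False
      then obtain i where i: "i \<notin> P" by blast
      have "card (- insert i P) < card (- P)" using i by (intro psubset_card_mono) auto
      then have st: "\<gamma>' \<in> spgen" if "sp_fixing (insert i P) \<gamma>'" for \<gamma>'
        using less.hyps[OF _ that] by blast
      show ?thesis by (rule clear_first_column[OF st i less.prems])
    qed
  qed
  from this[of "{}"] show ?thesis by (auto simp: sp_fixing_def fixes_planes_def)
qed


section \<open>Theta constants under the generators\<close>

text \<open>A characteristic \<open>(r, s)\<close> is stored as one vector indexed by \<open>'g + 'g\<close>, on which a symplectic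
  matrix acts by its transpose.\<close>

definition lo :: "real ^ ('g::finite + 'g) \<Rightarrow> real ^ 'g" where "lo v = (\<chi> i. v $ Inl i)"
definition hi :: "real ^ ('g::finite + 'g) \<Rightarrow> real ^ 'g" where "hi v = (\<chi> i. v $ Inr i)"

lemma lo_nth [simp]: "lo v $ i = v $ Inl i" by (simp add: lo_def)
lemma hi_nth [simp]: "hi v $ i = v $ Inr i" by (simp add: hi_def)

text \<open>The factor in front of \<open>theta\<close> is chosen to absorb the phase
  \<open>e2pi (r $ i * s $ i)\<close> of the inversion formula, so that a one-coordinate inversion
  leaves only the square root \<open>rtfac\<close>.\<close>

definition phi :: "real ^ ('g::finite + 'g) \<Rightarrow> complex ^ 'g ^ 'g \<Rightarrow> complex" where
  "phi v Z = e2pi (- of_real (lo v \<bullet> hi v) / 2) * theta (lo v) (hi v) Z"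

definition tact :: "int ^ ('g::finite + 'g) ^ ('g + 'g) \<Rightarrow> real ^ ('g + 'g) \<Rightarrow> real ^ ('g + 'g)" where
  "tact \<gamma> v = (\<chi> q. \<Sum>p\<in>UNIV. of_int (\<gamma> $ p $ q) * v $ p)"

text \<open>This and the next two maps are the transposed generators. Because transposition reverses
  products, a row operation on \<gamma> becomes a map applied to the characteristic before
  \<open>tact \<gamma>\<close>.\<close>

definition chT :: "'g::finite \<Rightarrow> int \<Rightarrow> real ^ ('g + 'g) \<Rightarrow> real ^ ('g + 'g)" where
  "chT i k v = (\<chi> p. v $ p + (if p = Inr i then of_int k * v $ Inl i else 0))"

definition chJ :: "'g::finite \<Rightarrow> real ^ ('g + 'g) \<Rightarrow> real ^ ('g + 'g)" where
  "chJ i v = (\<chi> p. if p = Inl i then v $ Inr i else if p = Inr i then - v $ Inl i else v $ p)"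

definition chU :: "'g::finite \<Rightarrow> 'g \<Rightarrow> int \<Rightarrow> real ^ ('g + 'g) \<Rightarrow> real ^ ('g + 'g)" where
  "chU i j k v = (\<chi> p. v $ p + (if p = Inl j then of_int k * v $ Inl i else 0)
      - (if p = Inr i then of_int k * v $ Inr j else 0))"

lemma tact_opT: "tact (opT i k \<gamma>) v = tact \<gamma> (chT i k v)"
  by (simp add: tact_def chT_def vec_eq_iff opT_def sum_UNIV_plus distrib_right distrib_left sum.distrib
      mult_delta_left mult_delta_right if_distrib[of real_of_int] cong: if_cong)

lemma tact_opJ: "tact (opJ i \<gamma>) v = tact \<gamma> (chJ i v)"
proof -
  have "(\<Sum>p\<in>UNIV. of_int (opJ i \<gamma> $ p $ q) * v $ p) = (\<Sum>p\<in>UNIV. of_int (\<gamma> $ p $ q) * chJ i v $ p)" for q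
  proof -
    have "(\<Sum>a\<in>UNIV. of_int (opJ i \<gamma> $ Inl a $ q) * v $ Inl a + of_int (opJ i \<gamma> $ Inr a $ q) * v $ Inr a)
      = (\<Sum>a\<in>UNIV. of_int (\<gamma> $ Inl a $ q) * chJ i v $ Inl a + of_int (\<gamma> $ Inr a $ q) * chJ i v $ Inr a)"
      by (intro sum.cong) (auto simp: chJ_def)
    then show ?thesis by (simp add: sum_UNIV_plus sum.distrib)
  qed
  then show ?thesis by (simp add: tact_def vec_eq_iff)
qed

lemma tact_opU: "tact (opU i j k \<gamma>) v = tact \<gamma> (chU i j k v)"
  by (simp add: tact_def chU_def vec_eq_iff opU_def sum_UNIV_plus distrib_right distrib_left sum.distrib
      left_diff_distrib right_diff_distrib sum_subtractf
      mult_delta_left mult_delta_right if_distrib[of real_of_int] cong: if_cong)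

lemma tact_one: "tact (mat 1) v = v"
  by (simp add: tact_def mat_def vec_eq_iff if_distrib[of real_of_int] mult_delta_left cong: if_cong)

lemma qf_add_axis:
  assumes "\<And>a b. Z $ a $ b = Z $ b $ a"
  shows "qf (x + c *\<^sub>R axis i 1) Z = qf x Z + 2 * of_real c * (\<Sum>b\<in>UNIV. of_real (x $ b) * Z $ i $ b) + of_real (c\<^sup>2) * Z $ i $ i"
proof -
  have "qf (x + c *\<^sub>R axis i 1) Z = (\<Sum>a\<in>UNIV. \<Sum>b\<in>UNIV. of_real (x $ a) * of_real (x $ b) * Z $ a $ b
     + (if a = i then of_real c * (of_real (x $ b) * Z $ i $ b) else 0) + (if b = i then of_real c * (of_real (x $ a) * Z $ a $ i) else 0)
     + (if a = i then if b = i then of_real (c\<^sup>2) * Z $ i $ i else 0 else 0))"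
    unfolding qf_def by (intro sum.cong refl) (auto simp: axis_def algebra_simps power2_eq_square)
  also have "\<dots> = qf x Z + of_real c * (\<Sum>b\<in>UNIV. of_real (x $ b) * Z $ i $ b) + of_real c * (\<Sum>a\<in>UNIV. of_real (x $ a) * Z $ a $ i)
     + of_real (c\<^sup>2) * Z $ i $ i"
  proof -
    have sw: "(\<Sum>b\<in>UNIV. if a = i then f b else 0) = (if a = i then \<Sum>b\<in>UNIV. f b else (0::complex))" for a and f :: "'a \<Rightarrow> complex"
      by simp
    show ?thesis by (simp add: sum.distrib qf_def sw sum_distrib_left)
  qed
  finally show ?thesis using assms by (simp add: algebra_simps)
qed

definition actT :: "'g::finite \<Rightarrow> int \<Rightarrow> complex ^ 'g ^ 'g \<Rightarrow> complex ^ 'g ^ 'g" where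
  "actT i k Z = (\<chi> a b. Z $ a $ b + (if a = i \<and> b = i then of_int k else 0))"

text \<open>The matrix \<open>U Z U^T\<close> for the elementary matrix \<open>U\<close> that adds
  \<open>k\<close> times row \<open>j\<close> to row \<open>i\<close>.\<close>

definition actU :: "'g::finite \<Rightarrow> 'g \<Rightarrow> int \<Rightarrow> complex ^ 'g ^ 'g \<Rightarrow> complex ^ 'g ^ 'g" where
  "actU i j k Z = (\<chi> a b. Z $ a $ b + (if a = i then of_int k * Z $ j $ b else 0)
     + (if b = i then of_int k * Z $ a $ j else 0) + (if a = i \<and> b = i then of_int (k\<^sup>2) * Z $ j $ j else 0))"

text \<open>Inversion in one coordinate: the diagonal entry goes to its negative inverse, and the
  block away from \<open>i\<close> becomes a Schur complement.\<close>

definition actJ :: "'g::finite \<Rightarrow> complex ^ 'g ^ 'g \<Rightarrow> complex ^ 'g ^ 'g" where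
  "actJ i Z = (\<chi> a b. if a = i \<and> b = i then - 1 / Z $ i $ i else if a = i then Z $ i $ b / Z $ i $ i
     else if b = i then Z $ a $ i / Z $ i $ i else Z $ a $ b - Z $ a $ i * Z $ i $ b / Z $ i $ i)"

lemma sum_if_const: "(\<Sum>b\<in>A. if P then f b else 0) = (if P then \<Sum>b\<in>A. f b else 0)"
  by simp

lemma qf_actT: "qf x (actT i k Z) = qf x Z + of_int k * of_real ((x $ i)\<^sup>2)"
proof -
  have "qf x (actT i k Z) = (\<Sum>a\<in>UNIV. \<Sum>b\<in>UNIV. of_real (x $ a) * of_real (x $ b) * Z $ a $ b
     + (if a = i then if b = i then of_int k * of_real ((x $ i)\<^sup>2) else 0 else 0))"
    unfolding qf_def by (intro sum.cong refl) (auto simp: actT_def algebra_simps power2_eq_square)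
  then show ?thesis by (simp add: sum.distrib qf_def sum_if_const)
qed

lemma qf_actU:
  assumes "\<And>a b. Z $ a $ b = Z $ b $ a"
  shows "qf x (actU i j k Z) = qf (x + (of_int k * x $ i) *\<^sub>R axis j 1) Z"
proof -
  have "qf x (actU i j k Z) = (\<Sum>a\<in>UNIV. \<Sum>b\<in>UNIV. of_real (x $ a) * of_real (x $ b) * Z $ a $ b
     + (if a = i then of_int k * of_real (x $ i) * (of_real (x $ b) * Z $ j $ b) else 0)
     + (if b = i then of_int k * of_real (x $ i) * (of_real (x $ a) * Z $ a $ j) else 0)
     + (if a = i then if b = i then of_real ((of_int k * x $ i)\<^sup>2) * Z $ j $ j else 0 else 0))"
    unfolding qf_def by (intro sum.cong refl) (auto simp: actU_def algebra_simps power2_eq_square)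
  also have "\<dots> = qf x Z + of_int k * of_real (x $ i) * (\<Sum>b\<in>UNIV. of_real (x $ b) * Z $ j $ b)
     + of_int k * of_real (x $ i) * (\<Sum>a\<in>UNIV. of_real (x $ a) * Z $ a $ j) + of_real ((of_int k * x $ i)\<^sup>2) * Z $ j $ j"
    by (simp add: sum.distrib qf_def sum_if_const sum_distrib_left)
  finally show ?thesis unfolding qf_add_axis[of Z, OF assms] using assms by (simp add: algebra_simps)
qed

text \<open>Completing the square in coordinate \<open>i\<close>. The right-hand side has the
  quadratic exponent that Jacobi inversion produces in that summation variable.\<close>

lemma qf_actJ:
  assumes "\<And>a b. Z $ a $ b = Z $ b $ a" and x: "x $ i = 0" and \<tau>: "Z $ i $ i \<noteq> 0"
  shows "qf (x + c *\<^sub>R axis i 1) (actJ i Z) =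
     qf x Z - (of_real c - (\<Sum>b\<in>UNIV. of_real (x $ b) * Z $ i $ b))\<^sup>2 / Z $ i $ i"
proof -
  let ?w = "\<Sum>b\<in>UNIV. of_real (x $ b) * Z $ i $ b"
  have s: "actJ i Z $ a $ b = actJ i Z $ b $ a" for a b
    using assms by (simp add: actJ_def)
  have 1: "qf x (actJ i Z) = qf x Z - ?w\<^sup>2 / Z $ i $ i"
  proof -
    have "qf x (actJ i Z) = (\<Sum>a\<in>UNIV. \<Sum>b\<in>UNIV. of_real (x $ a) * of_real (x $ b) * Z $ a $ b -
        (of_real (x $ a) * Z $ i $ a) * (of_real (x $ b) * Z $ i $ b) / Z $ i $ i)"
      unfolding qf_def
    proof (intro sum.cong refl)
      fix a b
      show "of_real (x $ a) * of_real (x $ b) * actJ i Z $ a $ b = of_real (x $ a) * of_real (x $ b) * Z $ a $ b -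
        (of_real (x $ a) * Z $ i $ a) * (of_real (x $ b) * Z $ i $ b) / Z $ i $ i"
        using x assms(1)[of a i] by (cases "a = i"; cases "b = i") (simp_all add: actJ_def algebra_simps)
    qed
    then show ?thesis
      by (simp add: sum_subtractf qf_def power2_eq_square sum_product sum_divide_distrib)
  qed
  have 2: "(\<Sum>b\<in>UNIV. of_real (x $ b) * actJ i Z $ i $ b) = ?w / Z $ i $ i"
    unfolding sum_divide_distrib by (intro sum.cong refl) (use x in \<open>auto simp: actJ_def\<close>)
  show ?thesis unfolding qf_add_axis[of "actJ i Z", OF s] 1 2 using \<tau>
    by (simp add: actJ_def power2_diff field_simps)
qed

lemma siegel_space_diag:
  assumes "Z \<in> siegel_space" shows "Im (Z $ i $ i) > 0"
proof -
  have "qf (0 + 1 *\<^sub>R axis i 1) Z = Z $ i $ i"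
    by (subst qf_add_axis) (use siegel_space_sym[OF assms] in \<open>auto simp: qf_def\<close>)
  moreover have "0 < Im (qf (axis i 1) Z)" using assms by (simp add: siegel_space_iff axis_eq_0_iff)
  ultimately show ?thesis by simp
qed

lemma siegel_space_diag_nonzero: "Z \<in> siegel_space \<Longrightarrow> Z $ i $ i \<noteq> 0"
  using siegel_space_diag[of Z i] by auto

lemma actT_in_siegel_space: "Z \<in> siegel_space \<Longrightarrow> actT i k Z \<in> siegel_space"
proof -
  have "Im (of_int k * of_real y) = 0" for y by simp
  then show "Z \<in> siegel_space \<Longrightarrow> actT i k Z \<in> siegel_space"
    unfolding siegel_space_iff qf_actT plus_complex.sel by (auto simp: actT_def)
qed

lemma actU_in_siegel_space:
  assumes Z: "Z \<in> siegel_space" and ij: "i \<noteq> j"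
  shows "actU i j k Z \<in> siegel_space"
  unfolding siegel_space_iff
proof (intro conjI allI impI)
  show "actU i j k Z $ a $ b = actU i j k Z $ b $ a" for a b
    using siegel_space_sym[OF Z] by (auto simp: actU_def)
  fix x :: "real ^ 'a" assume x: "x \<noteq> 0"
  have "x + (of_int k * x $ i) *\<^sub>R axis j 1 \<noteq> 0"
  proof
    assume *: "x + (of_int k * x $ i) *\<^sub>R axis j 1 = 0"
    then have "x $ i = 0" using ij by (auto simp: vec_eq_iff axis_def dest: spec[of _ i])
    then show False using * x by simp
  qed
  then show "Im (qf x (actU i j k Z)) > 0"
    using Z siegel_space_sym[OF Z] by (subst qf_actU) (auto simp: siegel_space_iff)
qed

text \<open>With \<open>u = (c - w) / \<tau>\<close> the form of \<open>actJ i Z\<close> at \<open>x\<close> is the Hermitian form of \<open>Z\<close> at the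
  complex vector obtained from \<open>x\<close> by putting \<open>u\<close> in position \<open>i\<close>; it is evaluated at the real and
  imaginary parts of that vector.\<close>

lemma actJ_in_siegel_space:
  assumes Z: "Z \<in> siegel_space"
  shows "actJ i Z \<in> siegel_space"
  unfolding siegel_space_iff
proof (intro conjI allI impI)
  note sym = siegel_space_sym[OF Z]
  show "actJ i Z $ a $ b = actJ i Z $ b $ a" for a b
    using sym by (simp add: actJ_def)
  fix x :: "real ^ 'a" assume x: "x \<noteq> 0"
  define \<tau> where "\<tau> = Z $ i $ i"
  define c where "c = x $ i"
  define y where "y = x - c *\<^sub>R axis i 1"
  define w where "w = (\<Sum>b\<in>UNIV. of_real (y $ b) * Z $ i $ b)"
  define u where "u = (of_real c - w) / \<tau>"
  have \<tau>: "\<tau> \<noteq> 0" using siegel_space_diag_nonzero[OF Z] by (simp add: \<tau>_def)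
  have y: "y $ i = 0" by (simp add: y_def c_def axis_def)
  have xy: "x = y + c *\<^sub>R axis i 1" by (simp add: y_def)
  have w: "w = of_real c - u * \<tau>" using \<tau> by (simp add: u_def)
  have "qf x (actJ i Z) = qf y Z - u\<^sup>2 * \<tau>"
  proof -
    have "u\<^sup>2 * \<tau> = (of_real c - w)\<^sup>2 / \<tau>" using \<tau> by (simp add: u_def power2_eq_square)
    then show ?thesis
      unfolding xy w_def \<tau>_def using qf_actJ[OF sym y, of c] \<tau> by (simp add: \<tau>_def)
  qed
  then have 1: "Im (qf x (actJ i Z)) = Im (qf y Z) - Im (u\<^sup>2 * \<tau>)" by simp
  let ?p = "y + Re u *\<^sub>R axis i 1" and ?q = "0 + Im u *\<^sub>R axis i (1::real)"
  have 2: "Im (qf ?p Z) = Im (qf y Z) + 2 * Re u * Im w + (Re u)\<^sup>2 * Im \<tau>"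
  proof -
    have "qf ?p Z = qf y Z + 2 * of_real (Re u) * w + of_real ((Re u)\<^sup>2) * \<tau>"
      unfolding w_def \<tau>_def by (rule qf_add_axis[OF sym])
    then show ?thesis by simp
  qed
  have 3: "Im (qf ?q Z) = (Im u)\<^sup>2 * Im \<tau>"
    by (subst qf_add_axis) (use sym in \<open>simp_all add: qf_def flip: \<tau>_def\<close>)
  have eq: "Im (qf x (actJ i Z)) = Im (qf ?p Z) + Im (qf ?q Z)"
    unfolding 1 2 3 w by (simp add: power2_eq_square algebra_simps)
  have pos: "Im (qf z Z) \<ge> 0" "z \<noteq> 0 \<Longrightarrow> Im (qf z Z) > 0" for z
    using Z by (cases "z = 0"; auto simp: siegel_space_iff qf_def less_imp_le)+
  have "?p \<noteq> 0 \<or> ?q \<noteq> 0"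
  proof (rule ccontr)
    assume *: "\<not> (?p \<noteq> 0 \<or> ?q \<noteq> 0)"
    then have "Im u = 0" by (simp add: axis_eq_0_iff)
    moreover have "Re u = 0" using * y by (auto simp: vec_eq_iff axis_def dest: spec[of _ i])
    ultimately have "u = 0" by (simp add: complex_eq_iff)
    then have "y = 0" using * by simp
    then have "w = 0" by (simp add: w_def)
    then have "c = 0" using w \<open>u = 0\<close> by simp
    then show False using x xy \<open>y = 0\<close> by simp
  qed
  then show "0 < Im (qf x (actJ i Z))"
    unfolding eq using pos[of ?p] pos[of ?q] by fastforce
qed

text \<open>With \<open>m = n $ i\<close>, the phase \<open>k * m^2 / 2\<close> agrees with
  \<open>k * m / 2\<close> modulo integers. The quadratic change of the form thus becomes a linear
  one, and this is the origin of the half-integral shift.\<close>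

lemma phi_actT:
  "phi v (actT i k Z) = e2pi (of_real (- of_int k * v $ Inl i / 4)) *
     phi (chT i k v + (of_int k / 2) *\<^sub>R axis (Inr i) 1) Z"
proof -
  define r s where "r = lo v" and "s = hi v"
  define s' where "s' = s + (of_int k * r $ i + of_int k / 2) *\<^sub>R axis i 1"
  \<comment> \<open>What remains when the linear phase in \<open>m\<close> is rewritten in terms of
    \<open>m + r $ i\<close>, the coordinate occurring in the series.\<close>
  define C where "C = - (of_int k * r $ i / 2 + of_int k * (r $ i)\<^sup>2 / 2)"
  have l: "lo (chT i k v + (of_int k / 2) *\<^sub>R axis (Inr i) 1) = r"
    by (simp add: vec_eq_iff chT_def axis_def r_def)
  have h: "hi (chT i k v + (of_int k / 2) *\<^sub>R axis (Inr i) 1) = s'"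
    by (auto simp: vec_eq_iff chT_def axis_def r_def s_def s'_def)
  have t: "theta_term r s (actT i k Z) n = e2pi (of_real C) * theta_term r s' Z n" for n
  proof -
    let ?x = "ivec n + r" and ?m = "n $ i"
    have xi': "ivec n $ i = of_int ?m" by (simp add: ivec_def)
    have "even (?m * (?m - 1))" by simp
    then obtain l where l: "?m * (?m - 1) = 2 * l" by (elim evenE)
    then have l': "real_of_int ?m * (real_of_int ?m - 1) = 2 * of_int l"
      by (metis of_int_1 of_int_diff of_int_mult of_int_numeral)
    have "(of_int k * (?x $ i)\<^sup>2 / 2 + ?x \<bullet> s) - (C + ?x \<bullet> s') = of_int k * (real_of_int ?m * (real_of_int ?m - 1)) / 2"
      by (simp add: s'_def inner_add_right inner_axis' inner_commute[of "axis _ _"] inner_axis xi' C_def power2_eq_square field_simps)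
    also have "\<dots> = of_int (k * l)" unfolding l' by simp
    finally have *: "e2pi (of_real (of_int k * (?x $ i)\<^sup>2 / 2 + ?x \<bullet> s)) = e2pi (of_real (C + ?x \<bullet> s'))"
      by (intro e2pi_cong_Ints) (simp only: Ints_of_int)
    have "theta_term r s (actT i k Z) n = e2pi (qf ?x Z / 2) * e2pi (of_real (of_int k * (?x $ i)\<^sup>2 / 2 + ?x \<bullet> s))"
      by (simp add: theta_term_def qf_actT add_divide_distrib add.assoc flip: e2pi_add)
    then show ?thesis unfolding * by (simp add: theta_term_def add_ac flip: e2pi_add)
  qed
  have th: "theta r s (actT i k Z) = e2pi (of_real C) * theta r s' Z"
    unfolding theta_altdef t by (rule infsum_cmult_right')
  have rs': "r \<bullet> s' = r \<bullet> s + (of_int k * r $ i + of_int k / 2) * r $ i"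
    by (simp add: s'_def inner_add_right inner_axis)
  have "- (r \<bullet> s) / 2 + C = - of_int k * r $ i / 4 + (- (r \<bullet> s') / 2)"
    unfolding rs' C_def by (simp add: field_simps power2_eq_square)
  then have "e2pi (of_real (- (r \<bullet> s) / 2 + C)) = e2pi (of_real (- of_int k * r $ i / 4 + (- (r \<bullet> s') / 2)))" by simp
  then have ex: "e2pi (- of_real (r \<bullet> s) / 2) * e2pi (of_real C) = e2pi (of_real (- of_int k * r $ i / 4)) * e2pi (- of_real (r \<bullet> s') / 2)"
    by (simp flip: e2pi_add)
  show ?thesis
    unfolding phi_def l h th unfolding r_def[symmetric] s_def[symmetric] th mult.assoc[symmetric] ex by (simp add: r_def)
qed

text \<open>A unimodular substitution permutes the lattice of summation, and the contragredient
  change of the second half of the characteristic preserves all inner products; no phase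
  arises.\<close>

lemma phi_actU:
  assumes Z: "Z \<in> siegel_space" and ij: "i \<noteq> j"
  shows "phi v (actU i j k Z) = phi (chU i j k v) Z"
proof -
  define r s where "r = lo v" and "s = hi v"
  define r' s' where "r' = r + (of_int k * r $ i) *\<^sub>R axis j 1" and "s' = s - (of_int k * s $ j) *\<^sub>R axis i 1"
  have l: "lo (chU i j k v) = r'" and h: "hi (chU i j k v) = s'"
    by (auto simp: vec_eq_iff chU_def axis_def r_def s_def r'_def s'_def)
  have inn: "(x + (of_int k * x $ i) *\<^sub>R axis j 1) \<bullet> s' = x \<bullet> s" for x
  proof -
    have "axis j (1::real) \<bullet> axis i 1 = 0" using ij by (simp add: inner_axis_axis)
    moreover have "x \<bullet> axis i 1 = x $ i" "axis j 1 \<bullet> s = s $ j" by (simp_all add: inner_axis inner_axis')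
    ultimately show ?thesis by (simp add: s'_def inner_diff_right inner_add_left)
  qed
  define g where "g n = n + (k * n $ i) *s axis j 1" for n :: "int ^ 'a"
  have bij: "bij_betw g UNIV UNIV"
    by (rule bij_betwI[where g = "\<lambda>n. n - (k * n $ i) *s axis j 1"])
       (use ij in \<open>auto simp: g_def vec_eq_iff axis_def\<close>)
  have g: "ivec (g n) = ivec n + (of_int k * ivec n $ i) *\<^sub>R axis j 1" for n
    by (simp add: g_def ivec_def vec_eq_iff axis_def)
  have t: "theta_term r s (actU i j k Z) n = theta_term r' s' Z (g n)" for n
  proof -
    have "ivec (g n) + r' = (ivec n + r) + (of_int k * (ivec n + r) $ i) *\<^sub>R axis j 1"
      unfolding g r'_def by (simp add: algebra_simps)
    then show ?thesis
      using inn[of "ivec n + r"] by (simp add: theta_term_def qf_actU[of Z, OF siegel_space_sym[OF Z]])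
  qed
  have th: "theta r s (actU i j k Z) = theta r' s' Z"
    unfolding theta_altdef t by (rule infsum_reindex_bij_betw[OF bij])
  show ?thesis
    unfolding phi_def l h using inn[of r] th by (simp add: r'_def r_def s_def)
qed

text \<open>Absolute convergence lets the sum over coordinate \<open>i\<close> be carried out
  innermost. It is a one-dimensional theta series, and the inversion formula turns it into the inner
  sum belonging to \<open>actJ i Z\<close>.\<close>

lemma phi_actJ:
  assumes Z: "Z \<in> siegel_space"
  shows "phi v (actJ i Z) = rtfac (Z $ i $ i) * phi (chJ i v) Z"
proof -
  define \<tau> where "\<tau> = Z $ i $ i"
  have \<tau>: "Im \<tau> > 0" "\<tau> \<noteq> 0" using siegel_space_diag[OF Z] siegel_space_diag_nonzero[OF Z] by (auto simp: \<tau>_def)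
  define r s where "r = lo (chJ i v)" and "s = hi (chJ i v)"
  define r' s' where "r' = lo v" and "s' = hi v"
  have ri: "r $ i = s' $ i" "r' $ i = - s $ i" and rn: "\<And>a. a \<noteq> i \<Longrightarrow> r' $ a = r $ a" "\<And>a. a \<noteq> i \<Longrightarrow> s' $ a = s $ a"
    by (auto simp: r_def s_def r'_def s'_def chJ_def)
  define S0 where "S0 = {n :: int ^ 'a. n $ i = 0}"
  \<comment> \<open>Inserts the inner variable \<open>m\<close> at position \<open>i\<close> of a
    lattice vector whose entry there is 0.\<close>
  define up where "up = (\<lambda>(n :: int ^ 'a, m :: int). (\<chi> a. if a = i then m else n $ a))"
  have bij: "bij_betw up (S0 \<times> UNIV) UNIV"
    by (rule bij_betwI[where g = "\<lambda>n. (\<chi> a. if a = i then 0 else n $ a, n $ i)"])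
       (auto simp: up_def S0_def vec_eq_iff)
  have split: "theta q p W = (\<Sum>\<^sub>\<infinity>n\<in>S0. \<Sum>\<^sub>\<infinity>m. theta_term q p W (up (n, m)))" if W: "W \<in> siegel_space" for q p W
  proof -
    have "(\<lambda>x. theta_term q p W (up x)) summable_on S0 \<times> UNIV"
      by (subst summable_on_reindex_bij_betw[OF bij]) (rule theta_term_summable[OF W])
    then have "(\<Sum>\<^sub>\<infinity>n\<in>S0. \<Sum>\<^sub>\<infinity>m. theta_term q p W (up (n, m))) = (\<Sum>\<^sub>\<infinity>x\<in>S0 \<times> UNIV. theta_term q p W (up x))"
      by (rule infsum_Sigma_banach)
    also have "\<dots> = theta q p W"
      unfolding theta_altdef by (rule infsum_reindex_bij_betw[OF bij])
    finally show ?thesis by simp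
  qed
  define y where "y n = (\<chi> a. if a = i then 0 else (ivec n + r) $ a)" for n
  define w where "w n = (\<Sum>b\<in>UNIV. of_real (y n $ b) * Z $ i $ b)" for n
  have yi: "y n $ i = 0" for n by (simp add: y_def)
  have x1: "ivec (up (n, m)) + r = y n + (of_int m + r $ i) *\<^sub>R axis i 1" for n m
    by (simp add: vec_eq_iff up_def y_def ivec_def axis_def)
  have x2: "ivec (up (n, m)) + r' = y n + (of_int m - s $ i) *\<^sub>R axis i 1" for n m
    using ri rn by (simp add: vec_eq_iff up_def y_def ivec_def axis_def)
  have ys: "y n \<bullet> s' = y n \<bullet> s" for n
    unfolding inner_vec_def by (intro sum.cong refl) (use rn in \<open>auto simp: y_def\<close>)
  have inner: "rtfac \<tau> * (\<Sum>\<^sub>\<infinity>m. theta_term r s Z (up (n, m))) =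
      e2pi (of_real (r $ i * s $ i)) * (\<Sum>\<^sub>\<infinity>m. theta_term r' s' (actJ i Z) (up (n, m)))" for n
  proof -
    let ?E = "e2pi (qf (y n) Z / 2 + of_real (y n \<bullet> s))"
    \<comment> \<open>The argument of the inner series is complex, since the off-diagonal entries of
      \<open>Z\<close> couple coordinate \<open>i\<close> to the others through
      \<open>w n\<close>.\<close>
    let ?z = "of_real (s $ i) + w n"
    have q1: "qf (y n + c *\<^sub>R axis i 1) Z = qf (y n) Z + 2 * of_real c * w n + of_real (c\<^sup>2) * \<tau>" for c
      unfolding w_def \<tau>_def by (rule qf_add_axis[OF siegel_space_sym[OF Z]])
    have q2: "qf (y n + c *\<^sub>R axis i 1) (actJ i Z) = qf (y n) Z - (of_real c - w n)\<^sup>2 / \<tau>" for c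
      unfolding w_def \<tau>_def by (rule qf_actJ[OF siegel_space_sym[OF Z] yi siegel_space_diag_nonzero[OF Z]])
    have ip: "(y n + c *\<^sub>R axis i 1) \<bullet> q = y n \<bullet> q + c * q $ i" for c q
      by (simp add: inner_add_left inner_axis')
    have t1: "theta_term r s Z (up (n, m)) = ?E * e2pi (\<tau> * (of_int m + of_real (r $ i))\<^sup>2 / 2 + (of_int m + of_real (r $ i)) * ?z)" for m
      unfolding theta_term_def x1 q1 ip e2pi_add[symmetric]
      by (rule arg_cong[where f=e2pi]) (simp add: field_simps)
    have t2: "theta_term r' s' (actJ i Z) (up (n, m)) = ?E * e2pi (- of_real (r $ i * s $ i)) *
        e2pi (- (of_int m - ?z)\<^sup>2 / (2 * \<tau>) + of_int m * of_real (r $ i))" for m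
      unfolding theta_term_def x2 q2 ip ys ri(1)[symmetric] e2pi_add[symmetric]
      using \<tau>(2) by (intro arg_cong[where f=e2pi]) (simp add: field_simps)
    have "rtfac \<tau> * (\<Sum>\<^sub>\<infinity>m. theta_term r s Z (up (n, m))) = ?E * (rtfac \<tau> *
       (\<Sum>\<^sub>\<infinity>m. e2pi (\<tau> * (of_int m + of_real (r $ i))\<^sup>2 / 2 + (of_int m + of_real (r $ i)) * ?z)))"
      unfolding t1 infsum_cmult_right' by simp
    also have "\<dots> = ?E * (\<Sum>\<^sub>\<infinity>m::int. e2pi (- (of_int m - ?z)\<^sup>2 / (2 * \<tau>) + of_int m * of_real (r $ i)))"
      unfolding jacobi_inversion[OF \<tau>(1)] ..
    also have "\<dots> = e2pi (of_real (r $ i * s $ i)) * (\<Sum>\<^sub>\<infinity>m. theta_term r' s' (actJ i Z) (up (n, m)))"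
      unfolding t2 infsum_cmult_right' by (simp add: e2pi_minus)
    finally show ?thesis .
  qed
  have "rtfac \<tau> * theta r s Z = (\<Sum>\<^sub>\<infinity>n\<in>S0. rtfac \<tau> * (\<Sum>\<^sub>\<infinity>m. theta_term r s Z (up (n, m))))"
    unfolding split[OF Z] by (rule infsum_cmult_right'[symmetric])
  also have "\<dots> = e2pi (of_real (r $ i * s $ i)) * theta r' s' (actJ i Z)"
    unfolding inner split[OF actJ_in_siegel_space[OF Z]] by (rule infsum_cmult_right')
  finally have th: "rtfac \<tau> * theta r s Z = e2pi (of_real (r $ i * s $ i)) * theta r' s' (actJ i Z)" .
  have "r' \<bullet> s' = r \<bullet> s - 2 * (r $ i * s $ i)"
  proof -
    have "r' \<bullet> s' - r \<bullet> s = (\<Sum>a\<in>UNIV. if a = i then - 2 * (r $ i * s $ i) else 0)"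
      unfolding inner_vec_def sum_subtractf[symmetric] by (intro sum.cong refl) (use ri rn in auto)
    then show ?thesis by simp
  qed
  then have "- (r' \<bullet> s') / 2 = - (r \<bullet> s) / 2 + r $ i * s $ i" by simp
  then have "e2pi (of_real (- (r' \<bullet> s') / 2)) = e2pi (of_real (- (r \<bullet> s) / 2 + r $ i * s $ i))" by simp
  then have "e2pi (- of_real (r' \<bullet> s') / 2) = e2pi (- of_real (r \<bullet> s) / 2) * e2pi (of_real (r $ i * s $ i))"
    by (simp flip: e2pi_add)
  then show ?thesis
    unfolding phi_def r_def[symmetric] s_def[symmetric] r'_def[symmetric] s'_def[symmetric] \<tau>_def[symmetric]
    using th by (simp add: mult_ac)
qed


section \<open>Products of theta constants under the symplectic group\<close>

definition act_num :: "int ^ ('g::finite + 'g) ^ ('g + 'g) \<Rightarrow> complex ^ 'g ^ 'g \<Rightarrow> complex ^ 'g ^ 'g" where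
  "act_num \<gamma> Z = blockA \<gamma> ** Z + blockB \<gamma>"

definition act_den :: "int ^ ('g::finite + 'g) ^ ('g + 'g) \<Rightarrow> complex ^ 'g ^ 'g \<Rightarrow> complex ^ 'g ^ 'g" where
  "act_den \<gamma> Z = blockC \<gamma> ** Z + blockD \<gamma>"

lemma act_num_nth: "act_num \<gamma> Z $ a $ b = (\<Sum>c\<in>UNIV. of_int (\<gamma> $ Inl a $ Inl c) * Z $ c $ b) + of_int (\<gamma> $ Inl a $ Inr b)"
  by (simp add: act_num_def blockA_def blockB_def matrix_matrix_mult_def)

lemma act_den_nth: "act_den \<gamma> Z $ a $ b = (\<Sum>c\<in>UNIV. of_int (\<gamma> $ Inr a $ Inl c) * Z $ c $ b) + of_int (\<gamma> $ Inr a $ Inr b)"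
  by (simp add: act_den_def blockC_def blockD_def matrix_matrix_mult_def)

lemma act_num_opT: "act_num (opT i k \<gamma>) Z $ a $ b = act_num \<gamma> Z $ a $ b + (if a = i then of_int k * act_den \<gamma> Z $ i $ b else 0)"
  by (cases "a = i") (simp_all add: act_num_nth act_den_nth algebra_simps sum.distrib sum_distrib_left)

lemma act_den_opT: "act_den (opT i k \<gamma>) Z = act_den \<gamma> Z"
  by (simp add: vec_eq_iff act_den_nth)

lemma act_num_opJ: "act_num (opJ i \<gamma>) Z $ a $ b = (if a = i then - act_den \<gamma> Z $ i $ b else act_num \<gamma> Z $ a $ b)"
  by (cases "a = i") (simp_all add: act_num_nth act_den_nth sum_negf)

lemma act_den_opJ: "act_den (opJ i \<gamma>) Z $ a $ b = (if a = i then act_num \<gamma> Z $ i $ b else act_den \<gamma> Z $ a $ b)"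
  by (cases "a = i") (simp_all add: act_num_nth act_den_nth)

lemma act_num_opU: "act_num (opU i j k \<gamma>) Z $ a $ b = act_num \<gamma> Z $ a $ b + (if a = i then of_int k * act_num \<gamma> Z $ j $ b else 0)"
  by (cases "a = i") (simp_all add: act_num_nth algebra_simps sum.distrib sum_distrib_left)

lemma act_den_opU: "act_den (opU i j k \<gamma>) Z $ a $ b = act_den \<gamma> Z $ a $ b - (if a = j then of_int k * act_den \<gamma> Z $ i $ b else 0)"
  by (cases "a = j") (simp_all add: act_den_nth algebra_simps sum_subtractf sum_distrib_left)

lemma aut_factor_den: "aut_factor \<gamma> Z = det (act_den \<gamma> Z)"
  by (simp add: aut_factor_def act_den_def)

lemma matrix_inv_right: "invertible A \<Longrightarrow> A ** matrix_inv A = mat 1"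
  and matrix_inv_left: "invertible A \<Longrightarrow> matrix_inv A ** A = mat 1"
  unfolding invertible_def matrix_inv_def by (metis (mono_tags, lifting) someI_ex)+

lemma invertible_mat_1: "invertible (mat 1 :: 'a::semiring_1 ^ 'n ^ 'n)"
  unfolding invertible_def by (rule exI[of _ "mat 1"]) simp

text \<open>Identifies the action by clearing the denominator, so that the generators can be
  compared entry by entry without computing an inverse.\<close>

lemma sp_act_eqI:
  assumes "invertible (act_den \<gamma> Z)" "act_num \<gamma> Z = W ** act_den \<gamma> Z"
  shows "sp_act \<gamma> Z = W"
proof -
  have "sp_act \<gamma> Z = (W ** act_den \<gamma> Z) ** matrix_inv (act_den \<gamma> Z)"
    unfolding assms(2)[symmetric] by (simp add: sp_act_def act_num_def act_den_def)
  also have "\<dots> = W ** (act_den \<gamma> Z ** matrix_inv (act_den \<gamma> Z))" by (simp add: matrix_mul_assoc)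
  finally show ?thesis using assms(1) by (simp add: matrix_inv_right)
qed

lemma act_num_eq_sp_act:
  assumes "invertible (act_den \<gamma> Z)"
  shows "act_num \<gamma> Z = sp_act \<gamma> Z ** act_den \<gamma> Z"
proof -
  have "sp_act \<gamma> Z ** act_den \<gamma> Z = act_num \<gamma> Z ** (matrix_inv (act_den \<gamma> Z) ** act_den \<gamma> Z)"
    by (simp add: sp_act_def act_num_def act_den_def matrix_mul_assoc)
  then show ?thesis using assms by (simp add: matrix_inv_left)
qed

lemma det_replace_row:
  fixes x :: "complex ^ 'n"
  shows "det (\<chi> a. if a = i then x else axis a 1) = x $ i"
proof -
  have 1: "(\<Sum>a\<in>UNIV. x $ a *s row a (mat 1)) = x"
    by (simp add: vec_eq_iff row_def mat_def mult_delta_right)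
  have 2: "row a (mat 1) = axis a (1::complex)" for a :: 'n
    by (simp add: vec_eq_iff row_def mat_def axis_def eq_commute)
  show ?thesis using cramer_lemma_transpose[of i x "mat 1"] unfolding 1 unfolding 2 by simp
qed

lemma matrix_mult_nth: "(A ** B) $ a $ b = (\<Sum>c\<in>UNIV. A $ a $ c * B $ c $ b)"
  by (simp add: matrix_matrix_mult_def)

lemma act_opT:
  assumes "invertible (act_den \<gamma> Z)"
  shows "invertible (act_den (opT i k \<gamma>) Z)" "sp_act (opT i k \<gamma>) Z = actT i k (sp_act \<gamma> Z)"
    "aut_factor (opT i k \<gamma>) Z = aut_factor \<gamma> Z"
proof -
  show 1: "invertible (act_den (opT i k \<gamma>) Z)" using assms by (simp add: act_den_opT)
  show "aut_factor (opT i k \<gamma>) Z = aut_factor \<gamma> Z" by (simp add: aut_factor_den act_den_opT)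
  show "sp_act (opT i k \<gamma>) Z = actT i k (sp_act \<gamma> Z)"
  proof (rule sp_act_eqI[OF 1])
    have "act_num (opT i k \<gamma>) Z $ a $ b = (actT i k (sp_act \<gamma> Z) ** act_den \<gamma> Z) $ a $ b" for a b
    proof -
      have "(actT i k (sp_act \<gamma> Z) ** act_den \<gamma> Z) $ a $ b = (sp_act \<gamma> Z ** act_den \<gamma> Z) $ a $ b + (if a = i then of_int k * act_den \<gamma> Z $ i $ b else 0)"
        by (cases "a = i") (simp_all add: matrix_mult_nth actT_def distrib_right sum.distrib mult_delta_left)
      then show ?thesis using act_num_eq_sp_act[OF assms] by (simp add: act_num_opT)
    qed
    then show "act_num (opT i k \<gamma>) Z = actT i k (sp_act \<gamma> Z) ** act_den (opT i k \<gamma>) Z"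
      by (simp add: vec_eq_iff act_den_opT)
  qed
qed

lemma act_opU:
  assumes "invertible (act_den \<gamma> Z)" and ij: "i \<noteq> j"
  shows "invertible (act_den (opU i j k \<gamma>) Z)" "sp_act (opU i j k \<gamma>) Z = actU i j k (sp_act \<gamma> Z)"
    "aut_factor (opU i j k \<gamma>) Z = aut_factor \<gamma> Z"
proof -
  define W where "W = sp_act \<gamma> Z"
  define R :: "complex ^ 'a ^ 'a" where "R = (\<chi> a. if a = j then axis j 1 - of_int k *s axis i 1 else axis a 1)"
  have R: "R $ a $ b = (if a = b then 1 else 0) - (if a = j then if b = i then of_int k else 0 else 0)" for a b
    by (auto simp: R_def axis_def)
  have dR: "det R = 1" using ij det_replace_row[of j "axis j 1 - of_int k *s axis i 1"]
    by (simp add: R_def axis_def)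
  have d: "act_den (opU i j k \<gamma>) Z = R ** act_den \<gamma> Z"
    by (simp add: vec_eq_iff act_den_opU matrix_mult_nth R left_diff_distrib sum_subtractf mult_delta_left sum_if_const if_distrib[of "\<lambda>x. x * _"] cong: if_cong)
  show af: "aut_factor (opU i j k \<gamma>) Z = aut_factor \<gamma> Z" by (simp add: aut_factor_den d det_mul dR)
  then show 1: "invertible (act_den (opU i j k \<gamma>) Z)" using assms(1) by (simp add: invertible_det_nz aut_factor_den)
  show "sp_act (opU i j k \<gamma>) Z = actU i j k W"
  proof (rule sp_act_eqI[OF 1])
    have e: "(actU i j k W ** R) $ a $ b = W $ a $ b + (if a = i then of_int k * W $ j $ b else 0)" for a b
    proof -
      have X: "(actU i j k W ** R) $ a $ b = actU i j k W $ a $ b - (if b = i then actU i j k W $ a $ j * of_int k else 0)"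
        by (cases "b = i") (simp_all add: matrix_mult_nth R right_diff_distrib sum_subtractf mult_delta_right)
      show ?thesis unfolding X using ij by (auto simp: actU_def algebra_simps power2_eq_square)
    qed
    have "act_num (opU i j k \<gamma>) Z $ a $ b = ((actU i j k W ** R) ** act_den \<gamma> Z) $ a $ b" for a b
    proof -
      have "((actU i j k W ** R) ** act_den \<gamma> Z) $ a $ b = (W ** act_den \<gamma> Z) $ a $ b + (if a = i then of_int k * (W ** act_den \<gamma> Z) $ j $ b else 0)"
        by (cases "a = i") (simp_all add: matrix_mult_nth[of _ "act_den \<gamma> Z"] e distrib_right sum.distrib sum_distrib_left mult.assoc)
      then show ?thesis using act_num_eq_sp_act[OF assms(1)] by (simp add: act_num_opU W_def)
    qed
    then show "act_num (opU i j k \<gamma>) Z = actU i j k W ** act_den (opU i j k \<gamma>) Z"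
      by (simp add: vec_eq_iff d matrix_mul_assoc)
  qed
qed

lemma act_opJ:
  assumes "invertible (act_den \<gamma> Z)" and W: "sp_act \<gamma> Z \<in> siegel_space"
  shows "invertible (act_den (opJ i \<gamma>) Z)" "sp_act (opJ i \<gamma>) Z = actJ i (sp_act \<gamma> Z)"
    "aut_factor (opJ i \<gamma>) Z = sp_act \<gamma> Z $ i $ i * aut_factor \<gamma> Z"
proof -
  define W where "W = sp_act \<gamma> Z"
  \<comment> \<open>New denominator = \<open>R\<close> times old denominator: exchanging the rows of
    plane \<open>i\<close> puts row \<open>i\<close> of the numerator
    \<open>W ** act_den \<gamma> Z\<close> there. The determinant of \<open>R\<close> is
    \<open>W $ i $ i\<close>, which is how a diagonal entry becomes the factor of
    automorphy.\<close>
  define R :: "complex ^ 'a ^ 'a" where "R = (\<chi> a. if a = i then W $ i else axis a 1)"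
  have R: "R $ a $ b = (if a = i then W $ i $ b else if a = b then 1 else 0)" for a b
    by (auto simp: R_def axis_def)
  have dR: "det R = W $ i $ i" unfolding R_def by (rule det_replace_row)
  have n: "act_num \<gamma> Z = W ** act_den \<gamma> Z" unfolding W_def by (rule act_num_eq_sp_act[OF assms(1)])
  have d: "act_den (opJ i \<gamma>) Z = R ** act_den \<gamma> Z"
  proof -
    have "act_den (opJ i \<gamma>) Z $ a $ b = (R ** act_den \<gamma> Z) $ a $ b" for a b
      by (cases "a = i") (simp_all add: act_den_opJ n matrix_mult_nth R mult_delta_left)
    then show ?thesis by (simp add: vec_eq_iff)
  qed
  have nz: "W $ i $ i \<noteq> 0" using siegel_space_diag_nonzero[OF W] by (simp add: W_def)
  show af: "aut_factor (opJ i \<gamma>) Z = sp_act \<gamma> Z $ i $ i * aut_factor \<gamma> Z"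
    by (simp add: aut_factor_den d det_mul dR W_def)
  then show 1: "invertible (act_den (opJ i \<gamma>) Z)" using assms(1) nz by (simp add: invertible_det_nz aut_factor_den W_def)
  show "sp_act (opJ i \<gamma>) Z = actJ i W"
  proof (rule sp_act_eqI[OF 1])
    have e: "(actJ i W ** R) $ a $ b = (if a = i then if b = i then - 1 else 0 else W $ a $ b)" for a b
    proof -
      have "(actJ i W ** R) $ a $ b = (\<Sum>c\<in>UNIV. (if c = i then actJ i W $ a $ i * W $ i $ b else 0) + (if c = b then if b = i then 0 else actJ i W $ a $ b else 0))"
        unfolding matrix_mult_nth by (intro sum.cong refl) (auto simp: R)
      also have "\<dots> = actJ i W $ a $ i * W $ i $ b + (if b = i then 0 else actJ i W $ a $ b)"
        by (simp add: sum.distrib)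
      finally show ?thesis using nz by (auto simp: actJ_def)
    qed
    have "act_num (opJ i \<gamma>) Z $ a $ b = ((actJ i W ** R) ** act_den \<gamma> Z) $ a $ b" for a b
      by (cases "a = i") (simp_all add: matrix_mult_nth[of _ "act_den \<gamma> Z"] e act_num_opJ n mult_delta_left)
    then show "act_num (opJ i \<gamma>) Z = actJ i W ** act_den (opJ i \<gamma>) Z"
      by (simp add: vec_eq_iff d matrix_mul_assoc)
  qed
qed

lemma act_one: "act_den (mat 1) Z = mat 1" "sp_act (mat 1) Z = Z" "aut_factor (mat 1) Z = 1"
proof -
  show d: "act_den (mat 1) Z = mat 1"
    by (simp add: vec_eq_iff act_den_nth mat_def if_distrib[of complex_of_int] if_distrib[of "\<lambda>x. x * _"] cong: if_cong)
  have "act_num (mat 1) Z = Z"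
    by (simp add: vec_eq_iff act_num_nth mat_def if_distrib[of complex_of_int] mult_delta_left cong: if_cong)
  then show "sp_act (mat 1) Z = Z" using d by (intro sp_act_eqI) (simp_all add: invertible_mat_1)
  show "aut_factor (mat 1) Z = 1" by (simp add: aut_factor_den d)
qed

text \<open>Invertibility and membership are carried together: an inversion keeps the denominator
  invertible only because the current point lies in the half-space and so has nonzero
  diagonal.\<close>

lemma spgen_act:
  assumes "\<gamma> \<in> spgen" "Z \<in> siegel_space"
  shows "invertible (act_den \<gamma> Z) \<and> sp_act \<gamma> Z \<in> siegel_space"
  using assms
proof (induction rule: spgen.induct)
  case one then show ?case by (simp add: act_one invertible_mat_1)
next
  case (T \<gamma> i k) then show ?case by (simp add: act_opT actT_in_siegel_space)
next
  case (J \<gamma> i) then show ?case by (simp add: act_opJ actJ_in_siegel_space)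
next
  case (U \<gamma> i j k) then show ?case by (simp add: act_opU actU_in_siegel_space)
qed

lemma Sp_int_act:
  assumes "\<gamma> \<in> Sp_int" "Z \<in> siegel_space"
  shows "sp_act \<gamma> Z \<in> siegel_space" "aut_factor \<gamma> Z \<noteq> 0"
  using spgen_act[of \<gamma> Z] assms Sp_int_subset_spgen by (auto simp: aut_factor_den invertible_det_nz)

section \<open>Dependence on the characteristic modulo integral vectors, and parity\<close>

definition integral_vec :: "real ^ 'n \<Rightarrow> bool" where
  "integral_vec v \<longleftrightarrow> (\<forall>p. v $ p \<in> \<int>)"

lemma integral_vec_add: "integral_vec v \<Longrightarrow> integral_vec w \<Longrightarrow> integral_vec (v + w)"
  and integral_vec_minus: "integral_vec v \<Longrightarrow> integral_vec (- v)"
  by (auto simp: integral_vec_def)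

lemma Ints_inner: "(\<And>i. x $ i * y $ i \<in> \<int>) \<Longrightarrow> x \<bullet> y \<in> \<int>" for x y :: "real ^ 'n"
  by (auto simp: inner_vec_def intro: Ints_sum)

lemma ivec_of_integral: "integral_vec v \<Longrightarrow> \<exists>m. v = ivec m"
  unfolding integral_vec_def
  by (rule exI[of _ "\<chi> i. \<lfloor>v $ i\<rfloor>"]) (simp add: ivec_def vec_eq_iff of_int_floor)

lemma theta_shift:
  "theta (r + ivec m) (s + ivec n) Z = e2pi (of_real (r \<bullet> ivec n)) * theta r s Z"
proof -
  have t: "theta_term (r + ivec m) (s + ivec n) Z k = e2pi (of_real (r \<bullet> ivec n)) * theta_term r s Z (k + m)" for k
  proof -
    have x: "ivec k + (r + ivec m) = ivec (k + m) + r" by (simp add: ivec_def vec_eq_iff)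
    have "(ivec (k + m) + r) \<bullet> (s + ivec n) - ((ivec (k + m) + r) \<bullet> s + r \<bullet> ivec n) = ivec (k + m) \<bullet> ivec n"
      by (simp add: inner_add_left inner_add_right)
    moreover have "ivec (k + m) \<bullet> ivec n \<in> \<int>" by (intro Ints_inner) (simp add: ivec_def)
    ultimately have "e2pi (of_real ((ivec (k + m) + r) \<bullet> (s + ivec n))) = e2pi (of_real ((ivec (k + m) + r) \<bullet> s + r \<bullet> ivec n))"
      by (intro e2pi_cong_Ints) simp
    then show ?thesis unfolding theta_term_def x e2pi_add by (simp add: e2pi_add)
  qed
  have bij: "bij_betw (\<lambda>k. k + m) UNIV UNIV" by (rule bij_betwI[where g = "\<lambda>k. k - m"]) auto
  show ?thesis
    unfolding theta_altdef t infsum_cmult_right' by (subst infsum_reindex_bij_betw[OF bij]) simp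
qed

definition torsion :: "real \<Rightarrow> (real ^ 'n) set" where
  "torsion c = {v. \<forall>p. c * v $ p \<in> \<int>}"

text \<open>An integral shift changes \<open>phi\<close> by \<open>e2pi E\<close>, and
  \<open>4 * N * E\<close> is an integer for a characteristic with denominators dividing
  \<open>2 * N\<close>. The factor 4 compensates the halves in the definition of \<open>phi\<close>
  and in the characteristics.\<close>

lemma phi_periodic:
  assumes v: "v \<in> torsion (2 * real N)" and m: "integral_vec m"
  shows "phi (v + m) Z ^ (4 * N) = phi v Z ^ (4 * N)"
proof -
  define r s where "r = lo v" and "s = hi v"
  have "integral_vec (lo m)" "integral_vec (hi m)" using m by (auto simp: integral_vec_def)
  then obtain a b where ab: "lo m = ivec a" "hi m = ivec b" using ivec_of_integral by metis
  have l: "lo (v + m) = r + ivec a" "hi (v + m) = s + ivec b"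
    by (simp_all add: r_def s_def ab[symmetric] vec_eq_iff)
  define E where "E = (r \<bullet> ivec b - ivec a \<bullet> s - ivec a \<bullet> ivec b) / 2"
  have "- ((r + ivec a) \<bullet> (s + ivec b)) / 2 + r \<bullet> ivec b = E + (- (r \<bullet> s) / 2)"
    unfolding E_def by (simp add: inner_add_left inner_add_right field_simps)
  then have "e2pi (of_real (- ((r + ivec a) \<bullet> (s + ivec b)) / 2)) * e2pi (of_real (r \<bullet> ivec b)) = e2pi (of_real E) * e2pi (of_real (- (r \<bullet> s) / 2))"
    by (simp only: e2pi_add[symmetric] of_real_add[symmetric])
  then have "phi (v + m) Z = e2pi (of_real E) * phi v Z"
    unfolding phi_def l theta_shift r_def[symmetric] s_def[symmetric] by (simp add: mult.assoc[symmetric])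
  moreover have "e2pi (of_real E) ^ (4 * N) = 1"
  proof -
    have "((2 * real N) *\<^sub>R r) \<bullet> ivec b \<in> \<int>" "ivec a \<bullet> ((2 * real N) *\<^sub>R s) \<in> \<int>" "ivec a \<bullet> ivec b \<in> \<int>"
    proof -
      have v2: "2 * real N * v $ p \<in> \<int>" for p using v by (simp add: torsion_def)
      have "(2 * real N * v $ Inl i) * of_int (b $ i) \<in> \<int>" "of_int (a $ i) * (2 * real N * v $ Inr i) \<in> \<int>" for i
        by (intro Ints_mult[OF v2] Ints_mult[OF _ v2] Ints_of_int)+
      then show "((2 * real N) *\<^sub>R r) \<bullet> ivec b \<in> \<int>" "ivec a \<bullet> ((2 * real N) *\<^sub>R s) \<in> \<int>"
        by (intro Ints_inner; simp add: r_def s_def ivec_def mult_ac)+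
      show "ivec a \<bullet> ivec b \<in> \<int>" by (intro Ints_inner) (simp add: ivec_def)
    qed
    then have "((2 * real N) *\<^sub>R r) \<bullet> ivec b - ivec a \<bullet> ((2 * real N) *\<^sub>R s) - of_nat (2 * N) * (ivec a \<bullet> ivec b) \<in> \<int>"
      by (intro Ints_diff Ints_mult) auto
    moreover have "real (4 * N) * E = ((2 * real N) *\<^sub>R r) \<bullet> ivec b - ivec a \<bullet> ((2 * real N) *\<^sub>R s) - of_nat (2 * N) * (ivec a \<bullet> ivec b)"
      unfolding inner_scaleR_left inner_scaleR_right E_def by (simp add: field_simps)
    ultimately have "e2pi (of_real (real (4 * N) * E)) = 1" using e2pi_of_real_Ints by metis
    then show ?thesis by (simp add: e2pi_power)
  qed
  ultimately show ?thesis by (simp add: power_mult_distrib)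
qed

definition char_sign :: "real ^ ('g::finite + 'g) \<Rightarrow> complex" where
  "char_sign h = e2pi (of_real (2 * (lo h \<bullet> hi h)))"

definition halves :: "(real ^ 'n) set" where
  "halves = {h. \<forall>p. h $ p \<in> {0, 1/2}}"

definition parity_class :: "complex \<Rightarrow> (real ^ ('g::finite + 'g)) set" where
  "parity_class \<sigma> = {h \<in> halves. char_sign h = \<sigma>}"

lemma finite_vec_Pi:
  assumes "\<And>i. finite (S i)"
  shows "finite {v :: 'a ^ 'n. \<forall>i. v $ i \<in> S i}"
proof (rule finite_subset)
  show "{v :: 'a ^ 'n. \<forall>i. v $ i \<in> S i} \<subseteq> vec_lambda ` (PiE UNIV S)"
    by (auto intro!: image_eqI[where x = "vec_nth _"])
  show "finite (vec_lambda ` (PiE UNIV S) :: ('a ^ 'n) set)"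
    using assms by (intro finite_imageI finite_PiE) auto
qed

lemma finite_halves: "finite halves"
  unfolding halves_def by (rule finite_vec_Pi) auto

lemma finite_parity_class: "finite (parity_class \<sigma>)"
  by (rule finite_subset[OF _ finite_halves]) (auto simp: parity_class_def)

definition frac_vec :: "real ^ 'n \<Rightarrow> real ^ 'n" where
  "frac_vec h = (\<chi> p. frac (h $ p))"

lemma frac_half:
  assumes "2 * x \<in> \<int>" shows "frac x \<in> {0, 1/2 :: real}"
proof -
  obtain m where m: "2 * x = of_int m" using assms by (elim Ints_cases)
  show ?thesis
  proof (cases "even m")
    case True
    then obtain l where "m = 2 * l" by (elim evenE)
    then have "x = of_int l" using m by simp
    then show ?thesis by simp
  next
    case False
    then obtain l where "m = 2 * l + 1" by (elim oddE)
    then have "x = of_int l + 1/2" using m by simp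
    then have "frac x = 1/2" by (subst frac_unique_iff) simp
    then show ?thesis by simp
  qed
qed

lemma frac_vec_halves: "h \<in> torsion 2 \<Longrightarrow> frac_vec h \<in> halves"
  using frac_half by (auto simp: torsion_def frac_vec_def halves_def)

lemma halves_torsion: "halves \<subseteq> torsion 2"
proof
  fix h :: "real ^ 'a" assume "h \<in> halves"
  then have "h $ p = 0 \<or> h $ p = 1/2" for p by (simp add: halves_def)
  then have "2 * h $ p \<in> \<int>" for p using Ints_0 Ints_1 by (metis mult_zero_right nonzero_mult_div_cancel_left times_divide_eq_right zero_neq_numeral mult.right_neutral)
  then show "h \<in> torsion 2" by (simp add: torsion_def)
qed

lemma frac_vec_integral: "integral_vec (frac_vec h - h)"
  by (simp add: integral_vec_def frac_vec_def frac_def)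

lemma frac_vec_eq:
  assumes "h \<in> halves" "integral_vec (x - h)"
  shows "frac_vec x = h"
proof -
  have "frac (x $ p) = h $ p" for p
  proof -
    have "h $ p \<ge> 0 \<and> h $ p < 1" using assms(1) by (auto simp: halves_def dest: spec[of _ p])
    moreover have "x $ p - h $ p \<in> \<int>" using assms(2) by (simp add: integral_vec_def)
    ultimately show ?thesis by (subst frac_unique_iff) (auto simp: algebra_simps)
  qed
  then show ?thesis by (simp add: frac_vec_def vec_eq_iff)
qed

lemma char_sign_cong:
  assumes h: "h \<in> torsion 2" and i: "integral_vec (x - h)"
  shows "char_sign x = char_sign h"
proof -
  obtain m where m: "integral_vec m" "x = h + m" using i by (metis add_diff_cancel_left' diff_add_cancel add.commute)
  have "2 * (lo x \<bullet> hi x) - 2 * (lo h \<bullet> hi h) =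
     (2 *\<^sub>R lo h) \<bullet> hi m + lo m \<bullet> (2 *\<^sub>R hi h) + 2 * (lo m \<bullet> hi m)"
    unfolding m(2) by (simp add: inner_vec_def sum_distrib_left sum.distrib[symmetric] sum_subtractf[symmetric] algebra_simps)
  also have "\<dots> \<in> \<int>"
    using h m(1) by (intro Ints_add Ints_mult Ints_inner) (auto simp: torsion_def integral_vec_def)
  finally show ?thesis unfolding char_sign_def by (rule e2pi_cong_Ints)
qed

text \<open>The map \<open>f\<close> is an involution only modulo integral vectors and may leave the
  chosen representatives; followed by \<open>frac_vec\<close> it is a genuine involution of the
  parity class, and \<open>F\<close> does not see the difference.\<close>

lemma prod_parity_class_reindex:
  fixes F :: "real ^ ('g::finite + 'g) \<Rightarrow> complex"
  assumes f: "\<And>h. h \<in> torsion 2 \<Longrightarrow> f h \<in> torsion 2" and p: "\<And>h. h \<in> torsion 2 \<Longrightarrow> char_sign (f h) = char_sign h"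
    and c: "\<And>h h'. integral_vec (h' - h) \<Longrightarrow> integral_vec (f h' - f h)"
    and inv: "\<And>h. h \<in> torsion 2 \<Longrightarrow> integral_vec (f (f h) - h)"
    and F: "\<And>h h'. h \<in> torsion 2 \<Longrightarrow> integral_vec (h' - h) \<Longrightarrow> F h' = F h"
  shows "(\<Prod>h\<in>parity_class \<sigma>. F (f h)) = (\<Prod>h\<in>parity_class \<sigma>. F h)"
proof (rule prod.reindex_bij_witness[where i = "\<lambda>h. frac_vec (f h)" and j = "\<lambda>h. frac_vec (f h)"])
  fix h :: "real ^ ('g + 'g)" assume h: "h \<in> parity_class \<sigma>"
  then have h2: "h \<in> torsion 2" "h \<in> halves" using halves_torsion by (auto simp: parity_class_def)
  have r: "frac_vec (f h) \<in> halves" using f[OF h2(1)] by (rule frac_vec_halves)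
  have "integral_vec (f (frac_vec (f h)) - f (f h))" by (rule c[OF frac_vec_integral])
  from integral_vec_add[OF this inv[OF h2(1)]] have "integral_vec (f (frac_vec (f h)) - h)" by simp
  then show "frac_vec (f (frac_vec (f h))) = h" by (rule frac_vec_eq[OF h2(2)])
  then show "frac_vec (f (frac_vec (f h))) = h" .
  show rS: "frac_vec (f h) \<in> parity_class \<sigma>"
    using r h p[OF h2(1)] char_sign_cong[OF f[OF h2(1)] frac_vec_integral] by (simp add: parity_class_def)
  then show "frac_vec (f h) \<in> parity_class \<sigma>" .
  show "F (frac_vec (f h)) = F (f h)" by (rule F[OF f[OF h2(1)] frac_vec_integral])
qed

lemma torsion_diff: "v \<in> torsion c \<Longrightarrow> w \<in> torsion c \<Longrightarrow> v - w \<in> torsion c"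
  by (auto simp: torsion_def right_diff_distrib)

lemma torsion_mult: "v \<in> torsion c \<Longrightarrow> d \<in> \<int> \<Longrightarrow> v \<in> torsion (d * c)"
  by (auto simp: torsion_def mult.assoc)

lemma tact_integral:
  assumes "v \<in> torsion c" shows "tact \<gamma> v \<in> torsion c"
proof -
  have "c * tact \<gamma> v $ q = (\<Sum>p\<in>UNIV. of_int (\<gamma> $ p $ q) * (c * v $ p))" for q
    by (simp add: tact_def sum_distrib_left mult_ac)
  then show ?thesis using assms by (auto simp: torsion_def)
qed

lemma ch_torsion:
  assumes "v \<in> torsion c"
  shows "chT i k v \<in> torsion c" "chJ i v \<in> torsion c" "chU i j k v \<in> torsion c"
  using tact_integral[OF assms, of "opT i k (mat 1)"] tact_integral[OF assms, of "opJ i (mat 1)"]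
    tact_integral[OF assms, of "opU i j k (mat 1)"]
  by (simp_all add: tact_opT tact_opJ tact_opU tact_one)

lemma ch_diff:
  "chT i k (v - w) = chT i k v - chT i k w" "chJ i (v - w) = chJ i v - chJ i w"
  "chU i j k (v - w) = chU i j k v - chU i j k w"
  by (simp_all add: chT_def chJ_def chU_def vec_eq_iff algebra_simps)

definition phi_prod :: "complex \<Rightarrow> nat \<Rightarrow> real ^ ('g::finite + 'g) \<Rightarrow> complex ^ 'g ^ 'g \<Rightarrow> complex" where
  "phi_prod \<sigma> N w Z = (\<Prod>h\<in>parity_class \<sigma>. phi (h - w) Z ^ (4 * N))"

text \<open>Each parity receives the odd factor that appears in the size of the other class, so that
  size times exponent agrees for both.\<close>

definition theta_exponent :: "'g::finite itself \<Rightarrow> complex \<Rightarrow> nat" where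
  "theta_exponent _ \<sigma> = (if \<sigma> = 1 then 2 ^ CARD('g) - 1 else 2 ^ CARD('g) + 1)"

lemma odd_theta_exponent: "odd (theta_exponent TYPE('g::finite) \<sigma>)"
  by (auto simp: theta_exponent_def)

definition phi_prod_power :: "complex \<Rightarrow> nat \<Rightarrow> real ^ ('g::finite + 'g) \<Rightarrow> complex ^ 'g ^ 'g \<Rightarrow> complex" where
  "phi_prod_power \<sigma> N w Z = phi_prod \<sigma> N w Z ^ theta_exponent TYPE('g) \<sigma>"

lemma parity_class_torsion:
  assumes "h \<in> torsion 2" "w \<in> torsion (real N)"
  shows "h - w \<in> torsion (2 * real N)"
  using torsion_mult[OF assms(1), of "real N"] torsion_mult[OF assms(2), of 2]
  by (intro torsion_diff) (simp_all add: mult.commute)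

lemma prod_parity_class_phi:
  fixes w :: "real ^ ('g::finite + 'g)"
  assumes "\<And>h. h \<in> torsion 2 \<Longrightarrow> f h \<in> torsion 2" "\<And>h. h \<in> torsion 2 \<Longrightarrow> char_sign (f h) = char_sign h"
    and "\<And>h h'. integral_vec (h' - h) \<Longrightarrow> integral_vec (f h' - f h)"
    and "\<And>h. h \<in> torsion 2 \<Longrightarrow> integral_vec (f (f h) - h)"
    and w: "w \<in> torsion (real N)"
  shows "(\<Prod>h\<in>parity_class \<sigma>. phi (f h - w) Z ^ (4 * N)) = phi_prod \<sigma> N w Z"
  unfolding phi_prod_def
proof (rule prod_parity_class_reindex[of f "\<lambda>h. phi (h - w) Z ^ (4 * N)"])
  fix h h' :: "real ^ ('g + 'g)" assume "h \<in> torsion 2" "integral_vec (h' - h)"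
  then show "phi (h' - w) Z ^ (4 * N) = phi (h - w) Z ^ (4 * N)"
    using phi_periodic[OF parity_class_torsion[OF _ w], of h "h' - h" Z] by simp
qed (use assms in auto)

lemma phi_prod_periodic:
  fixes w :: "real ^ ('g::finite + 'g)"
  assumes "w \<in> torsion (real N)" "integral_vec (w' - w)"
  shows "phi_prod \<sigma> N w' Z = phi_prod \<sigma> N w Z"
  unfolding phi_prod_def
proof (intro prod.cong refl)
  fix h :: "real ^ ('g + 'g)" assume "h \<in> parity_class \<sigma>"
  then have "h \<in> torsion 2" using halves_torsion by (auto simp: parity_class_def)
  from phi_periodic[OF parity_class_torsion[OF this assms(1)] integral_vec_minus[OF assms(2)]]
  show "phi (h - w') Z ^ (4 * N) = phi (h - w) Z ^ (4 * N)" by simp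
qed

lemma integral_vec_of_torsion: "v \<in> torsion 1 \<longleftrightarrow> integral_vec v"
  by (simp add: torsion_def integral_vec_def)

section \<open>Products over a parity class under the generators\<close>

lemma phi_prod_actU:
  fixes w :: "real ^ ('g::finite + 'g)"
  assumes Z: "Z \<in> siegel_space" and ij: "i \<noteq> j" and w: "w \<in> torsion (real N)"
  shows "phi_prod \<sigma> N w (actU i j k Z) = phi_prod \<sigma> N (chU i j k w) Z"
proof -
  have "phi_prod \<sigma> N w (actU i j k Z) = (\<Prod>h\<in>parity_class \<sigma>. phi (chU i j k h - chU i j k w) Z ^ (4 * N))"
    by (simp add: phi_prod_def phi_actU[OF Z ij] ch_diff)
  also have "\<dots> = phi_prod \<sigma> N (chU i j k w) Z"
  proof (rule prod_parity_class_phi)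
    fix h :: "real ^ ('g + 'g)" assume h: "h \<in> torsion 2"
    show "chU i j k h \<in> torsion 2" using h by (rule ch_torsion)
    have "lo (chU i j k h) = lo h + (of_int k * lo h $ i) *\<^sub>R axis j 1"
      "hi (chU i j k h) = hi h - (of_int k * hi h $ j) *\<^sub>R axis i 1"
      by (simp_all add: chU_def vec_eq_iff axis_def)
    moreover have "axis j (1::real) \<bullet> axis i 1 = 0" using ij by (simp add: inner_axis_axis)
    ultimately show "char_sign (chU i j k h) = char_sign h"
      by (simp add: char_sign_def inner_add_left inner_diff_right inner_axis inner_axis')
    have "2 * of_int k * h $ p \<in> \<int>" for p
      using h by (auto simp: torsion_def mult.assoc mult.left_commute[of 2])
    moreover have "chU i j k (chU i j k h) - h = (\<chi> p. if p = Inl j then 2 * of_int k * h $ Inl i else if p = Inr i then - (2 * of_int k * h $ Inr j) else 0)"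
      using ij by (auto simp: chU_def vec_eq_iff)
    ultimately show "integral_vec (chU i j k (chU i j k h) - h)" by (simp add: integral_vec_def)
  next
    fix h h' :: "real ^ ('g + 'g)" assume "integral_vec (h' - h)"
    then show "integral_vec (chU i j k h' - chU i j k h)"
      unfolding ch_diff[symmetric] integral_vec_of_torsion[symmetric] by (rule ch_torsion)
  qed (rule ch_torsion(3)[OF w])
  finally show ?thesis .
qed

text \<open>Every factor contributes the same power of \<open>- \<i> * Z $ i $ i\<close>, so the
  class enters only through its cardinality.\<close>

lemma phi_prod_actJ:
  fixes w :: "real ^ ('g::finite + 'g)"
  assumes Z: "Z \<in> siegel_space" and w: "w \<in> torsion (real N)"
  shows "phi_prod \<sigma> N w (actJ i Z) = (- \<i> * Z $ i $ i) ^ (2 * N * card (parity_class \<sigma> :: (real ^ ('g + 'g)) set)) * phi_prod \<sigma> N (chJ i w) Z"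
proof -
  have rt: "rtfac (Z $ i $ i) ^ (4 * N) = (- \<i> * Z $ i $ i) ^ (2 * N)"
    using rtfac_power2[OF siegel_space_diag_nonzero[OF Z, of i]] power_mult[of "rtfac (Z $ i $ i)" 2 "2 * N"] by simp
  have "phi_prod \<sigma> N w (actJ i Z) = (\<Prod>h\<in>(parity_class \<sigma> :: (real ^ ('g + 'g)) set). (- \<i> * Z $ i $ i) ^ (2 * N)) * (\<Prod>h\<in>parity_class \<sigma>. phi (chJ i h - chJ i w) Z ^ (4 * N))"
    by (simp only: phi_prod_def phi_actJ[OF Z] ch_diff power_mult_distrib[of "rtfac _"] rt prod.distrib)
  also have "(\<Prod>h\<in>parity_class \<sigma>. phi (chJ i h - chJ i w) Z ^ (4 * N)) = phi_prod \<sigma> N (chJ i w) Z"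
  proof (rule prod_parity_class_phi)
    fix h :: "real ^ ('g + 'g)" assume h: "h \<in> torsion 2"
    show "chJ i h \<in> torsion 2" using h by (rule ch_torsion)
    have "lo (chJ i h) \<bullet> hi (chJ i h) = lo h \<bullet> hi h - 2 * h $ Inl i * h $ Inr i"
    proof -
      have "lo (chJ i h) \<bullet> hi (chJ i h) - lo h \<bullet> hi h = (\<Sum>a\<in>UNIV. if a = i then - 2 * h $ Inl i * h $ Inr i else 0)"
        unfolding inner_vec_def sum_subtractf[symmetric] by (intro sum.cong refl) (auto simp: chJ_def)
      then show ?thesis by simp
    qed
    then have "2 * (lo (chJ i h) \<bullet> hi (chJ i h)) - 2 * (lo h \<bullet> hi h) = - ((2 * h $ Inl i) * (2 * h $ Inr i))" by simp
    also have "\<dots> \<in> \<int>" 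
    proof -
      have h2: "2 * h $ p \<in> \<int>" for p using h by (simp add: torsion_def)
      show ?thesis by (intro Ints_minus Ints_mult[OF h2 h2])
    qed
    finally show "char_sign (chJ i h) = char_sign h" unfolding char_sign_def by (rule e2pi_cong_Ints)
    have "chJ i (chJ i h) - h = (\<chi> p. if p = Inl i \<or> p = Inr i then - (2 * h $ p) else 0)"
      by (auto simp: chJ_def vec_eq_iff)
    then show "integral_vec (chJ i (chJ i h) - h)" using h by (simp add: integral_vec_def torsion_def)
  next
    fix h h' :: "real ^ ('g + 'g)" assume "integral_vec (h' - h)"
    then show "integral_vec (chJ i h' - chJ i h)"
      unfolding ch_diff[symmetric] integral_vec_of_torsion[symmetric] by (rule ch_torsion)
  qed (rule ch_torsion(2)[OF w])
  finally show ?thesis by (simp add: power_mult)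
qed

text \<open>After the power \<open>4 * N\<close> the phase of a factor depends only on
  \<open>h $ Inl i\<close>, because \<open>N * w\<close> is integral. Characteristics with entry 1/2
  there contribute a sign and the others nothing.\<close>

lemma phi_prod_actT:
  fixes w :: "real ^ ('g::finite + 'g)"
  assumes w: "w \<in> torsion (real N)"
  shows "phi_prod \<sigma> N w (actT i k Z) = (- 1) ^ (nat \<bar>k\<bar> * N * card {h \<in> (parity_class \<sigma> :: (real ^ ('g + 'g)) set). h $ Inl i = 1/2}) * phi_prod \<sigma> N (chT i k w) Z"
proof -
  define c :: "real ^ ('g + 'g)" where "c = (of_int k / 2) *\<^sub>R axis (Inr i) 1"
  define q where "q h = (if h $ Inl i = 1/2 then (- 1) ^ (nat \<bar>k\<bar> * N) else 1 :: complex)" for h :: "real ^ ('g + 'g)"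
  have ph: "phi (h - w) (actT i k Z) ^ (4 * N) = q h * phi ((chT i k h + c) - chT i k w) Z ^ (4 * N)" if h: "h \<in> parity_class \<sigma>" for h
  proof -
    have "real N * w $ Inl i \<in> \<int>" using w by (simp add: torsion_def)
    then have "of_int k * (real N * w $ Inl i) \<in> \<int>" by (intro Ints_mult[OF Ints_of_int])
    moreover have "real (4 * N) * (- of_int k * (h - w) $ Inl i / 4) - (- of_int k * real N * h $ Inl i) = of_int k * (real N * w $ Inl i)"
      by (simp add: field_simps)
    ultimately have "e2pi (of_real (real (4 * N) * (- of_int k * (h - w) $ Inl i / 4))) = e2pi (of_real (- of_int k * real N * h $ Inl i))"
      by (intro e2pi_cong_Ints) simp
    also have "\<dots> = q h"
    proof (cases "h $ Inl i = 1/2")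
      case True
      have e1: "e2pi (1/2) = -1" by (simp add: e2pi_def)
      have e2: "e2pi (-1/2) = -1" by (simp add: e2pi_def exp_minus)
      show ?thesis
      proof (cases "k \<ge> 0")
        case k: True
        then obtain n where n: "k = int n" by (elim nonneg_int_cases)
        have eq: "of_real (- of_int k * real N * h $ Inl i) = of_nat (nat \<bar>k\<bar> * N) * (-1/2 :: complex)"
          unfolding True n by simp
        show ?thesis unfolding eq e2pi_power[symmetric] e2 using True by (simp add: q_def)
      next
        case k: False
        then obtain n where n: "k = - int n" by (metis int_cases2 nonneg_int_cases linear of_nat_0_le_iff)
        have eq: "of_real (- of_int k * real N * h $ Inl i) = of_nat (nat \<bar>k\<bar> * N) * (1/2 :: complex)"
          unfolding True n by simp
        show ?thesis unfolding eq e2pi_power[symmetric] e1 using True by (simp add: q_def)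
      qed
    next
      case False
      then have "h $ Inl i = 0" using h by (auto simp: parity_class_def halves_def)
      then show ?thesis by (simp add: q_def)
    qed
    finally have "e2pi (of_real (- of_int k * (h - w) $ Inl i / 4)) ^ (4 * N) = q h"
      by (simp add: e2pi_power)
    moreover have c: "chT i k (h - w) + c = (chT i k h + c) - chT i k w" by (simp add: ch_diff)
    ultimately show ?thesis unfolding phi_actT power_mult_distrib c_def[symmetric] c by simp
  qed
  have finS: "finite (parity_class \<sigma> :: (real ^ ('g + 'g)) set)" by (rule finite_parity_class)
  have "phi_prod \<sigma> N w (actT i k Z) = (\<Prod>h\<in>parity_class \<sigma>. q h) * (\<Prod>h\<in>parity_class \<sigma>. phi ((chT i k h + c) - chT i k w) Z ^ (4 * N))"
    by (simp add: phi_prod_def ph prod.distrib)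
  also have "(\<Prod>h\<in>parity_class \<sigma>. phi ((chT i k h + c) - chT i k w) Z ^ (4 * N)) = phi_prod \<sigma> N (chT i k w) Z"
  proof (rule prod_parity_class_phi)
    have c2: "c \<in> torsion 2" by (simp add: torsion_def c_def axis_def)
    fix h :: "real ^ ('g + 'g)" assume h: "h \<in> torsion 2"
    show "chT i k h + c \<in> torsion 2"
      using torsion_diff[OF ch_torsion(1)[OF h], of "- c" i k] c2 by (simp add: torsion_def)
    have l: "lo (chT i k h + c) = lo h" "hi (chT i k h + c) = hi h + (of_int k * h $ Inl i + of_int k / 2) *\<^sub>R axis i 1"
      by (auto simp: vec_eq_iff chT_def c_def axis_def)
    obtain m where m: "2 * h $ Inl i = of_int m" using h by (auto simp: torsion_def elim!: Ints_cases)
    \<comment> \<open>This keeps the affine map parity preserving: the half-integral shift completes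
      the change of the pairing to \<open>k * m * (m + 1) / 2\<close>.\<close>
    have "even (m * (m + 1))" by simp
    then obtain l' where "m * (m + 1) = 2 * l'" by (elim evenE)
    then have l': "real_of_int m * (real_of_int m + 1) = 2 * of_int l'"
      by (metis of_int_1 of_int_add of_int_mult of_int_numeral)
    have hm: "h $ Inl i = of_int m / 2" using m by simp
    have "2 * (lo (chT i k h + c) \<bullet> hi (chT i k h + c)) - 2 * (lo h \<bullet> hi h) = of_int k * (real_of_int m * (real_of_int m + 1)) / 2"
      unfolding l by (simp add: inner_add_right inner_axis hm field_simps)
    also have "\<dots> = of_int (k * l')" unfolding l' by simp
    finally show "char_sign (chT i k h + c) = char_sign h" unfolding char_sign_def by (intro e2pi_cong_Ints) (simp only: Ints_of_int)
    have "chT i k (chT i k h + c) + c - h = (\<chi> p. if p = Inr i then of_int k * (2 * h $ Inl i) + of_int k else 0)"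
      by (auto simp: chT_def c_def axis_def vec_eq_iff)
    moreover have "of_int k * (2 * h $ Inl i) + of_int k \<in> \<int>" unfolding m by (intro Ints_add Ints_mult) auto
    ultimately show "integral_vec (chT i k (chT i k h + c) + c - h)" by (simp add: integral_vec_def)
  next
    fix h h' :: "real ^ ('g + 'g)" assume "integral_vec (h' - h)"
    then have "integral_vec (chT i k h' - chT i k h)"
      unfolding ch_diff[symmetric] integral_vec_of_torsion[symmetric] by (rule ch_torsion)
    then show "integral_vec (chT i k h' + c - (chT i k h + c))" by simp
  qed (rule ch_torsion(1)[OF w])
  also have "(\<Prod>h\<in>parity_class \<sigma>. q h) = ((- 1) ^ (nat \<bar>k\<bar> * N)) ^ card {h \<in> (parity_class \<sigma> :: (real ^ ('g + 'g)) set). h $ Inl i = 1/2}"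
    unfolding q_def by (subst prod.If_cases[OF finS]) (simp add: Collect_conj_eq[symmetric] Int_def)
  finally show ?thesis by (simp add: power_mult)
qed

lemma char_sign_halves:
  assumes "h \<in> halves" shows "char_sign h = 1 \<or> char_sign h = - 1"
proof -
  have h2: "2 * h $ p \<in> \<int>" for p using assms halves_torsion by (auto simp: torsion_def)
  have h4: "4 * (h $ Inl i * h $ Inr i) \<in> \<int>" for i
    using Ints_mult[OF h2[of "Inl i"] h2[of "Inr i"]] by simp
  have "(2 *\<^sub>R lo h) \<bullet> (2 *\<^sub>R hi h) \<in> \<int>"
    by (intro Ints_inner) (simp add: h4)
  then have "e2pi (of_real (2 * (2 * (lo h \<bullet> hi h)))) = 1" by (intro e2pi_of_real_Ints) simp
  then have "char_sign h ^ 2 = 1" unfolding char_sign_def e2pi_power by simp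
  then show ?thesis by (simp add: power2_eq_1_iff)
qed

lemma char_sign_prod: "char_sign h = (\<Prod>i\<in>UNIV. e2pi (of_real (2 * (h $ Inl i * h $ Inr i))))"
  unfolding char_sign_def e2pi_sum[OF finite, symmetric] by (simp add: inner_vec_def sum_distrib_left)

text \<open>A sum over all half-integral characteristics factors over the \<open>g\<close> planes.
  It counts the characteristics with \<open>f = 1\<close> and computes the sum of their signs when
  \<open>f\<close> is the sign in one plane.\<close>

lemma sum_halves_prod:
  fixes f :: "real \<Rightarrow> real \<Rightarrow> complex"
  shows "(\<Sum>h\<in>(halves :: (real ^ ('g::finite + 'g)) set). \<Prod>i\<in>UNIV. f (h $ Inl i) (h $ Inr i))
    = (f 0 0 + f 0 (1/2) + f (1/2) 0 + f (1/2) (1/2)) ^ CARD('g)"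
proof -
  let ?D = "{0, 1/2 :: real} \<times> {0, 1/2 :: real}"
  have sD: "(\<Sum>z\<in>?D. f (fst z) (snd z)) = f 0 0 + f 0 (1/2) + f (1/2) 0 + f (1/2) (1/2)"
    by (simp add: sum.cartesian_product[symmetric, of "\<lambda>x y. f x y", simplified case_prod_beta] add.assoc)
  have "(f 0 0 + f 0 (1/2) + f (1/2) 0 + f (1/2) (1/2)) ^ CARD('g) = (\<Prod>i\<in>(UNIV::'g set). \<Sum>z\<in>?D. f (fst z) (snd z))"
    unfolding sD by simp
  also have "\<dots> = (\<Sum>g\<in>PiE (UNIV::'g set) (\<lambda>_. ?D). \<Prod>i\<in>UNIV. f (fst (g i)) (snd (g i)))"
    by (rule prod_sum_PiE) auto
  also have "\<dots> = (\<Sum>h\<in>(halves :: (real ^ ('g::finite + 'g)) set). \<Prod>i\<in>UNIV. f (h $ Inl i) (h $ Inr i))"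
  proof (rule sum.reindex_bij_witness[where j = "\<lambda>g. \<chi> p. case p of Inl a \<Rightarrow> fst (g a) | Inr a \<Rightarrow> snd (g a)"
          and i = "\<lambda>h a. (h $ Inl a, h $ Inr a)"])
    fix g :: "'g \<Rightarrow> real \<times> real" assume g: "g \<in> PiE UNIV (\<lambda>_. ?D)"
    have "g a \<in> ?D" for a using PiE_mem[OF g, of a] by simp
    then have "fst (g a) \<in> {0, 1/2}" "snd (g a) \<in> {0, 1/2}" for a by (simp_all only: mem_Times_iff)
    then show "(\<chi> p. case p of Inl a \<Rightarrow> fst (g a) | Inr a \<Rightarrow> snd (g a)) \<in> halves"
      unfolding halves_def by (simp split: sum.split)
  qed (auto simp: halves_def vec_eq_iff split: sum.splits)
  finally show ?thesis by simp
qed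

text \<open>The class sizes have sum \<open>4^g\<close> and difference
  \<open>(1 + 1 + 1 - 1)^g = 2^g\<close>; this determines both.\<close>

lemma card_parity_class:
  fixes \<sigma> :: complex
  assumes "\<sigma> \<in> {1, - 1}"
  shows "2 * card (parity_class \<sigma> :: (real ^ ('g::finite + 'g)) set) * theta_exponent TYPE('g) \<sigma> = 2 ^ CARD('g) * (2 ^ CARD('g) - 1) * (2 ^ CARD('g) + 1)"
proof -
  let ?S = "parity_class :: complex \<Rightarrow> (real ^ ('g + 'g)) set"
  have e: "e2pi (1/2) = -1" by (simp add: e2pi_def)
  have U: "halves = ?S 1 \<union> ?S (-1)" and D: "?S 1 \<inter> ?S (-1) = {}"
    using char_sign_halves by (auto simp: parity_class_def)
  have s: "(\<Sum>h\<in>halves. f h) = (\<Sum>h\<in>?S 1. f h) + (\<Sum>h\<in>?S (-1). f h)" for f :: "_ \<Rightarrow> complex"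
    unfolding U by (rule sum.union_disjoint[OF finite_parity_class finite_parity_class D])
  have "(\<Sum>h\<in>(halves :: (real ^ ('g + 'g)) set). 1 :: complex) = 4 ^ CARD('g)"
    using sum_halves_prod[of "\<lambda>_ _. 1", where 'g = 'g] by simp
  then have 1: "of_nat (card (?S 1)) + of_nat (card (?S (-1))) = (4 ^ CARD('g) :: complex)"
    unfolding s by simp
  have "(\<Sum>h\<in>(halves :: (real ^ ('g + 'g)) set). char_sign h) = 2 ^ CARD('g)"
    using sum_halves_prod[of "\<lambda>x y. e2pi (of_real (2 * (x * y)))", where 'g = 'g] e by (simp add: char_sign_prod)
  then have "(\<Sum>h\<in>?S 1. char_sign h) + (\<Sum>h\<in>?S (-1). char_sign h) = 2 ^ CARD('g)" unfolding s .
  then have 2: "of_nat (card (?S 1)) - of_nat (card (?S (-1))) = (2 ^ CARD('g) :: complex)"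
    by (simp add: parity_class_def)
  have "of_nat (2 * card (?S 1)) = (of_nat (2 ^ CARD('g) * (2 ^ CARD('g) + 1)) :: complex)"
    using arg_cong2[OF 1 2, of "(+)"] by (simp add: algebra_simps power_mult_distrib[symmetric] flip: power_add)
  then have c1: "2 * card (?S 1) = 2 ^ CARD('g) * (2 ^ CARD('g) + 1)" by (simp only: of_nat_eq_iff)
  have "of_nat (2 * card (?S (-1)) + 2 ^ CARD('g)) = (of_nat (2 ^ CARD('g) * 2 ^ CARD('g)) :: complex)"
    using arg_cong2[OF 1 2, of "(-)"] by (simp add: algebra_simps power_mult_distrib[symmetric] flip: power_add)
  then have "2 * card (?S (-1)) + 2 ^ CARD('g) = 2 ^ CARD('g) * 2 ^ CARD('g)" by (simp only: of_nat_eq_iff)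
  then have c2: "2 * card (?S (-1)) = 2 ^ CARD('g) * (2 ^ CARD('g) - 1)"
    unfolding right_diff_distrib' by simp
  have ne: "(- 1 :: complex) \<noteq> 1" by simp
  from assms consider "\<sigma> = 1" | "\<sigma> = - 1" by blast
  then show ?thesis
  proof cases
    case 1 show ?thesis unfolding 1 c1 theta_exponent_def by (simp only: refl if_True mult_ac)
  next
    case 2 show ?thesis unfolding 2 c2 theta_exponent_def by (simp only: ne if_False mult_ac)
  qed
qed

text \<open>When the \<open>Inl i\<close> entry is 1/2, flipping the \<open>Inr i\<close> entry
  between 0 and 1/2 reverses the parity. Translations therefore give both parities the same
  sign.\<close>

lemma card_parity_class_half_eq:
  "card {h \<in> (parity_class 1 :: (real ^ ('g::finite + 'g)) set). h $ Inl i = 1/2} = card {h \<in> (parity_class (- 1) :: (real ^ ('g + 'g)) set). h $ Inl i = 1/2}"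
proof (rule bij_betw_same_card)
  define flip where "flip = (\<lambda>h :: real ^ ('g + 'g). \<chi> p. if p = Inr i then 1/2 - h $ p else h $ p)"
  have ff: "flip (flip h) = h" for h by (simp add: flip_def vec_eq_iff)
  have fi: "flip h $ Inl i = h $ Inl i" for h by (simp add: flip_def)
  have fh: "flip h \<in> halves" if "h \<in> halves" for h
    using that by (auto simp: flip_def halves_def)
  have fp: "char_sign (flip h) = - char_sign h" if h: "h \<in> halves" "h $ Inl i = 1/2" for h
  proof -
    have "lo (flip h) \<bullet> hi (flip h) - lo h \<bullet> hi h = (\<Sum>a\<in>UNIV. if a = i then (1/2 - 2 * h $ Inr i) / 2 else 0)"
      unfolding inner_vec_def sum_subtractf[symmetric] by (intro sum.cong refl) (auto simp: flip_def h(2) field_simps)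
    then have eq: "2 * (lo (flip h) \<bullet> hi (flip h)) = 2 * (lo h \<bullet> hi h) + (1/2 - 2 * h $ Inr i)" by simp
    have "h $ Inr i = 0 \<or> h $ Inr i = 1/2" using h by (simp add: halves_def)
    then have "e2pi (of_real (1/2 - 2 * h $ Inr i)) = -1"
    proof
      assume 0: "h $ Inr i = 0" show ?thesis unfolding 0 by (simp add: e2pi_def)
    next
      assume 1: "h $ Inr i = 1/2" show ?thesis unfolding 1 by (simp add: e2pi_def exp_minus)
    qed
    then show ?thesis unfolding char_sign_def eq of_real_add e2pi_add by simp
  qed
  show "bij_betw flip {h \<in> parity_class 1. h $ Inl i = 1/2} {h \<in> parity_class (- 1). h $ Inl i = 1/2}"
    by (rule bij_betwI[where g = flip]) (auto simp: parity_class_def fh fp fi ff)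
qed

text \<open>The common weight of numerator and denominator: half the number of theta factors in
  either product, counted with multiplicity.\<close>

definition theta_weight :: "'g::finite itself \<Rightarrow> nat \<Rightarrow> nat" where
  "theta_weight _ N = N * (2 ^ CARD('g) * (2 ^ CARD('g) - 1) * (2 ^ CARD('g) + 1))"

lemma even_theta_weight: "even (theta_weight TYPE('g::finite) N)"
  by (simp add: theta_weight_def)

text \<open>One \<epsilon> serves both parities and all \<open>w\<close>; the exponents are odd, so
  raising to them does not alter it.\<close>

lemma phi_prod_power_actT:
  obtains \<epsilon> :: complex where "\<epsilon>\<^sup>2 = 1"
    "\<And>\<sigma> w Z. \<sigma> \<in> {1, - 1} \<Longrightarrow> w \<in> torsion (real N) \<Longrightarrow>
       phi_prod_power \<sigma> N w (actT i k Z) = \<epsilon> * phi_prod_power \<sigma> N (chT (i :: 'g::finite) k w) Z"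
proof
  let ?\<epsilon> = "(- 1 :: complex) ^ (nat \<bar>k\<bar> * N * card {h \<in> (parity_class 1 :: (real ^ ('g::finite + 'g)) set). h $ Inl i = 1/2})"
  show "?\<epsilon>\<^sup>2 = 1" by (simp flip: power_mult add: mult.commute[of _ 2])
  then have e: "?\<epsilon> = 1 \<or> ?\<epsilon> = - 1" by (simp only: power2_eq_1_iff)
  fix \<sigma> :: complex and w :: "real ^ ('g + 'g)" and Z
  assume \<sigma>: "\<sigma> \<in> {1, - 1}" and w: "w \<in> torsion (real N)"
  have "phi_prod \<sigma> N w (actT i k Z) = ?\<epsilon> * phi_prod \<sigma> N (chT i k w) Z"
    unfolding phi_prod_actT[OF w] using \<sigma> card_parity_class_half_eq[of i] by auto
  moreover have "?\<epsilon> ^ theta_exponent TYPE('g) \<sigma> = ?\<epsilon>" 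
  proof (rule disjE[OF e])
    assume 1: "?\<epsilon> = 1" show ?thesis unfolding 1 by simp
  next
    assume 1: "?\<epsilon> = - 1" show ?thesis unfolding 1 using odd_theta_exponent[of \<sigma>, where 'g = 'g] by simp
  qed
  ultimately show "phi_prod_power \<sigma> N w (actT i k Z) = ?\<epsilon> * phi_prod_power \<sigma> N (chT i k w) Z"
    by (simp only: phi_prod_power_def power_mult_distrib)
qed

lemma phi_prod_power_actJ:
  fixes i :: "'g::finite"
  assumes "\<sigma> \<in> {1, - 1}" "w \<in> torsion (real N)" "Z \<in> siegel_space"
  shows "phi_prod_power \<sigma> N w (actJ i Z) = (- \<i>) ^ theta_weight TYPE('g) N * (Z $ i $ i) ^ theta_weight TYPE('g) N * phi_prod_power \<sigma> N (chJ i w) Z"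
proof -
  have "2 * N * card (parity_class \<sigma> :: (real ^ ('g + 'g)) set) * theta_exponent TYPE('g) \<sigma> = theta_weight TYPE('g) N"
    unfolding theta_weight_def using card_parity_class[OF assms(1), where 'g = 'g] by (metis mult.assoc mult.left_commute)
  then show ?thesis
    unfolding phi_prod_power_def phi_prod_actJ[OF assms(3,2)] power_mult_distrib power_mult[symmetric] by (simp add: power_mult_distrib)
qed

text \<open>The order of the quantifiers is the point: \<kappa> is chosen before \<sigma> and
  \<open>w\<close>, so it cancels between a numerator and a denominator.\<close>

theorem phi_prod_power_transform:
  assumes "\<gamma> \<in> (spgen :: (int ^ ('g::finite + 'g) ^ ('g + 'g)) set)"
  shows "\<exists>\<kappa>. \<kappa>\<^sup>2 = 1 \<and> (\<forall>\<sigma>\<in>{1, - 1}. \<forall>w\<in>torsion (real N). \<forall>Z\<in>siegel_space.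
     phi_prod_power \<sigma> N w (sp_act \<gamma> Z) = \<kappa> * aut_factor \<gamma> Z ^ theta_weight TYPE('g) N * phi_prod_power \<sigma> N (tact \<gamma> w) Z)"
  using assms
proof (induction rule: spgen.induct)
  case one
  show ?case by (rule exI[of _ 1]) (simp add: act_one tact_one)
next
  case (T \<gamma> i k)
  then obtain \<kappa> where k: "\<kappa>\<^sup>2 = 1" "\<And>\<sigma> w Z. \<sigma> \<in> {1, - 1} \<Longrightarrow> w \<in> torsion (real N) \<Longrightarrow> Z \<in> siegel_space \<Longrightarrow>
    phi_prod_power \<sigma> N w (sp_act \<gamma> Z) = \<kappa> * aut_factor \<gamma> Z ^ theta_weight TYPE('g) N * phi_prod_power \<sigma> N (tact \<gamma> w) Z" by blast
  obtain \<epsilon> :: complex where e: "\<epsilon>\<^sup>2 = 1" "\<And>\<sigma> w Z. \<sigma> \<in> {1, - 1} \<Longrightarrow> w \<in> torsion (real N) \<Longrightarrow>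
       phi_prod_power \<sigma> N w (actT i k Z) = \<epsilon> * phi_prod_power \<sigma> N (chT i k w) Z" using phi_prod_power_actT by metis
  show ?case
  proof (intro exI[of _ "\<epsilon> * \<kappa>"] conjI ballI)
    show "(\<epsilon> * \<kappa>)\<^sup>2 = 1" using k(1) e(1) by (simp add: power_mult_distrib)
    fix \<sigma> :: complex and w :: "real ^ ('g + 'g)" and Z :: "complex ^ 'g ^ 'g"
    assume a: "\<sigma> \<in> {1, - 1}" "w \<in> torsion (real N)" "Z \<in> siegel_space"
    have "phi_prod_power \<sigma> N w (sp_act (opT i k \<gamma>) Z) = \<epsilon> * phi_prod_power \<sigma> N (chT i k w) (sp_act \<gamma> Z)"
      using spgen_act[OF T.hyps a(3)] e(2)[OF a(1,2)] by (simp add: act_opT)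
    also have "\<dots> = \<epsilon> * \<kappa> * aut_factor \<gamma> Z ^ theta_weight TYPE('g) N * phi_prod_power \<sigma> N (tact \<gamma> (chT i k w)) Z"
      using k(2)[OF a(1) ch_torsion(1)[OF a(2)] a(3)] by simp
    finally show "phi_prod_power \<sigma> N w (sp_act (opT i k \<gamma>) Z) = \<epsilon> * \<kappa> * aut_factor (opT i k \<gamma>) Z ^ theta_weight TYPE('g) N * phi_prod_power \<sigma> N (tact (opT i k \<gamma>) w) Z"
      using spgen_act[OF T.hyps a(3)] by (simp add: act_opT tact_opT)
  qed
next
  case (J \<gamma> i)
  then obtain \<kappa> where k: "\<kappa>\<^sup>2 = 1" "\<And>\<sigma> w Z. \<sigma> \<in> {1, - 1} \<Longrightarrow> w \<in> torsion (real N) \<Longrightarrow> Z \<in> siegel_space \<Longrightarrow>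
    phi_prod_power \<sigma> N w (sp_act \<gamma> Z) = \<kappa> * aut_factor \<gamma> Z ^ theta_weight TYPE('g) N * phi_prod_power \<sigma> N (tact \<gamma> w) Z" by blast
  let ?e = "(- \<i>) ^ theta_weight TYPE('g) N"
  show ?case
  proof (intro exI[of _ "?e * \<kappa>"] conjI ballI)
    have "?e\<^sup>2 = ((- \<i>)\<^sup>2) ^ theta_weight TYPE('g) N" by (simp only: power_mult[symmetric] mult.commute)
    also have "\<dots> = 1" using even_theta_weight[of N, where 'g = 'g] by simp
    finally show "(?e * \<kappa>)\<^sup>2 = 1" using k(1) by (simp add: power_mult_distrib)
    fix \<sigma> :: complex and w :: "real ^ ('g + 'g)" and Z :: "complex ^ 'g ^ 'g"
    assume a: "\<sigma> \<in> {1, - 1}" "w \<in> torsion (real N)" "Z \<in> siegel_space"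
    note g = spgen_act[OF J.hyps a(3)]
    have "phi_prod_power \<sigma> N w (sp_act (opJ i \<gamma>) Z) = ?e * (sp_act \<gamma> Z $ i $ i) ^ theta_weight TYPE('g) N * phi_prod_power \<sigma> N (chJ i w) (sp_act \<gamma> Z)"
      using g phi_prod_power_actJ[OF a(1,2)] by (simp add: act_opJ)
    also have "\<dots> = ?e * \<kappa> * (sp_act \<gamma> Z $ i $ i * aut_factor \<gamma> Z) ^ theta_weight TYPE('g) N * phi_prod_power \<sigma> N (tact \<gamma> (chJ i w)) Z"
      using k(2)[OF a(1) ch_torsion(2)[OF a(2)] a(3)] by (simp add: power_mult_distrib)
    finally show "phi_prod_power \<sigma> N w (sp_act (opJ i \<gamma>) Z) = ?e * \<kappa> * aut_factor (opJ i \<gamma>) Z ^ theta_weight TYPE('g) N * phi_prod_power \<sigma> N (tact (opJ i \<gamma>) w) Z"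
      using g by (simp add: act_opJ tact_opJ)
  qed
next
  case (U \<gamma> i j k)
  then obtain \<kappa> where k: "\<kappa>\<^sup>2 = 1" "\<And>\<sigma> w Z. \<sigma> \<in> {1, - 1} \<Longrightarrow> w \<in> torsion (real N) \<Longrightarrow> Z \<in> siegel_space \<Longrightarrow>
    phi_prod_power \<sigma> N w (sp_act \<gamma> Z) = \<kappa> * aut_factor \<gamma> Z ^ theta_weight TYPE('g) N * phi_prod_power \<sigma> N (tact \<gamma> w) Z" by blast
  show ?case
  proof (intro exI[of _ \<kappa>] conjI ballI)
    show "\<kappa>\<^sup>2 = 1" by (rule k(1))
    fix \<sigma> :: complex and w :: "real ^ ('g + 'g)" and Z :: "complex ^ 'g ^ 'g"
    assume a: "\<sigma> \<in> {1, - 1}" "w \<in> torsion (real N)" "Z \<in> siegel_space"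
    note g = spgen_act[OF U.hyps(1) a(3)]
    have "phi_prod_power \<sigma> N w (sp_act (opU i j k \<gamma>) Z) = phi_prod_power \<sigma> N (chU i j k w) (sp_act \<gamma> Z)"
      using g phi_prod_actU[OF _ U.hyps(2) a(2)] by (simp add: act_opU[OF _ U.hyps(2)] phi_prod_power_def)
    also have "\<dots> = \<kappa> * aut_factor \<gamma> Z ^ theta_weight TYPE('g) N * phi_prod_power \<sigma> N (tact \<gamma> (chU i j k w)) Z"
      by (rule k(2)[OF a(1) ch_torsion(3)[OF a(2)] a(3)])
    finally show "phi_prod_power \<sigma> N w (sp_act (opU i j k \<gamma>) Z) = \<kappa> * aut_factor (opU i j k \<gamma>) Z ^ theta_weight TYPE('g) N * phi_prod_power \<sigma> N (tact (opU i j k \<gamma>) w) Z"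
      using g by (simp add: act_opU[OF _ U.hyps(2)] tact_opU)
  qed
qed


section \<open>Fourier expansions\<close>

lemma complex_subfieldD:
  assumes "complex_subfield K"
  shows "0 \<in> K" "1 \<in> K" "\<And>x y. x \<in> K \<Longrightarrow> y \<in> K \<Longrightarrow> x - y \<in> K" "\<And>x y. x \<in> K \<Longrightarrow> y \<in> K \<Longrightarrow> x * y \<in> K"
    "\<And>x. x \<in> K \<Longrightarrow> inverse x \<in> K"
proof -
  show "0 \<in> K" "1 \<in> K" "\<And>x y. x \<in> K \<Longrightarrow> y \<in> K \<Longrightarrow> x - y \<in> K" "\<And>x y. x \<in> K \<Longrightarrow> y \<in> K \<Longrightarrow> x * y \<in> K"
    using assms unfolding complex_subfield_def by blast+
  show "inverse x \<in> K" if "x \<in> K" for x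
    using assms that unfolding complex_subfield_def by (cases "x = 0") auto
qed

lemma complex_subfield_add: "complex_subfield K \<Longrightarrow> x \<in> K \<Longrightarrow> y \<in> K \<Longrightarrow> x + y \<in> K"
  using complex_subfieldD(3)[of K x "0 - y"] complex_subfieldD(3)[of K 0 y] complex_subfieldD(1)[of K] by simp

lemma complex_subfield_sum: "complex_subfield K \<Longrightarrow> (\<And>x. x \<in> A \<Longrightarrow> f x \<in> K) \<Longrightarrow> (\<Sum>x\<in>A. f x) \<in> K"
  by (induction A rule: infinite_finite_induct) (auto simp: complex_subfieldD complex_subfield_add)

lemma complex_subfield_power: "complex_subfield K \<Longrightarrow> x \<in> K \<Longrightarrow> x ^ n \<in> K"
  by (induction n) (auto simp: complex_subfieldD)

lemma complex_subfield_Inter: "(\<And>K. K \<in> S \<Longrightarrow> complex_subfield K) \<Longrightarrow> complex_subfield (\<Inter> S)"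
  unfolding complex_subfield_def by blast

text \<open>Abstracts the coefficient field. It is used for the cyclotomic field, where rationality
  is claimed, and for all complex numbers, where only the existence of an expansion at a cusp
  matters.\<close>

definition root_field :: "nat \<Rightarrow> complex set \<Rightarrow> bool" where
  "root_field N K \<longleftrightarrow> complex_subfield K \<and> (\<forall>x. real N * x \<in> \<int> \<longrightarrow> e2pi (of_real x) \<in> K)"

lemma root_field_UNIV: "root_field N UNIV"
  by (simp add: root_field_def complex_subfield_def)

lemma root_field_cyclotomic:
  assumes N: "N > 0"
  shows "root_field N (cyclotomic_field N)"
  unfolding root_field_def
proof (intro conjI allI impI)
  show K: "complex_subfield (cyclotomic_field N)"
    unfolding cyclotomic_field_def by (rule complex_subfield_Inter) auto
  have z: "e2pi (1 / of_nat N) \<in> cyclotomic_field N" by (auto simp: cyclotomic_field_def)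
  fix x assume "real N * x \<in> \<int>"
  then obtain m where m: "real N * x = of_int m" by (elim Ints_cases)
  show "e2pi (of_real x) \<in> cyclotomic_field N"
  proof (cases "m \<ge> 0")
    case True
    then obtain n where "m = int n" by (elim nonneg_int_cases)
    then have "x = real n / real N" using m N by (simp add: field_simps)
    then have "e2pi (of_real x) = e2pi (1 / of_nat N) ^ n" by (simp add: e2pi_power)
    then show ?thesis using complex_subfield_power[OF K z] by simp
  next
    case False
    then obtain n where "m = - int n" by (metis int_cases2 nonneg_int_cases linear of_nat_0_le_iff)
    then have "x = - (real n / real N)" using m N by (simp add: field_simps)
    then have "e2pi (of_real x) = inverse (e2pi (1 / of_nat N) ^ n)" by (simp add: e2pi_power e2pi_minus)
    then show ?thesis using complex_subfieldD(5)[OF K complex_subfield_power[OF K z]] by simp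
  qed
qed

section \<open>Algebra of Fourier expansions\<close>

definition fexp :: "nat \<Rightarrow> real ^ 'g ^ 'g \<Rightarrow> complex ^ 'g ^ 'g \<Rightarrow> complex" where
  "fexp M \<beta> Z = e2pi (trace (map_mat complex_of_real \<beta> ** Z) / of_nat M)"

lemma trace_mult: "trace (map_mat complex_of_real \<beta> ** Z) = (\<Sum>i\<in>UNIV. \<Sum>j\<in>UNIV. of_real (\<beta> $ i $ j) * Z $ j $ i)"
  by (simp add: trace_def matrix_matrix_mult_def map_mat_def)

lemma fexp_add: "fexp M (\<beta> + \<beta>') Z = fexp M \<beta> Z * fexp M \<beta>' Z"
  unfolding fexp_def trace_mult by (simp add: distrib_right sum.distrib add_divide_distrib e2pi_add)

lemma fexp_0: "fexp M 0 Z = 1"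
  unfolding fexp_def trace_mult by simp

definition fourier_over :: "complex set \<Rightarrow> nat \<Rightarrow> (complex ^ 'g ^ 'g \<Rightarrow> complex) \<Rightarrow> bool" where
  "fourier_over K M f \<longleftrightarrow> (\<exists>c. has_fourier_expansion M f c \<and> (\<forall>\<beta>\<in>fourier_index. c \<beta> \<in> K))"

text \<open>Groups a series indexed by an arbitrary set according to its exponents. Finite fibres
  make each coefficient a finite sum, hence an element of \<open>K\<close>.\<close>

lemma fourier_overI:
  assumes p: "\<And>a. a \<in> A \<Longrightarrow> p a \<in> fourier_index" and fin: "\<And>\<beta>. \<beta> \<in> fourier_index \<Longrightarrow> finite {a \<in> A. p a = \<beta>}"
    and hs: "\<And>Z. Z \<in> siegel_space \<Longrightarrow> ((\<lambda>a. c a * fexp M (p a) Z) has_sum f Z) A"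
    and K: "complex_subfield K" "\<And>a. a \<in> A \<Longrightarrow> c a \<in> K"
  shows "fourier_over K M f"
  unfolding fourier_over_def has_fourier_expansion_def fexp_def[symmetric]
proof (intro exI[of _ "\<lambda>\<beta>. \<Sum>a\<in>{a \<in> A. p a = \<beta>}. c a"] conjI ballI)
  show "(\<Sum>a\<in>{a \<in> A. p a = \<beta>}. c a) \<in> K" for \<beta>
    using K by (intro complex_subfield_sum) auto
  fix Z :: "complex ^ 'b ^ 'b" assume Z: "Z \<in> siegel_space"
  have bij: "bij_betw snd (SIGMA \<beta>:fourier_index. {a \<in> A. p a = \<beta>}) A"
    by (rule bij_betwI[where g = "\<lambda>a. (p a, a)"]) (use p in auto)
  have "((\<lambda>x. c (snd x) * fexp M (p (snd x)) Z) has_sum f Z) (SIGMA \<beta>:fourier_index. {a \<in> A. p a = \<beta>})"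
    by (subst has_sum_reindex_bij_betw[OF bij]) (rule hs[OF Z])
  then show "((\<lambda>\<beta>. (\<Sum>a\<in>{a \<in> A. p a = \<beta>}. c a) * fexp M \<beta> Z) has_sum f Z) fourier_index"
  proof (rule has_sum_SigmaD)
    fix \<beta> :: "real ^ 'b ^ 'b" assume "\<beta> \<in> fourier_index"
    have "(\<Sum>a\<in>{a \<in> A. p a = \<beta>}. c a) * fexp M \<beta> Z = (\<Sum>a\<in>{a \<in> A. p a = \<beta>}. c a * fexp M (p a) Z)"
      by (simp add: sum_distrib_right)
    then show "((\<lambda>a. c (snd (\<beta>, a)) * fexp M (p (snd (\<beta>, a))) Z) has_sum (\<Sum>a\<in>{a \<in> A. p a = \<beta>}. c a) * fexp M \<beta> Z) {a \<in> A. p a = \<beta>}"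
      by (intro has_sum_finiteI fin \<open>\<beta> \<in> fourier_index\<close>) simp
  qed
qed

lemma has_sum_times_complex:
  fixes f :: "'a \<Rightarrow> complex" and g :: "'b \<Rightarrow> complex"
  assumes f: "(f has_sum a) A" and g: "(g has_sum b) B"
  shows "((\<lambda>x. f (fst x) * g (snd x)) has_sum (a * b)) (A \<times> B)"
proof (rule has_sum_SigmaI)
  show "((\<lambda>y. f (fst (x, y)) * g (snd (x, y))) has_sum f x * b) B" for x
    using has_sum_cmult_right[OF g, of "f x"] by simp
  show "((\<lambda>x. f x * b) has_sum a * b) A" by (rule has_sum_cmult_left[OF f])
  have fa: "(\<lambda>x. norm (f x)) summable_on A" and ga: "(\<lambda>x. norm (g x)) summable_on B"
    using f g has_sum_imp_summable summable_on_iff_abs_summable_on_complex by blast+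
  have "Infinite_Sum.abs_summable_on (\<lambda>x. f (fst x) * g (snd x)) (A \<times> B)"
    unfolding Infinite_Sum.abs_summable_on_Sigma_iff
  proof (intro conjI ballI)
    show "(\<lambda>y. norm (f (fst (x, y)) * g (snd (x, y)))) summable_on B" for x
      using summable_on_cmult_right[OF ga, of "norm (f x)"] by (simp add: norm_mult)
    have "(\<Sum>\<^sub>\<infinity>y\<in>B. norm (f (fst (x, y)) * g (snd (x, y)))) = norm (f x) * (\<Sum>\<^sub>\<infinity>y\<in>B. norm (g y))" for x
      by (simp add: norm_mult infsum_cmult_right')
    then show "(\<lambda>x. norm (\<Sum>\<^sub>\<infinity>y\<in>B. norm (f (fst (x, y)) * g (snd (x, y))))) summable_on A"
      using summable_on_cmult_left[OF fa, of "\<Sum>\<^sub>\<infinity>y\<in>B. norm (g y)"] by (simp add: infsum_nonneg abs_mult)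
  qed
  then show "(\<lambda>x. f (fst x) * g (snd x)) summable_on A \<times> B"
    by (rule abs_summable_summable)
qed

text \<open>Semi-definiteness tested on \<open>axis i 1\<close> and on \<open>axis i 1\<close> plus
  or minus \<open>axis j 1\<close>.\<close>

lemma psd_entries:
  fixes \<beta> :: "real ^ 'g ^ 'g"
  assumes "\<beta> \<in> fourier_index"
  shows "\<beta> $ i $ i \<ge> 0" "2 * \<bar>\<beta> $ i $ j\<bar> \<le> \<beta> $ i $ i + \<beta> $ j $ j"
proof -
  have ax: "axis a (1::real) \<bullet> (\<beta> *v axis b 1) = \<beta> $ a $ b" for a b
    by (simp add: inner_axis' matrix_vector_mult_basis column_def)
  have psd: "x \<bullet> (\<beta> *v x) \<ge> 0" for x using assms by (simp add: fourier_index_def)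
  have sym: "\<beta> $ j $ i = \<beta> $ i $ j" using assms by (auto simp: fourier_index_def transpose_def vec_eq_iff)
  show "\<beta> $ i $ i \<ge> 0" using psd[of "axis i 1"] by (simp only: ax)
  have "0 \<le> \<beta> $ i $ i + \<beta> $ j $ j + 2 * \<beta> $ i $ j"
    using psd[of "axis i 1 + axis j 1"]
    by (simp add: matrix_vector_right_distrib inner_add_left inner_add_right ax sym)
  moreover have "0 \<le> \<beta> $ i $ i + \<beta> $ j $ j - 2 * \<beta> $ i $ j"
    using psd[of "axis i 1 - axis j 1"]
    by (simp add: matrix_vector_mult_diff_distrib inner_diff_left inner_diff_right ax sym)
  ultimately show "2 * \<bar>\<beta> $ i $ j\<bar> \<le> \<beta> $ i $ i + \<beta> $ j $ j" by linarith
qed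

lemma zero_in_fourier_index: "0 \<in> fourier_index"
  by (simp add: fourier_index_def transpose_def vec_eq_iff matrix_vector_mult_def inner_vec_def)

lemma add_in_fourier_index:
  assumes "\<beta> \<in> fourier_index" "\<beta>' \<in> fourier_index"
  shows "\<beta> + \<beta>' \<in> fourier_index"
  using assms unfolding fourier_index_def
  by (auto simp: transpose_def vec_eq_iff matrix_vector_mult_add_rdistrib inner_add_right distrib_left)

text \<open>The diagonal of a summand is bounded by that of \<beta>, and its diagonal bounds its
  other entries; being half integers, they have finitely many values. Coefficients of products are
  therefore finite sums.\<close>

lemma finite_fourier_splittings:
  fixes \<beta> :: "real ^ 'g ^ 'g"
  shows "finite {x \<in> fourier_index \<times> fourier_index. fst x + snd x = \<beta>}"
proof -
  define B where "B = (\<Sum>i\<in>UNIV. \<bar>\<beta> $ i $ i\<bar>)"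
  define S where "S = (\<lambda>m::int. of_int m / 2 :: real) ` {- \<lceil>2 * B\<rceil>..\<lceil>2 * B\<rceil>}"
  have fin: "finite {\<gamma> :: real ^ 'g ^ 'g. \<forall>i. \<gamma> $ i \<in> {v. \<forall>j. v $ j \<in> S}}"
    by (intro finite_vec_Pi) (simp add: S_def)
  have sub: "\<gamma> \<in> {\<gamma>. \<forall>i. \<gamma> $ i \<in> {v. \<forall>j. v $ j \<in> S}}"
    if g: "\<gamma> \<in> fourier_index" "\<gamma>' \<in> fourier_index" "\<gamma> + \<gamma>' = \<beta>" for \<gamma> \<gamma>'
  proof -
    have d: "\<gamma> $ i $ i \<le> B" for i
    proof -
      have "\<gamma> $ i $ i \<le> \<beta> $ i $ i" using psd_entries(1)[OF g(2), of i] unfolding g(3)[symmetric] by simp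
      also have "\<dots> \<le> \<bar>\<beta> $ i $ i\<bar>" by simp
      also have "\<dots> \<le> B" unfolding B_def by (rule member_le_sum) auto
      finally show ?thesis .
    qed
    have "\<gamma> $ i $ j \<in> S" for i j
    proof -
      have "2 * \<gamma> $ i $ j \<in> \<int>" using g(1) by (simp add: fourier_index_def)
      then obtain m where m: "2 * \<gamma> $ i $ j = of_int m" by (elim Ints_cases)
      have "\<bar>real_of_int m\<bar> \<le> 2 * B" using psd_entries(2)[OF g(1), of i j] d[of i] d[of j] m by linarith
      then have "m \<in> {- \<lceil>2 * B\<rceil>..\<lceil>2 * B\<rceil>}" by (auto simp: le_ceiling_iff) linarith+
      moreover have "\<gamma> $ i $ j = of_int m / 2" using m by simp
      ultimately show ?thesis unfolding S_def by blast
    qed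
    then show ?thesis by simp
  qed
  show ?thesis
  proof (rule finite_subset)
    show "{x \<in> fourier_index \<times> fourier_index. fst x + snd x = \<beta>} \<subseteq> (\<lambda>\<gamma>. (\<gamma>, \<beta> - \<gamma>)) ` {\<gamma>. \<forall>i. \<gamma> $ i \<in> {v. \<forall>j. v $ j \<in> S}}"
      using sub by (fastforce simp: image_iff)
  qed (rule finite_imageI[OF fin])
qed

lemma fourier_over_mult:
  assumes K: "complex_subfield K" and "fourier_over K M f" "fourier_over K M g"
  shows "fourier_over K M (\<lambda>Z. f Z * g Z)"
proof -
  obtain c d where c: "has_fourier_expansion M f c" "\<And>\<beta>. \<beta> \<in> fourier_index \<Longrightarrow> c \<beta> \<in> K"
    and d: "has_fourier_expansion M g d" "\<And>\<beta>. \<beta> \<in> fourier_index \<Longrightarrow> d \<beta> \<in> K"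
    using assms by (auto simp: fourier_over_def)
  show ?thesis
  proof (rule fourier_overI[of "fourier_index \<times> fourier_index" "\<lambda>x. fst x + snd x" "\<lambda>x. c (fst x) * d (snd x)"])
    fix Z :: "complex ^ 'a ^ 'a" assume Z: "Z \<in> siegel_space"
    have "((\<lambda>\<beta>. c \<beta> * fexp M \<beta> Z) has_sum f Z) fourier_index" "((\<lambda>\<beta>. d \<beta> * fexp M \<beta> Z) has_sum g Z) fourier_index"
      using c(1) d(1) Z by (auto simp: has_fourier_expansion_def fexp_def)
    from has_sum_times_complex[OF this]
    show "((\<lambda>x. c (fst x) * d (snd x) * fexp M (fst x + snd x) Z) has_sum f Z * g Z) (fourier_index \<times> fourier_index)"
      by (simp add: fexp_add mult_ac)
  qed (use K c d finite_fourier_splittings in \<open>auto intro: add_in_fourier_index complex_subfieldD(4)\<close>)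
qed

lemma fourier_over_const:
  assumes K: "complex_subfield K" "c \<in> K"
  shows "fourier_over K M (\<lambda>Z. c)"
  by (rule fourier_overI[of "{0}" "\<lambda>x. x" "\<lambda>_. c"])
     (use K zero_in_fourier_index in \<open>auto simp: fexp_0 intro!: has_sum_finiteI\<close>)

lemma fourier_over_power:
  assumes K: "complex_subfield K" and "fourier_over K M f"
  shows "fourier_over K M (\<lambda>Z. f Z ^ n)"
proof (induction n)
  case 0 show ?case using fourier_over_const[OF K complex_subfieldD(2)[OF K]] by simp
next
  case (Suc n) then show ?case using fourier_over_mult[OF K assms(2) Suc] by simp
qed

lemma fourier_over_prod:
  assumes K: "complex_subfield K" and f: "\<And>x. x \<in> A \<Longrightarrow> fourier_over K M (f x)"
  shows "fourier_over K M (\<lambda>Z. \<Prod>x\<in>A. f x Z)"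
  using f
proof (induction A rule: infinite_finite_induct)
  case (insert x A)
  then show ?case using fourier_over_mult[OF K, of M "f x" "\<lambda>Z. \<Prod>x\<in>A. f x Z"] by simp
qed (use fourier_over_const[OF K complex_subfieldD(2)[OF K]] in simp_all)

text \<open>Normalised so that the coefficient attached to the lattice vector \<open>n\<close> is
  \<open>e2pi (ivec n \<bullet> hi v)\<close>, without a contribution from
  \<open>lo v\<close>.\<close>

definition theta0 :: "real ^ ('g::finite + 'g) \<Rightarrow> complex ^ 'g ^ 'g \<Rightarrow> complex" where
  "theta0 v Z = e2pi (- of_real (lo v \<bullet> hi v)) * theta (lo v) (hi v) Z"

lemma finite_square_fibre: "finite {m::int. (of_int m + r)\<^sup>2 = (q::real)}"
proof (rule finite_subset)
  show "{m::int. (of_int m + r)\<^sup>2 = q} \<subseteq> {\<lfloor>sqrt q - r\<rfloor>, \<lfloor>- sqrt q - r\<rfloor>}"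
  proof
    fix m :: int assume "m \<in> {m. (of_int m + r)\<^sup>2 = q}"
    then have "q = (of_int m + r)\<^sup>2" by simp
    then have "sqrt q = \<bar>of_int m + r\<bar>" by simp
    then have "of_int m = sqrt q - r \<or> of_int m = - sqrt q - r" by linarith
    then show "m \<in> {\<lfloor>sqrt q - r\<rfloor>, \<lfloor>- sqrt q - r\<rfloor>}" by (metis floor_of_int insertCI)
  qed
qed simp

text \<open>With \<open>x = ivec n + lo v\<close> the vector \<open>2 * N * x\<close> is integral,
  so its rank-one square is an admissible exponent. Half of \<open>qf x Z\<close> is the trace of
  that square times \<open>Z\<close>, divided by \<open>8 * N^2\<close>, which explains the
  level.\<close>

lemma fourier_over_theta0:
  fixes v :: "real ^ ('g::finite + 'g)"
  assumes N: "N > 0" and v: "v \<in> torsion (2 * real N)" and K: "complex_subfield K"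
    and r: "\<And>n. e2pi (of_real (ivec n \<bullet> hi v)) \<in> K"
  shows "fourier_over K (8 * N\<^sup>2) (theta0 v)"
proof (rule fourier_overI[of UNIV "\<lambda>n. \<chi> i j. (2 * real N * (ivec n + lo v) $ i) * (2 * real N * (ivec n + lo v) $ j)" "\<lambda>n. e2pi (of_real (ivec n \<bullet> hi v))"])
  fix n :: "int ^ 'g"
  let ?x = "\<lambda>i. 2 * real N * (ivec n + lo v) $ i"
  have xi: "?x i \<in> \<int>" for i
  proof -
    have v1: "2 * real N * v $ Inl i \<in> \<int>" using v by (simp add: torsion_def)
    have "2 * real N * of_int (n $ i) + 2 * real N * v $ Inl i \<in> \<int>" by (intro Ints_add[OF _ v1] Ints_mult) auto
    then show ?thesis by (simp add: ivec_def distrib_left)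
  qed
  show "(\<chi> i j. ?x i * ?x j) \<in> fourier_index"
    unfolding fourier_index_def
  proof (intro CollectI conjI allI)
    show "transpose (\<chi> i j. ?x i * ?x j) = (\<chi> i j. ?x i * ?x j)"
      by (simp add: transpose_def vec_eq_iff mult.commute)
    show "2 * (\<chi> i j. ?x i * ?x j) $ i $ j \<in> \<int>" for i j
      using Ints_mult[OF _ Ints_mult[OF xi[of i] xi[of j]], of 2] by simp
    show "(\<chi> i j. ?x i * ?x j) $ i $ i \<in> \<int>" for i
      using Ints_mult[OF xi[of i] xi[of i]] by simp
    fix y :: "real ^ 'g"
    have psd: "y \<bullet> ((\<chi> i j. t i * t j) *v y) = (\<Sum>i\<in>UNIV. y $ i * t i)\<^sup>2" for t :: "'g \<Rightarrow> real"
      by (simp add: inner_vec_def matrix_vector_mult_def power2_eq_square sum_product sum_distrib_left mult_ac)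
    show "0 \<le> y \<bullet> ((\<chi> i j. ?x i * ?x j) *v y)" unfolding psd[of ?x] by simp
  qed
  show "e2pi (of_real (ivec n \<bullet> hi v)) \<in> K" by (rule r)
next
  fix \<beta> :: "real ^ 'g ^ 'g"
  show "finite {n \<in> UNIV. (\<chi> i j. (2 * real N * (ivec n + lo v) $ i) * (2 * real N * (ivec n + lo v) $ j)) = \<beta>}"
  proof (rule finite_subset)
    \<comment> \<open>The diagonal of \<beta> fixes the square of each coordinate, leaving at most
      two integers per coordinate.\<close>
    show "{n \<in> UNIV. (\<chi> i j. (2 * real N * (ivec n + lo v) $ i) * (2 * real N * (ivec n + lo v) $ j)) = \<beta>}
      \<subseteq> {n. \<forall>i. n $ i \<in> {m. (of_int m + v $ Inl i)\<^sup>2 = \<beta> $ i $ i / (4 * (real N)\<^sup>2)}}"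
      using N by (auto simp: ivec_def power2_eq_square)
    show "finite {n :: int ^ 'g. \<forall>i. n $ i \<in> {m. (of_int m + v $ Inl i)\<^sup>2 = \<beta> $ i $ i / (4 * (real N)\<^sup>2)}}"
      by (intro finite_vec_Pi finite_square_fibre)
  qed
next
  fix Z :: "complex ^ 'g ^ 'g" assume Z: "Z \<in> siegel_space"
  have fe: "fexp (8 * N\<^sup>2) (\<chi> i j. (2 * real N * x $ i) * (2 * real N * x $ j)) Z = e2pi (qf x Z / 2)" for x
  proof -
    have "trace (map_mat complex_of_real (\<chi> i j. (2 * real N * x $ i) * (2 * real N * x $ j)) ** Z) = 4 * (of_nat N)\<^sup>2 * qf x Z"
      unfolding trace_mult qf_def sum_distrib_left
      by (intro sum.cong refl) (simp add: siegel_space_sym[OF Z] power2_eq_square)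
    then show ?thesis using N by (simp add: fexp_def)
  qed
  have t: "e2pi (- of_real (lo v \<bullet> hi v)) * theta_term (lo v) (hi v) Z n = e2pi (of_real (ivec n \<bullet> hi v)) * e2pi (qf (ivec n + lo v) Z / 2)" for n
    by (simp add: theta_term_def inner_add_left add_ac flip: e2pi_add)
  show "((\<lambda>n. e2pi (of_real (ivec n \<bullet> hi v)) * fexp (8 * N\<^sup>2) (\<chi> i j. (2 * real N * (ivec n + lo v) $ i) * (2 * real N * (ivec n + lo v) $ j)) Z) has_sum theta0 v Z) UNIV"
    unfolding fe t[symmetric] theta0_def by (intro has_sum_cmult_right theta_has_sum Z)
qed (rule K)

text \<open>The half-integral part of the characteristic contributes a sign to each coefficient and
  the part from \<open>w\<close> an \<open>N\<close>th root of unity.\<close>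

lemma fourier_over_theta0_parity_class:
  assumes N: "N > 0" and K: "root_field N K" and h: "h \<in> parity_class \<sigma>" and w: "w \<in> torsion (real N)"
  shows "fourier_over K (8 * N\<^sup>2) (theta0 (h - w))"
proof (rule fourier_over_theta0[OF N])
  have h2: "h \<in> torsion 2" using h halves_torsion by (auto simp: parity_class_def)
  show "h - w \<in> torsion (2 * real N)" by (rule parity_class_torsion[OF h2 w])
  show K': "complex_subfield K" using K by (simp add: root_field_def)
  fix n
  have "2 * (ivec n \<bullet> hi h) \<in> \<int>" 
  proof -
    have "ivec n \<bullet> (2 *\<^sub>R hi h) \<in> \<int>" using h2 by (intro Ints_inner) (auto simp: ivec_def torsion_def intro: Ints_mult)
    then show ?thesis by simp
  qed
  then have "e2pi (of_real (2 * (ivec n \<bullet> hi h))) = 1" by (rule e2pi_of_real_Ints)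
  then have "e2pi (of_real (ivec n \<bullet> hi h)) ^ 2 = 1" by (simp add: e2pi_power)
  then have "e2pi (of_real (ivec n \<bullet> hi h)) = 1 \<or> e2pi (of_real (ivec n \<bullet> hi h)) = 0 - 1" by (simp add: power2_eq_1_iff)
  then have 1: "e2pi (of_real (ivec n \<bullet> hi h)) \<in> K" using complex_subfieldD[OF K'] by metis
  have "ivec n \<bullet> (real N *\<^sub>R hi w) \<in> \<int>" using w by (intro Ints_inner) (auto simp: ivec_def torsion_def intro: Ints_mult)
  then have "real N * - (ivec n \<bullet> hi w) \<in> \<int>" using Ints_minus by fastforce
  then have 2: "e2pi (of_real (- (ivec n \<bullet> hi w))) \<in> K" using K unfolding root_field_def by blast
  have "hi (h - w) = hi h - hi w" by (simp add: vec_eq_iff)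
  then have "e2pi (of_real (ivec n \<bullet> hi (h - w))) = e2pi (of_real (ivec n \<bullet> hi h)) * e2pi (of_real (- (ivec n \<bullet> hi w)))"
    by (simp add: inner_diff_right flip: e2pi_add)
  then show "e2pi (of_real (ivec n \<bullet> hi (h - w))) \<in> K" using complex_subfieldD(4)[OF K' 1 2] by simp
qed

lemma theta_eq_theta0: "theta (lo v) (hi v) Z = e2pi (of_real (lo v \<bullet> hi v)) * theta0 v Z"
  by (simp add: theta0_def e2pi_minus)

lemma phi_eq_theta0: "phi v Z = e2pi (of_real (lo v \<bullet> hi v) / 2) * theta0 v Z"
  unfolding phi_def theta_eq_theta0 by (simp add: mult.assoc[symmetric] flip: e2pi_add)

lemma fourier_over_Qphi:
  assumes "N > 0" "w \<in> torsion (real N)"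
  shows "fourier_over UNIV (8 * N\<^sup>2) (phi_prod_power \<sigma> N w)"
proof -
  have K: "complex_subfield UNIV" by (simp add: complex_subfield_def)
  show ?thesis
    unfolding phi_prod_power_def[abs_def] phi_prod_def[abs_def] phi_eq_theta0
    by (intro fourier_over_power fourier_over_prod fourier_over_mult fourier_over_const K UNIV_I
        fourier_over_theta0_parity_class root_field_UNIV assms)
qed

text \<open>Powers divisible by \<open>4 N\<close> turn the phase \<open>e(v'\<^sup>T v'')\<close> of the constant term into an \<open>N\<close>th root of unity.\<close>

lemma fourier_over_theta_power:
  assumes N: "N > 0" and K: "root_field N K" and h: "h \<in> parity_class \<sigma>" and w: "w \<in> torsion (real N)"
  shows "fourier_over K (8 * N\<^sup>2) (\<lambda>Z. theta (lo (h - w)) (hi (h - w)) Z ^ (4 * N * m))"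
proof -
  let ?v = "h - w"
  have K': "complex_subfield K" using K by (simp add: root_field_def)
  have h2: "h \<in> torsion 2" using h halves_torsion by (auto simp: parity_class_def)
  have v: "2 * real N * ?v $ p \<in> \<int>" for p using parity_class_torsion[OF h2 w] by (simp add: torsion_def del: vector_minus_component)
  have "((2 * real N) *\<^sub>R lo ?v) \<bullet> ((2 * real N) *\<^sub>R hi ?v) \<in> \<int>"
    by (rule Ints_inner) (simp only: vector_scaleR_component lo_nth hi_nth real_scaleR_def Ints_mult[OF v v])
  then have "of_nat m * (((2 * real N) *\<^sub>R lo ?v) \<bullet> ((2 * real N) *\<^sub>R hi ?v)) \<in> \<int>" by (intro Ints_mult Ints_of_nat)
  moreover have "of_nat m * (((2 * real N) *\<^sub>R lo ?v) \<bullet> ((2 * real N) *\<^sub>R hi ?v)) = real N * (real (4 * N * m) * (lo ?v \<bullet> hi ?v))"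
    by (simp add: mult_ac)
  ultimately have "real N * (real (4 * N * m) * (lo ?v \<bullet> hi ?v)) \<in> \<int>" by metis
  then have "e2pi (of_real (real (4 * N * m) * (lo ?v \<bullet> hi ?v))) \<in> K" using K unfolding root_field_def by blast
  then have c: "e2pi (of_real (lo ?v \<bullet> hi ?v)) ^ (4 * N * m) \<in> K" by (simp add: e2pi_power)
  show ?thesis
    unfolding theta_eq_theta0 power_mult_distrib
    by (intro fourier_over_mult[OF K'] fourier_over_const[OF K' c] fourier_over_power[OF K'] fourier_over_theta0_parity_class[OF N K h w])
qed


section \<open>Holomorphy and non-vanishing\<close>

lemma siegel_holomorphic_const: "siegel_holomorphic (\<lambda>Z. c)"
  unfolding siegel_holomorphic_def
  by (intro ballI exI[of _ "\<lambda>_. 0"] conjI allI) simp_all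

lemma siegel_holomorphic_mult:
  assumes "siegel_holomorphic f" "siegel_holomorphic g"
  shows "siegel_holomorphic (\<lambda>Z. f Z * g Z)"
  unfolding siegel_holomorphic_def
proof
  fix Z :: "complex ^ 'a ^ 'a" assume Z: "Z \<in> siegel_space"
  obtain D where D: "(f has_derivative D) (at Z within siegel_space)" "\<And>c X. D (map_mat (\<lambda>x. c * x) X) = c * D X"
    using assms(1) Z unfolding siegel_holomorphic_def by blast
  obtain E where E: "(g has_derivative E) (at Z within siegel_space)" "\<And>c X. E (map_mat (\<lambda>x. c * x) X) = c * E X"
    using assms(2) Z unfolding siegel_holomorphic_def by blast
  show "\<exists>D. ((\<lambda>Z. f Z * g Z) has_derivative D) (at Z within siegel_space) \<and> (\<forall>c X. D (map_mat (\<lambda>x. c * x) X) = c * D X)"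
    by (rule exI conjI has_derivative_mult[OF D(1) E(1)])+ (simp add: D(2) E(2) algebra_simps)
qed

lemma siegel_holomorphic_power:
  "siegel_holomorphic f \<Longrightarrow> siegel_holomorphic (\<lambda>Z. f Z ^ n)"
  by (induction n) (auto intro: siegel_holomorphic_const siegel_holomorphic_mult)

lemma siegel_holomorphic_prod:
  "(\<And>x. x \<in> A \<Longrightarrow> siegel_holomorphic (f x)) \<Longrightarrow> siegel_holomorphic (\<lambda>Z. \<Prod>x\<in>A. f x Z)"
  by (induction A rule: infinite_finite_induct) (auto intro: siegel_holomorphic_const siegel_holomorphic_mult)

lemma qf_zline: "qf x (zline Z X t) = qf x Z + t * qf x X"
  by (simp add: zline_def qf_add qf_map_mat)

text \<open>The perturbation of the form is at most \<open>norm (t - t0) * K\<close> times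
  \<open>(norm x)^2\<close>, which stays below the coercivity bound at \<open>t0\<close>.\<close>

lemma siegel_space_zline_open:
  fixes Z X :: "complex ^ 'g ^ 'g"
  assumes sX: "\<And>i j. X $ i $ j = X $ j $ i"
  shows "open {t. zline Z X t \<in> siegel_space}"
  unfolding open_dist
proof (intro ballI)
  fix t0 assume "t0 \<in> {t. zline Z X t \<in> siegel_space}"
  then have t0: "zline Z X t0 \<in> siegel_space" by simp
  obtain c where c: "c > 0" "\<And>x. Im (qf x (zline Z X t0)) \<ge> c * (norm x)\<^sup>2"
    using siegel_space_coercive[OF t0] by blast
  define K where "K = real CARD('g) ^ 2 * norm X"
  have K: "K \<ge> 0" by (simp add: K_def)
  show "\<exists>e>0. \<forall>t. dist t t0 < e \<longrightarrow> t \<in> {t. zline Z X t \<in> siegel_space}"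
  proof (intro exI[of _ "c / (K + 1)"] conjI allI impI)
    show "0 < c / (K + 1)" using c K by simp
    fix t assume t: "dist t t0 < c / (K + 1)"
    have tK: "norm (t - t0) * K < c"
    proof -
      have "norm (t - t0) * (K + 1) < c" using t K by (simp add: dist_norm pos_less_divide_eq)
      moreover have "norm (t - t0) * K \<le> norm (t - t0) * (K + 1)" by (intro mult_left_mono) auto
      ultimately show ?thesis by linarith
    qed
    have "zline Z X t $ i $ j = zline Z X t $ j $ i" for i j
    proof -
      have "zline Z X t $ a $ b = zline Z X t0 $ a $ b + (t - t0) * X $ a $ b" for a b
        by (simp add: zline_def map_mat_def algebra_simps)
      then show ?thesis using siegel_space_sym[OF t0, of i j] sX[of i j] by simp
    qed
    moreover have "Im (qf x (zline Z X t)) > 0" if x: "x \<noteq> 0" for x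
    proof -
      have "qf x (zline Z X t) = qf x (zline Z X t0) + (t - t0) * qf x X"
        unfolding qf_zline by (simp add: algebra_simps)
      moreover have "\<bar>Im ((t - t0) * qf x X)\<bar> \<le> norm (t - t0) * norm (qf x X)"
        by (metis abs_Im_le_cmod norm_mult)
      moreover have "norm (t - t0) * norm (qf x X) \<le> norm (t - t0) * (K * (norm x)\<^sup>2)"
        using norm_qf_le[of x X] by (intro mult_left_mono) (auto simp: K_def)
      moreover have "norm (t - t0) * (K * (norm x)\<^sup>2) < c * (norm x)\<^sup>2"
        using tK x by (simp add: mult.assoc[symmetric])
      ultimately show ?thesis using c(2)[of x] by (simp only: plus_complex.sel)
    qed
    ultimately show "t \<in> {t. zline Z X t \<in> siegel_space}" by (simp add: siegel_space_iff)
  qed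
qed

lemma siegel_space_zline_convex:
  fixes Z X :: "complex ^ 'g ^ 'g"
  shows "convex {t. zline Z X t \<in> siegel_space}"
proof (rule convexI)
  fix s t and u v :: real
  assume st: "s \<in> {t. zline Z X t \<in> siegel_space}" "t \<in> {t. zline Z X t \<in> siegel_space}" and uv: "0 \<le> u" "0 \<le> v" "u + v = 1"
  have v: "v = 1 - u" using uv by simp
  have eq: "zline Z X (u *\<^sub>R s + v *\<^sub>R t) $ a $ b = of_real u * zline Z X s $ a $ b + of_real v * zline Z X t $ a $ b" for a b
    unfolding v by (simp add: zline_def map_mat_def scaleR_conv_of_real algebra_simps)
  have q: "qf x (zline Z X (u *\<^sub>R s + v *\<^sub>R t)) = of_real u * qf x (zline Z X s) + of_real v * qf x (zline Z X t)" for x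
    unfolding v qf_zline by (simp add: scaleR_conv_of_real algebra_simps)
  have "Im (qf x (zline Z X (u *\<^sub>R s + v *\<^sub>R t))) > 0" if x: "x \<noteq> 0" for x
  proof -
    have p: "Im (qf x (zline Z X s)) > 0" "Im (qf x (zline Z X t)) > 0" using st x by (auto simp: siegel_space_iff)
    have "u > 0 \<or> v > 0" using uv by linarith
    then have "u * Im (qf x (zline Z X s)) + v * Im (qf x (zline Z X t)) > 0"
      using p uv by (auto intro: add_pos_nonneg add_nonneg_pos)
    then show ?thesis unfolding q by simp
  qed
  moreover have "zline Z X (u *\<^sub>R s + v *\<^sub>R t) $ i $ j = zline Z X (u *\<^sub>R s + v *\<^sub>R t) $ j $ i" for i j
    unfolding eq using st siegel_space_sym[of "zline Z X s" i j] siegel_space_sym[of "zline Z X t" i j] by simp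
  ultimately show "u *\<^sub>R s + v *\<^sub>R t \<in> {t. zline Z X t \<in> siegel_space}" by (simp add: siegel_space_iff)
qed

text \<open>On the complex line through the two points, the first function is nonzero near
  \<open>t = 0\<close>. If the product vanished, the second would vanish on a nonempty open set,
  hence on the whole convex domain, including \<open>t = 1\<close>.\<close>

lemma siegel_nonzero_mult:
  fixes f g :: "complex ^ 'g ^ 'g \<Rightarrow> complex"
  assumes f: "siegel_holomorphic f" "Z1 \<in> siegel_space" "f Z1 \<noteq> 0"
    and g: "siegel_holomorphic g" "Z2 \<in> siegel_space" "g Z2 \<noteq> 0"
  shows "\<exists>Z\<in>siegel_space. f Z * g Z \<noteq> 0"
proof (rule ccontr)
  assume "\<not> ?thesis"
  then have z: "\<And>Z. Z \<in> siegel_space \<Longrightarrow> f Z = 0 \<or> g Z = 0" by auto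
  define X where "X = Z2 - Z1"
  have sX: "X $ i $ j = X $ j $ i" for i j using siegel_space_sym[OF f(2), of i j] siegel_space_sym[OF g(2), of i j] by (simp add: X_def)
  define T where "T = {t. zline Z1 X t \<in> siegel_space}"
  have T: "open T" "connected T"
    unfolding T_def using siegel_space_zline_open[of X, OF sX] siegel_space_zline_convex convex_connected by blast+
  have z01: "zline Z1 X 0 = Z1" "zline Z1 X 1 = Z2" by (simp_all add: zline_def map_mat_def vec_eq_iff X_def)
  have hf: "(\<lambda>t. f (zline Z1 X t)) holomorphic_on T" and hg: "(\<lambda>t. g (zline Z1 X t)) holomorphic_on T"
    using siegel_holomorphic_line[OF f(1) _ T(1)] siegel_holomorphic_line[OF g(1) _ T(1)] by (auto simp: T_def)
  define U where "U = T \<inter> (\<lambda>t. f (zline Z1 X t)) -` (- {0})"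
  have U: "open U"
    unfolding U_def by (intro continuous_open_preimage holomorphic_on_imp_continuous_on[OF hf] T) auto
  have "0 \<in> U" using f by (simp add: U_def T_def z01)
  have "g (zline Z1 X 1) = 0"
  proof (rule analytic_continuation_open[of U T "\<lambda>t. g (zline Z1 X t)" "\<lambda>_. 0"])
    show "U \<noteq> {}" using \<open>0 \<in> U\<close> by auto
    show "U \<subseteq> T" by (auto simp: U_def)
    show "1 \<in> T" using g by (simp add: T_def z01)
    show "g (zline Z1 X t) = 0" if "t \<in> U" for t using z[of "zline Z1 X t"] that by (auto simp: U_def T_def)
  qed (use T U hg in auto)
  then show False using g(3) by (simp add: z01)
qed

lemma siegel_nonzero_prod:
  fixes f :: "'a \<Rightarrow> complex ^ 'g ^ 'g \<Rightarrow> complex"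
  assumes "finite A" and "\<And>x. x \<in> A \<Longrightarrow> siegel_holomorphic (f x) \<and> (\<exists>Z\<in>siegel_space. f x Z \<noteq> 0)"
    and ne: "(siegel_space :: (complex ^ 'g ^ 'g) set) \<noteq> {}"
  shows "\<exists>Z\<in>siegel_space. (\<Prod>x\<in>A. f x Z) \<noteq> 0"
  using assms(1,2)
proof (induction A rule: finite_induct)
  case empty show ?case using ne by auto
next
  case (insert x A)
  obtain Z1 where Z1: "Z1 \<in> siegel_space" "f x Z1 \<noteq> 0" using insert.prems by blast
  obtain Z2 where Z2: "Z2 \<in> siegel_space" "(\<Prod>x\<in>A. f x Z2) \<noteq> 0" using insert by blast
  have "siegel_holomorphic (\<lambda>Z. \<Prod>x\<in>A. f x Z)" using insert.prems by (intro siegel_holomorphic_prod) auto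
  then have "\<exists>Z\<in>siegel_space. f x Z * (\<Prod>x\<in>A. f x Z) \<noteq> 0"
    using siegel_nonzero_mult[of "f x" Z1 "\<lambda>Z. \<Prod>x\<in>A. f x Z" Z2] Z1 Z2 insert.prems by blast
  then show ?case using insert.hyps by simp
qed

text \<open>For an even characteristic \<open>(c, d)\<close> there is an integral symmetric matrix such that
  all terms of the theta series have the same phase at \<open>X + \<i> I\<close>: outside the support of \<open>c\<close> it is
  diagonal with entries \<open>2 d\<close>, and on the support it is a star centred at \<open>j\<close> with entries \<open>2 d\<close>.
  Evenness says that the entries of \<open>2 d\<close> on the support have even sum.\<close>

lemma even_theta_nonzero:
  fixes h :: "real ^ ('g::finite + 'g)"
  assumes h: "h \<in> parity_class 1"
  shows "\<exists>Z\<in>siegel_space. theta (lo h) (hi h) Z \<noteq> 0"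
proof -
  define c d where "c = lo h" and "d = hi h"
  have ch: "c $ i = 0 \<or> c $ i = 1/2" and dh: "d $ i = 0 \<or> d $ i = 1/2" for i
    using h by (auto simp: parity_class_def halves_def c_def d_def)
  \<comment> \<open>The centre of the star is some index in the support of \<open>c\<close>; if the
    support is empty, \<open>j\<close> is arbitrary and all \<open>u b\<close> are 0.\<close>
  define j where "j = (SOME j. (\<exists>i. c $ i = 1/2) \<longrightarrow> c $ j = 1/2)"
  have j: "c $ j = 1/2" if "c $ i = 1/2" for i
  proof -
    have "(\<exists>i. c $ i = 1/2) \<longrightarrow> c $ j = 1/2" unfolding j_def by (rule someI_ex) auto
    then show ?thesis using that by blast
  qed
  define u where "u b = (if c $ b = 1/2 \<and> b \<noteq> j then 2 * d $ b else 0)" for b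
  define \<delta> where "\<delta> b = (if c $ b = 0 then d $ b else 0)" for b
  define Z :: "complex ^ 'g ^ 'g" where "Z = (\<chi> a b. (if a = b then of_real (2 * \<delta> a) + \<i> else 0)
     + (if a = j then of_real (u b) else 0) + (if b = j then of_real (u a) else 0))"
  define ph where "ph x = (\<Sum>a\<in>UNIV. \<delta> a * (x $ a)\<^sup>2 + x $ j * u a * x $ a)" for x :: "real ^ 'g"
  have q: "qf x Z = of_real (2 * ph x) + \<i> * of_real ((norm x)\<^sup>2)" for x
  proof -
    have "qf x Z = (\<Sum>a\<in>UNIV. \<Sum>b\<in>UNIV. (if b = a then of_real (x $ a * x $ a) * (of_real (2 * \<delta> a) + \<i>) else 0)
      + (if a = j then of_real (x $ j * u b * x $ b) else 0) + (if b = j then of_real (x $ j * u a * x $ a) else 0))"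
      unfolding qf_def by (intro sum.cong refl) (auto simp: Z_def algebra_simps)
    also have "\<dots> = (\<Sum>a\<in>UNIV. of_real (x $ a * x $ a) * (of_real (2 * \<delta> a) + \<i>)) + (\<Sum>b\<in>UNIV. of_real (x $ j * u b * x $ b))
      + (\<Sum>a\<in>UNIV. of_real (x $ j * u a * x $ a))"
      by (simp add: sum.distrib sum_if_const)
    also have "\<dots> = of_real (2 * ph x) + \<i> * of_real (x \<bullet> x)"
      by (simp add: ph_def inner_vec_def sum.distrib sum_distrib_left distrib_left distrib_right power2_eq_square algebra_simps)
    finally show ?thesis by (simp add: power2_norm_eq_inner)
  qed
  have "Z \<in> siegel_space"
    unfolding siegel_space_iff q by (auto simp: Z_def)
  \<comment> \<open>The phase left over from coordinate \<open>j\<close>: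
    \<open>x $ j * d $ j - (x $ j + 1/2) * d $ j\<close>.\<close>
  define \<kappa> where "\<kappa> = (if c $ j = 1/2 then - d $ j / 2 else 0)"
  have phase: "ph x + x \<bullet> d - \<kappa> \<in> \<int>" if x: "x = ivec n + c" for x n
  proof -
    \<comment> \<open>An integer, as \<open>x $ j\<close> lies in 1/2 plus the integers. Modulo
      integers, and apart from \<kappa>, each coordinate contributes
      \<open>p * (2 * c $ a * d $ a)\<close>; evenness makes the sum of these integral.\<close>
    define p where "p = (if c $ j = 1/2 then x $ j + 1/2 else 0)"
    have xi: "x $ a - c $ a \<in> \<int>" for a by (simp add: x ivec_def)
    have p: "p \<in> \<int>"
    proof (cases "c $ j = 1/2")
      case True
      have "p = (x $ j - c $ j) + 1" using True by (simp add: p_def)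
      then show ?thesis using Ints_add[OF xi[of j] Ints_1] by (simp only:)
    qed (simp add: p_def)
    have d2: "2 * d $ a \<in> \<int>" for a
    proof -
      have "2 * d $ a = 0 \<or> 2 * d $ a = 1" using dh[of a] by auto
      then show ?thesis by (metis Ints_0 Ints_1)
    qed
    have t: "(\<delta> a * (x $ a)\<^sup>2 + x $ j * u a * x $ a + x $ a * d $ a) - p * (2 * (c $ a * d $ a)) - (if a = j then \<kappa> else 0) \<in> \<int>" for a
    proof (cases "c $ a = 0")
      case True
      then obtain m where m: "x $ a = of_int m" using xi[of a] by (auto elim!: Ints_cases)
      have k: "(if a = j then \<kappa> else 0) = 0" using True by (auto simp: \<kappa>_def)
      have "even (m * (m + 1))" by simp
      then obtain l where "m * (m + 1) = 2 * l" by (elim evenE)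
      then have l: "real_of_int m * (real_of_int m + 1) = 2 * of_int l" by (metis of_int_1 of_int_add of_int_mult of_int_numeral)
      have "(\<delta> a * (x $ a)\<^sup>2 + x $ j * u a * x $ a + x $ a * d $ a) - p * (2 * (c $ a * d $ a)) - (if a = j then \<kappa> else 0) = d $ a * (real_of_int m * (real_of_int m + 1))"
        unfolding k using True by (simp add: \<delta>_def u_def m power2_eq_square algebra_simps)
      also have "\<dots> = (2 * d $ a) * of_int l" unfolding l by simp
      finally show ?thesis using Ints_mult[OF d2 Ints_of_int] by simp
    next
      case False
      then have ca: "c $ a = 1/2" using ch[of a] by simp
      then have cj: "c $ j = 1/2" by (rule j)
      show ?thesis
      proof (cases "a = j")
        case True
        have "(\<delta> a * (x $ a)\<^sup>2 + x $ j * u a * x $ a + x $ a * d $ a) - p * (2 * (c $ a * d $ a)) - (if a = j then \<kappa> else 0) = 0"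
          unfolding True \<delta>_def u_def p_def \<kappa>_def cj by (simp add: algebra_simps)
        then show ?thesis by simp
      next
        case aj: False
        have "(\<delta> a * (x $ a)\<^sup>2 + x $ j * u a * x $ a + x $ a * d $ a) - p * (2 * (c $ a * d $ a)) - (if a = j then \<kappa> else 0) = p * ((2 * d $ a) * (x $ a - c $ a))"
          unfolding \<delta>_def u_def p_def ca cj using aj by (simp add: algebra_simps)
        then show ?thesis using Ints_mult[OF p Ints_mult[OF d2[of a] xi[of a]]] by simp
      qed
    qed
    have "(\<Sum>a\<in>UNIV. (\<delta> a * (x $ a)\<^sup>2 + x $ j * u a * x $ a + x $ a * d $ a) - p * (2 * (c $ a * d $ a)) - (if a = j then \<kappa> else 0)) \<in> \<int>"
      by (intro Ints_sum t)
    moreover have "(\<Sum>a\<in>UNIV. (\<delta> a * (x $ a)\<^sup>2 + x $ j * u a * x $ a + x $ a * d $ a) - p * (2 * (c $ a * d $ a)) - (if a = j then \<kappa> else 0))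
      = (ph x + x \<bullet> d - \<kappa>) - p * (2 * (c \<bullet> d))"
      by (simp add: sum_subtractf sum.distrib ph_def inner_vec_def sum_distrib_left)
    moreover have "2 * (c \<bullet> d) \<in> \<int>"
    proof -
      have "e2pi (of_real (2 * (c \<bullet> d))) = 1" using h by (simp add: parity_class_def char_sign_def c_def d_def)
      then obtain n :: int where "2 * pi * (2 * (c \<bullet> d)) = of_int (2 * n) * pi" unfolding e2pi_def exp_eq_1 by auto
      then have "2 * (c \<bullet> d) = of_int n" by simp
      then show ?thesis by (simp only: Ints_of_int)
    qed
    ultimately show ?thesis using Ints_add[OF _ Ints_mult[OF p], of "(ph x + x \<bullet> d - \<kappa>) - p * (2 * (c \<bullet> d))" "2 * (c \<bullet> d)"]
      by simp
  qed
  have tm: "theta_term c d Z n = e2pi (of_real \<kappa>) * of_real (exp (- pi * (norm (ivec n + c))\<^sup>2))" for n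
  proof -
    let ?x = "ivec n + c"
    have "theta_term c d Z n = e2pi (of_real (ph ?x + ?x \<bullet> d)) * e2pi (\<i> * of_real ((norm ?x)\<^sup>2) / 2)"
      unfolding theta_term_def q by (simp add: add_divide_distrib flip: e2pi_add) (simp add: algebra_simps)
    moreover have "e2pi (of_real (ph ?x + ?x \<bullet> d)) = e2pi (of_real \<kappa>)"
      by (rule e2pi_cong_Ints) (rule phase[OF refl])
    moreover have "e2pi (\<i> * of_real ((norm ?x)\<^sup>2) / 2) = of_real (exp (- pi * (norm ?x)\<^sup>2))"
      by (simp add: e2pi_def flip: exp_of_real)
    ultimately show ?thesis by simp
  qed
  define S where "S = (\<Sum>\<^sub>\<infinity>n. exp (- pi * (norm (ivec n + c))\<^sup>2))"
  have sm: "(\<lambda>n. exp (- pi * (norm (ivec n + c))\<^sup>2)) summable_on UNIV"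
    using summable_on_gauss[of pi c] by simp
  have "theta c d Z = e2pi (of_real \<kappa>) * of_real S"
    unfolding theta_altdef tm S_def
    by (rule infsumI) (intro has_sum_cmult_right has_sum_of_real has_sum_infsum sm)
  \<comment> \<open>With the common phase removed, the series has strictly positive terms.\<close>
  moreover have "S \<noteq> 0"
  proof
    assume "S = 0"
    then have "exp (- pi * (norm (ivec 0 + c))\<^sup>2) = 0"
      unfolding S_def by (rule nonneg_infsum_le_0D[OF eq_refl sm]) auto
    then show False by simp
  qed
  ultimately show ?thesis using \<open>Z \<in> siegel_space\<close> unfolding c_def d_def by (intro bexI[of _ Z]) auto
qed


section \<open>The function \<open>\<Theta>\<close>\<close>

definition joinv :: "real ^ 'g \<Rightarrow> real ^ 'g \<Rightarrow> real ^ ('g::finite + 'g)" where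
  "joinv a b = (\<chi> p. case p of Inl i \<Rightarrow> a $ i | Inr i \<Rightarrow> b $ i)"

lemma lo_joinv [simp]: "lo (joinv a b) = a" and hi_joinv [simp]: "hi (joinv a b) = b"
  by (simp_all add: vec_eq_iff joinv_def)

lemma joinv_lo_hi [simp]: "joinv (lo h) (hi h) = h"
  by (simp add: vec_eq_iff joinv_def split: sum.split)

lemma joinv_in_halves: "joinv a b \<in> halves \<longleftrightarrow> (a, b) \<in> half_characteristics"
proof
  assume "joinv a b \<in> halves"
  then have "joinv a b $ Inl i \<in> {0, 1/2}" "joinv a b $ Inr i \<in> {0, 1/2}" for i unfolding halves_def by blast+
  then show "(a, b) \<in> half_characteristics" by (simp add: joinv_def half_characteristics_def)
qed (simp add: joinv_def half_characteristics_def halves_def split: sum.split)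

lemma joinv_in_parity_class:
  "joinv a b \<in> parity_class (- 1) \<longleftrightarrow> (a, b) \<in> S_minus" "joinv a b \<in> parity_class 1 \<longleftrightarrow> (a, b) \<in> S_plus"
  by (simp_all add: parity_class_def joinv_in_halves S_minus_def S_plus_def char_sign_def dotp_eq_inner)

lemma prod_S_minus: "(\<Prod>(a, b)\<in>S_minus. G a b) = (\<Prod>h\<in>parity_class (- 1). G (lo h) (hi h))"
  by (rule prod.reindex_bij_witness[where j = "\<lambda>(a, b). joinv a b" and i = "\<lambda>h. (lo h, hi h)"])
     (auto simp: joinv_in_parity_class simp flip: joinv_in_parity_class)

lemma prod_S_plus: "(\<Prod>(a, b)\<in>S_plus. G a b) = (\<Prod>h\<in>parity_class 1. G (lo h) (hi h))"
  by (rule prod.reindex_bij_witness[where j = "\<lambda>(a, b). joinv a b" and i = "\<lambda>h. (lo h, hi h)"])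
     (auto simp: joinv_in_parity_class simp flip: joinv_in_parity_class)

lemma lo_diff: "lo (v - w) = lo v - lo w" and hi_diff: "hi (v - w) = hi v - hi w"
  by (simp_all add: vec_eq_iff)

definition theta_prod :: "complex \<Rightarrow> nat \<Rightarrow> nat \<Rightarrow> real ^ ('g::finite + 'g) \<Rightarrow> complex ^ 'g ^ 'g \<Rightarrow> complex" where
  "theta_prod \<sigma> N m w Z = (\<Prod>h\<in>parity_class \<sigma>. theta (lo (h - w)) (hi (h - w)) Z ^ (4 * N * m))"

lemma theta_prod_eq_Qphi:
  fixes w :: "real ^ ('g::finite + 'g)"
  obtains C where "\<And>Z. theta_prod \<sigma> N (theta_exponent TYPE('g) \<sigma>) w Z = C * phi_prod_power \<sigma> N w Z"
proof
  let ?m = "theta_exponent TYPE('g) \<sigma>"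
  fix Z :: "complex ^ 'g ^ 'g"
  have "theta (lo v) (hi v) Z = e2pi (of_real (lo v \<bullet> hi v) / 2) * phi v Z" for v
    by (simp add: phi_def mult.assoc[symmetric] flip: e2pi_add)
  then have "theta_prod \<sigma> N ?m w Z = (\<Prod>h\<in>parity_class \<sigma>. e2pi (of_real (lo (h - w) \<bullet> hi (h - w)) / 2) ^ (4 * N * ?m) * (phi (h - w) Z ^ (4 * N)) ^ ?m)"
    by (simp only: theta_prod_def power_mult_distrib power_mult)
  then show "theta_prod \<sigma> N ?m w Z = (\<Prod>h\<in>parity_class \<sigma>. e2pi (of_real (lo (h - w) \<bullet> hi (h - w)) / 2) ^ (4 * N * ?m)) * phi_prod_power \<sigma> N w Z"
    by (simp only: prod.distrib phi_prod_power_def phi_prod_def prod_power_distrib)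
qed

lemma siegel_holomorphic_theta_prod: "siegel_holomorphic (theta_prod \<sigma> N m w)"
  unfolding theta_prod_def[abs_def]
  by (intro siegel_holomorphic_prod siegel_holomorphic_power siegel_holomorphic_theta)

lemma fourier_over_theta_prod:
  assumes "N > 0" "root_field N K" "w \<in> torsion (real N)"
  shows "fourier_over K (8 * N\<^sup>2) (theta_prod \<sigma> N m w)"
proof -
  have "complex_subfield K" using assms by (simp add: root_field_def)
  then show ?thesis
    unfolding theta_prod_def[abs_def]
    by (intro fourier_over_prod fourier_over_theta_power assms)
qed

lemma theta_prod_nonzero: "\<exists>Z\<in>siegel_space. theta_prod 1 N m (0 :: real ^ ('g::finite + 'g)) Z \<noteq> 0"
  unfolding theta_prod_def
proof (rule siegel_nonzero_prod[OF finite_parity_class])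
  fix h :: "real ^ ('g + 'g)" assume "h \<in> parity_class 1"
  then show "siegel_holomorphic (\<lambda>Z. theta (lo (h - 0)) (hi (h - 0)) Z ^ (4 * N * m)) \<and>
      (\<exists>Z\<in>siegel_space. theta (lo (h - 0)) (hi (h - 0)) Z ^ (4 * N * m) \<noteq> 0)"
    using even_theta_nonzero[of h] by (auto intro!: siegel_holomorphic_power siegel_holomorphic_theta)
next
  have "(0 :: real ^ ('g + 'g)) \<in> parity_class 1" by (simp add: parity_class_def halves_def char_sign_def inner_vec_def)
  then show "(siegel_space :: (complex ^ 'g ^ 'g) set) \<noteq> {}" using even_theta_nonzero by blast
qed

lemma Theta_num_eq:
  fixes r s :: "real ^ 'g"
  shows "Theta_num N r s = (\<lambda>Z. 2 ^ (4 * N) *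
     e2pi (of_real (- (2 ^ CARD('g)) * real N * (2 ^ CARD('g) - 1) * (2 ^ CARD('g) + 1) * dotp r s)) *
     theta_prod (- 1) N (theta_exponent TYPE('g) (- 1)) (joinv r s) Z)"
  unfolding Theta_num_def[abs_def] prod_S_minus theta_prod_def by (simp add: theta_exponent_def lo_diff hi_diff)

lemma Theta_den_eq:
  "Theta_den N = theta_prod 1 N (theta_exponent TYPE('g) 1) (0 :: real ^ ('g::finite + 'g))"
  unfolding Theta_den_def[abs_def] prod_S_plus theta_prod_def[abs_def] by (simp add: theta_exponent_def)

text \<open>The entries of \<gamma> minus the identity are multiples of \<open>N\<close>, and
  \<open>N * w\<close> is integral.\<close>

lemma principal_congruence_tact:
  fixes w :: "real ^ ('g::finite + 'g)"
  assumes g: "\<gamma> \<in> principal_congruence N" and w: "w \<in> torsion (real N)"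
  shows "integral_vec (tact \<gamma> w - w)"
  unfolding integral_vec_def
proof
  fix q
  let ?I = "mat 1 :: int ^ ('g + 'g) ^ ('g + 'g)"
  have "int N dvd \<gamma> $ p $ q - ?I $ p $ q" for p
    using g by (simp add: principal_congruence_def mod_eq_dvd_iff)
  then obtain t where t: "\<And>p. \<gamma> $ p $ q - ?I $ p $ q = int N * t p" unfolding dvd_def by metis
  have "(tact \<gamma> w - w) $ q = (tact \<gamma> w - tact ?I w) $ q" by (simp add: tact_one)
  also have "\<dots> = (\<Sum>p\<in>UNIV. of_int (\<gamma> $ p $ q - ?I $ p $ q) * w $ p)"
    by (simp add: tact_def sum_subtractf left_diff_distrib)
  also have "\<dots> = (\<Sum>p\<in>UNIV. of_int (t p) * (real N * w $ p))"
    unfolding t by (simp add: mult_ac)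
  also have "\<dots> \<in> \<int>" using w by (intro Ints_sum Ints_mult[OF Ints_of_int]) (simp add: torsion_def)
  finally show "(tact \<gamma> w - w) $ q \<in> \<int>" .
qed

lemma principal_congruence_antimono:
  assumes "N dvd M" shows "principal_congruence M \<subseteq> principal_congruence N"
  using assms by (auto simp: principal_congruence_def mod_eq_dvd_iff) (meson dvd_trans int_dvd_int_iff)

lemma fourier_over_cong:
  "(\<And>Z. Z \<in> siegel_space \<Longrightarrow> f Z = g Z) \<Longrightarrow> fourier_over K M f \<Longrightarrow> fourier_over K M g"
  unfolding fourier_over_def has_fourier_expansion_def by simp

text \<open>Multiplying numerator and denominator by the denominator squares the sign character \<open>\<kappa>\<close> away.\<close>

theorem proposition4p5:
  fixes N :: nat and r s :: "real ^ 'g"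
  assumes "N > 0"
    and "\<forall>i. real N * r $ i \<in> \<int>"
    and "\<forall>i. real N * s $ i \<in> \<int>"
  shows "Theta N r s \<in> siegel_functions N (cyclotomic_field N)"
proof -
  let ?K = "cyclotomic_field N" and ?M = "8 * N\<^sup>2" and ?n = "theta_weight TYPE('g) N"
  define w where "w = joinv r s"
  define p q where "p = Theta_num N r s" and "q = (Theta_den N :: complex ^ 'g ^ 'g \<Rightarrow> complex)"
  have w: "w \<in> torsion (real N)"
    using assms(2,3) by (simp add: torsion_def w_def joinv_def split: sum.split)
  have w0: "0 \<in> torsion (real N)" by (simp add: torsion_def)
  have K: "root_field N ?K" and K': "complex_subfield ?K"
    using root_field_cyclotomic[OF assms(1)] by (simp_all add: root_field_def)
  define C0 :: complex where "C0 = 2 ^ (4 * N) *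
     e2pi (of_real (- (2 ^ CARD('g)) * real N * (2 ^ CARD('g) - 1) * (2 ^ CARD('g) + 1) * dotp r s))"
  have p: "p = (\<lambda>Z. C0 * theta_prod (- 1) N (theta_exponent TYPE('g) (- 1)) w Z)"
    unfolding p_def Theta_num_eq C0_def w_def ..
  have q: "q = theta_prod 1 N (theta_exponent TYPE('g) 1) 0" unfolding q_def by (rule Theta_den_eq)
  obtain C1 where "\<And>Z. theta_prod (- 1) N (theta_exponent TYPE('g) (- 1)) w Z = C1 * phi_prod_power (- 1) N w Z"
    by (rule theta_prod_eq_Qphi[of "- 1" N w]) blast
  then have pQ: "p Z = C0 * C1 * phi_prod_power (- 1) N w Z" for Z by (simp add: p)
  obtain C2 where qQ: "\<And>Z. q Z = C2 * phi_prod_power 1 N 0 Z"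
    unfolding q by (rule theta_prod_eq_Qphi[of 1 N 0]) blast
  \<comment> \<open>Multiplied by \<open>N\<close>, the argument of the exponential is an integer
    multiple of the inner product of \<open>N * r\<close> and \<open>N * s\<close>, so the
    exponential is an \<open>N\<close>th root of unity.\<close>
  have C0: "C0 \<in> ?K"
  proof -
    have "((real N *\<^sub>R r) \<bullet> (real N *\<^sub>R s)) \<in> \<int>"
      using assms(2,3) by (intro Ints_inner) (simp add: Ints_mult)
    then have "of_int (- (2 ^ CARD('g)) * (2 ^ CARD('g) - 1) * (2 ^ CARD('g) + 1)) * ((real N *\<^sub>R r) \<bullet> (real N *\<^sub>R s)) \<in> \<int>"
      by (intro Ints_mult[OF Ints_of_int])
    moreover have "of_int (- (2 ^ CARD('g)) * (2 ^ CARD('g) - 1) * (2 ^ CARD('g) + 1)) * ((real N *\<^sub>R r) \<bullet> (real N *\<^sub>R s))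
      = real N * (- (2 ^ CARD('g)) * real N * (2 ^ CARD('g) - 1) * (2 ^ CARD('g) + 1) * dotp r s)"
      by (simp add: dotp_eq_inner mult_ac)
    ultimately have "e2pi (of_real (- (2 ^ CARD('g)) * real N * (2 ^ CARD('g) - 1) * (2 ^ CARD('g) + 1) * dotp r s)) \<in> ?K"
      using K unfolding root_field_def by metis
    moreover have "(2 :: complex) \<in> ?K"
      using complex_subfield_add[OF K' complex_subfieldD(2)[OF K'] complex_subfieldD(2)[OF K']] by simp
    ultimately show ?thesis
      unfolding C0_def by (intro complex_subfieldD(4)[OF K'] complex_subfield_power[OF K'])
  qed
  have hol: "siegel_holomorphic p" "siegel_holomorphic q"
    unfolding p q by (intro siegel_holomorphic_mult siegel_holomorphic_const siegel_holomorphic_theta_prod)+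
  have nz: "\<exists>Z\<in>siegel_space. q Z \<noteq> 0" unfolding q by (rule theta_prod_nonzero)
  have fo: "fourier_over ?K ?M p" "fourier_over ?K ?M q"
    unfolding p q by (intro fourier_over_mult fourier_over_const fourier_over_theta_prod K K' C0 assms(1) w w0)+
  have mono: "principal_congruence ?M \<subseteq> (principal_congruence N :: (int ^ ('g + 'g) ^ ('g + 'g)) set)"
    by (rule principal_congruence_antimono) (simp add: power2_eq_square)
  \<comment> \<open>Holds on the whole symplectic group. The denominator has characteristic 0, fixed
    by \<open>tact \<gamma>\<close>; the numerator moves to the characteristic
    \<open>tact \<gamma> w\<close>, which returns to \<open>w\<close> modulo integers on
    \<Gamma>(N).\<close>
  have tr: "\<exists>\<kappa>. \<kappa>\<^sup>2 = 1 \<and> (\<forall>Z\<in>siegel_space. q (sp_act \<gamma> Z) = \<kappa> * aut_factor \<gamma> Z ^ ?n * q Z \<and>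
      p (sp_act \<gamma> Z) = \<kappa> * aut_factor \<gamma> Z ^ ?n * (C0 * C1 * phi_prod_power (- 1) N (tact \<gamma> w) Z))" if "\<gamma> \<in> Sp_int" for \<gamma>
  proof -
    have "\<gamma> \<in> spgen" using that Sp_int_subset_spgen by blast
    then obtain \<kappa> where \<kappa>: "\<kappa>\<^sup>2 = 1" "\<And>\<sigma> w Z. \<sigma> \<in> {1, - 1} \<Longrightarrow> w \<in> torsion (real N) \<Longrightarrow> Z \<in> siegel_space \<Longrightarrow>
       phi_prod_power \<sigma> N w (sp_act \<gamma> Z) = \<kappa> * aut_factor \<gamma> Z ^ ?n * phi_prod_power \<sigma> N (tact \<gamma> w) Z"
      using phi_prod_power_transform[of \<gamma> N] by blast
    have "tact \<gamma> 0 = 0" by (simp add: tact_def vec_eq_iff)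
    then have "q (sp_act \<gamma> Z) = \<kappa> * aut_factor \<gamma> Z ^ ?n * q Z" if "Z \<in> siegel_space" for Z
      using \<kappa>(2)[of 1 0 Z, OF _ w0 that] by (simp add: qQ mult_ac)
    moreover have "p (sp_act \<gamma> Z) = \<kappa> * aut_factor \<gamma> Z ^ ?n * (C0 * C1 * phi_prod_power (- 1) N (tact \<gamma> w) Z)" if "Z \<in> siegel_space" for Z
      using \<kappa>(2)[of "- 1" w Z, OF _ w that] by (simp add: pQ mult_ac)
    ultimately show ?thesis using \<kappa>(1) by blast
  qed
  have trN: "p (sp_act \<gamma> Z) * q Z = p Z * q (sp_act \<gamma> Z)"
    "p (sp_act \<gamma> Z) * q (sp_act \<gamma> Z) = aut_factor \<gamma> Z ^ (2 * ?n) * (p Z * q Z)"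
    if g: "\<gamma> \<in> principal_congruence N" and Z: "Z \<in> siegel_space" for \<gamma> Z
  proof -
    have "\<gamma> \<in> Sp_int" using g by (simp add: principal_congruence_def)
    from tr[OF this] obtain \<kappa> where \<kappa>: "\<kappa>\<^sup>2 = 1" "q (sp_act \<gamma> Z) = \<kappa> * aut_factor \<gamma> Z ^ ?n * q Z"
      "p (sp_act \<gamma> Z) = \<kappa> * aut_factor \<gamma> Z ^ ?n * (C0 * C1 * phi_prod_power (- 1) N (tact \<gamma> w) Z)"
      using Z by blast
    have "phi_prod_power (- 1) N (tact \<gamma> w) Z = phi_prod_power (- 1) N w Z"
      unfolding phi_prod_power_def phi_prod_periodic[OF w principal_congruence_tact[OF g w]] ..
    then have pg: "p (sp_act \<gamma> Z) = \<kappa> * aut_factor \<gamma> Z ^ ?n * p Z" using \<kappa>(3) by (simp add: pQ)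
    show "p (sp_act \<gamma> Z) * q Z = p Z * q (sp_act \<gamma> Z)" unfolding pg \<kappa>(2) by simp
    have "p (sp_act \<gamma> Z) * q (sp_act \<gamma> Z) = \<kappa>\<^sup>2 * (aut_factor \<gamma> Z ^ (2 * ?n) * (p Z * q Z))"
      unfolding pg \<kappa>(2) by (simp add: power2_eq_square mult_2 mult_2_right power_add mult_ac)
    then show "p (sp_act \<gamma> Z) * q (sp_act \<gamma> Z) = aut_factor \<gamma> Z ^ (2 * ?n) * (p Z * q Z)" using \<kappa>(1) by simp
  qed
  have trq: "q (sp_act \<gamma> Z) * q (sp_act \<gamma> Z) = aut_factor \<gamma> Z ^ (2 * ?n) * (q Z * q Z)"
    if g: "\<gamma> \<in> Sp_int" and Z: "Z \<in> siegel_space" for \<gamma> Z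
  proof -
    obtain \<kappa> where \<kappa>: "\<kappa>\<^sup>2 = 1" "q (sp_act \<gamma> Z) = \<kappa> * aut_factor \<gamma> Z ^ ?n * q Z" using tr[OF g] Z by blast
    have "q (sp_act \<gamma> Z) * q (sp_act \<gamma> Z) = \<kappa>\<^sup>2 * (aut_factor \<gamma> Z ^ (2 * ?n) * (q Z * q Z))"
      unfolding \<kappa>(2) by (simp add: power2_eq_square mult_2 mult_2_right power_add mult_ac)
    then show ?thesis using \<kappa>(1) by simp
  qed
  have trp: "p (sp_act \<gamma> Z) * q (sp_act \<gamma> Z) = aut_factor \<gamma> Z ^ (2 * ?n) * (C0 * C1 * phi_prod_power (- 1) N (tact \<gamma> w) Z * q Z)"
    if g: "\<gamma> \<in> Sp_int" and Z: "Z \<in> siegel_space" for \<gamma> Z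
  proof -
    obtain \<kappa> where \<kappa>: "\<kappa>\<^sup>2 = 1" "q (sp_act \<gamma> Z) = \<kappa> * aut_factor \<gamma> Z ^ ?n * q Z"
      "p (sp_act \<gamma> Z) = \<kappa> * aut_factor \<gamma> Z ^ ?n * (C0 * C1 * phi_prod_power (- 1) N (tact \<gamma> w) Z)" using tr[OF g] Z by blast
    have "p (sp_act \<gamma> Z) * q (sp_act \<gamma> Z) = \<kappa>\<^sup>2 * (aut_factor \<gamma> Z ^ (2 * ?n) * (C0 * C1 * phi_prod_power (- 1) N (tact \<gamma> w) Z * q Z))"
      unfolding \<kappa>(2,3) by (simp add: power2_eq_square mult_2 mult_2_right power_add mult_ac)
    then show ?thesis using \<kappa>(1) by simp
  qed
  have U: "complex_subfield UNIV" by (simp add: complex_subfield_def)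
  \<comment> \<open>The witness \<open>g\<close> in the cusp condition is the transform of
    \<open>f\<close> with its automorphy factor removed; dividing is legitimate since that factor
    never vanishes.\<close>
  have form: "f \<in> modular_forms_over (int (2 * ?n)) ?K"
    if "siegel_holomorphic f" and fo: "fourier_over ?K ?M f"
      and inv: "\<And>\<gamma> Z. \<gamma> \<in> principal_congruence ?M \<Longrightarrow> Z \<in> siegel_space \<Longrightarrow> f (sp_act \<gamma> Z) = aut_factor \<gamma> Z ^ (2 * ?n) * f Z"
      and cusp: "\<And>\<gamma>. \<gamma> \<in> Sp_int \<Longrightarrow> \<exists>g. fourier_over UNIV ?M g \<and> (\<forall>Z\<in>siegel_space. f (sp_act \<gamma> Z) = aut_factor \<gamma> Z ^ (2 * ?n) * g Z)"
    for f :: "complex ^ 'g ^ 'g \<Rightarrow> complex"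
    unfolding modular_forms_over_def siegel_modular_form_def
  proof (intro CollectI exI[of _ ?M] conjI ballI impI)
    show "1 \<le> ?M" using assms(1) by simp
    show "siegel_holomorphic f" by fact
    show "f (sp_act \<gamma> Z) = aut_factor \<gamma> Z powi int (2 * ?n) * f Z"
      if "\<gamma> \<in> principal_congruence ?M" "Z \<in> siegel_space" for \<gamma> Z
      using inv[OF that] unfolding power_int_of_nat .
    show "\<exists>c. has_fourier_expansion ?M f c \<and> (\<forall>\<beta>\<in>fourier_index. c \<beta> \<in> ?K)"
      using fo by (simp add: fourier_over_def)
    fix \<gamma> :: "int ^ ('g + 'g) ^ ('g + 'g)" assume g: "\<gamma> \<in> Sp_int"
    obtain h where h: "fourier_over UNIV ?M h" "\<And>Z. Z \<in> siegel_space \<Longrightarrow> f (sp_act \<gamma> Z) = aut_factor \<gamma> Z ^ (2 * ?n) * h Z"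
      using cusp[OF g] by blast
    have "h Z = aut_factor \<gamma> Z powi (- int (2 * ?n)) * f (sp_act \<gamma> Z)" if "Z \<in> siegel_space" for Z
      unfolding power_int_minus power_int_of_nat using h(2)[OF that] Sp_int_act(2)[OF g that] by simp
    from fourier_over_cong[OF this h(1)]
    show "\<exists>c. has_fourier_expansion ?M (\<lambda>Z. aut_factor \<gamma> Z powi (- int (2 * ?n)) * f (sp_act \<gamma> Z)) c"
      by (auto simp: fourier_over_def)
  qed
  have sp: "\<gamma> \<in> Sp_int" if "\<gamma> \<in> principal_congruence ?M" for \<gamma> :: "int ^ ('g + 'g) ^ ('g + 'g)"
    using that by (simp add: principal_congruence_def)
  have fU: "fourier_over UNIV ?M q" using fo(2) by (auto simp: fourier_over_def)
  have f1: "(\<lambda>Z. p Z * q Z) \<in> modular_forms_over (int (2 * ?n)) ?K"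
  proof (rule form)
    show "siegel_holomorphic (\<lambda>Z. p Z * q Z)" by (intro siegel_holomorphic_mult hol)
    show "fourier_over ?K ?M (\<lambda>Z. p Z * q Z)" by (intro fourier_over_mult fo K')
    show "p (sp_act \<gamma> Z) * q (sp_act \<gamma> Z) = aut_factor \<gamma> Z ^ (2 * ?n) * (p Z * q Z)"
      if "\<gamma> \<in> principal_congruence ?M" "Z \<in> siegel_space" for \<gamma> Z
      using trN(2) mono that by blast
    fix \<gamma> :: "int ^ ('g + 'g) ^ ('g + 'g)" assume g: "\<gamma> \<in> Sp_int"
    \<comment> \<open>At another cusp the numerator is the same kind of product at a characteristic
      that is again \<open>N\<close>-torsion, so the level \<open>8 * N^2\<close> serves every
      cusp.\<close>
    have "fourier_over UNIV ?M (\<lambda>Z. C0 * C1 * phi_prod_power (- 1) N (tact \<gamma> w) Z * q Z)"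
      by (intro fourier_over_mult fourier_over_const fourier_over_Qphi fU U UNIV_I assms(1) tact_integral w)
    then show "\<exists>g. fourier_over UNIV ?M g \<and> (\<forall>Z\<in>siegel_space. p (sp_act \<gamma> Z) * q (sp_act \<gamma> Z) = aut_factor \<gamma> Z ^ (2 * ?n) * g Z)"
      using trp[OF g] by blast
  qed
  have f2: "(\<lambda>Z. q Z * q Z) \<in> modular_forms_over (int (2 * ?n)) ?K"
  proof (rule form)
    show "siegel_holomorphic (\<lambda>Z. q Z * q Z)" by (intro siegel_holomorphic_mult hol)
    show "fourier_over ?K ?M (\<lambda>Z. q Z * q Z)" by (intro fourier_over_mult fo K')
    show "q (sp_act \<gamma> Z) * q (sp_act \<gamma> Z) = aut_factor \<gamma> Z ^ (2 * ?n) * (q Z * q Z)"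
      if "\<gamma> \<in> principal_congruence ?M" "Z \<in> siegel_space" for \<gamma> Z
      by (rule trq[OF sp[OF that(1)] that(2)])
    fix \<gamma> :: "int ^ ('g + 'g) ^ ('g + 'g)" assume g: "\<gamma> \<in> Sp_int"
    show "\<exists>g. fourier_over UNIV ?M g \<and> (\<forall>Z\<in>siegel_space. q (sp_act \<gamma> Z) * q (sp_act \<gamma> Z) = aut_factor \<gamma> Z ^ (2 * ?n) * g Z)"
      using trq[OF g] fourier_over_mult[OF U fU fU] by blast
  qed
  show ?thesis
    unfolding siegel_functions_def Theta_def p_def[symmetric] q_def[symmetric]
  proof (intro CollectI conjI ballI)
    show "siegel_meromorphic (p, q)" using hol nz by (simp add: siegel_meromorphic_def)
    show "\<exists>k f1 f2. f1 \<in> modular_forms_over k ?K \<and> f2 \<in> modular_forms_over k ?K \<and>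
        (\<exists>Z\<in>siegel_space. f2 Z \<noteq> 0) \<and> fraction_eq (p, q) (f1, f2)"
    proof (intro exI conjI)
      show "(\<lambda>Z. p Z * q Z) \<in> modular_forms_over (int (2 * ?n)) ?K" by (rule f1)
      show "(\<lambda>Z. q Z * q Z) \<in> modular_forms_over (int (2 * ?n)) ?K" by (rule f2)
      show "\<exists>Z\<in>siegel_space. q Z * q Z \<noteq> 0" using nz by simp
      show "fraction_eq (p, q) (\<lambda>Z. p Z * q Z, \<lambda>Z. q Z * q Z)" by (simp add: fraction_eq_def)
    qed
    show "fraction_eq (fraction_act \<gamma> (p, q)) (p, q)" if "\<gamma> \<in> principal_congruence N" for \<gamma>
      using trN(1)[OF that] by (simp add: fraction_eq_def fraction_act_def)
  qed
qed

end
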